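(* Let $G=(V,E)$ be a $d$-regular graph with $n$ vertices and set $\lambda=\lambda(G)$. Then $$H(G) \ge \max\left(1-\frac{2\lambda}{d},\ \frac{d-\lambda}{d+3\lambda}\right) n = \left(1-\min\left(\frac{2\lambda}{d},\ \frac{4\lambda}{d+3\lambda}\right)\right) n.$$ As a result, for any fixed integer $d\ge 3$ and any $\varepsilon>0$, asymptotically almost surely $$H(\mathcal{G}_{n,d}) \ge \left(1-\min\left(\frac{4\sqrt{d-1}}{d},\ \frac{8\sqrt{d-1}}{d+6\sqrt{d-1}}\right)-\varepsilon\right) n.$$
   Context: Hopping forcing: given a graph $G$ with each vertex coloured blue or white, the hopping forcing rule allows a blue vertex $b$ to force (recolour blue) a white vertex $w$ at distance exactly two from $b$, provided that every neighbour of $b$ is blue and $b$ has not previously performed a force (each vertex can perform at most one force). A set $B\subseteq V(G)$ is feasible if, starting with exactly the vertices of $B$ blue, repeated sequential applications of the rule can make all vertices blue. The hopping forcing number $H(G)$ is the minimum size of a feasible set. For a $d$-regular graph $G$ with adjacency eigenvalues $\lambda_1=d\ge\lambda_2\ge\cdots\ge\lambda_n$, $\lambda(G)=\max(|\lambda_2|,|\lambda_n|)$. $\mathcal{G}_{n,d}$ is a uniformly random $d$-regular simple graph on $n$ labelled vertices ($dn$ even), $d$ fixed, $n\to\infty$; an event holds asymptotically almost surely (a.a.s.) if its probability tends to $1$ as $n\to\infty$. *)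

theory Defs
  imports
    "HOL-Probability.Probability"
    "HOL-Library.Extended_Nat"
    "Jordan_Normal_Form.Char_Poly"
begin

section \<open>Finite simple graphs\<close>

text \<open>A graph is given by its vertex set \<open>V\<close> and its set \<open>E\<close> of edges, each edge being a
  two-element subset of \<open>V\<close>.\<close>

definition simple_graph :: "'a set \<Rightarrow> 'a set set \<Rightarrow> bool" where
  "simple_graph V E \<longleftrightarrow> finite V \<and> (\<forall>e\<in>E. e \<subseteq> V \<and> card e = 2)"

definition neighbours :: "'a set set \<Rightarrow> 'a \<Rightarrow> 'a set" where
  "neighbours E v = {u. {v, u} \<in> E}"

definition regular_graph :: "nat \<Rightarrow> 'a set \<Rightarrow> 'a set set \<Rightarrow> bool" where
  "regular_graph d V E \<longleftrightarrow> simple_graph V E \<and> (\<forall>v\<in>V. card (neighbours E v) = d)"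

text \<open>A pair is in the \<open>k\<close>-th relational power of adjacency iff it is joined by a walk of
  length \<open>k\<close>; vertices in different components are at distance \<open>\<infinity>\<close>.\<close>

definition graph_dist :: "'a set set \<Rightarrow> 'a \<Rightarrow> 'a \<Rightarrow> enat" where
  "graph_dist E u v = (INF k\<in>{k. (u, v) \<in> {(x, y). {x, y} \<in> E} ^^ k}. enat k)"


section \<open>Hopping forcing\<close>

text \<open>In a state of the process, \<open>B\<close> is the set of blue vertices and \<open>U\<close> is the set of vertices
  that have already performed a force.\<close>

definition can_hop :: "'a set \<Rightarrow> 'a set set \<Rightarrow> 'a set \<Rightarrow> 'a set \<Rightarrow> 'a \<Rightarrow> 'a \<Rightarrow> bool" where
  "can_hop V E B U b w \<longleftrightarrow>
     b \<in> B \<and> b \<notin> U \<and> neighbours E b \<subseteq> B \<and> w \<in> V \<and> w \<notin> B \<and> graph_dist E b w = 2"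

inductive hopping_reachable ::
    "'a set \<Rightarrow> 'a set set \<Rightarrow> 'a set \<Rightarrow> 'a set \<Rightarrow> 'a set \<Rightarrow> bool"
  for V E B0 where
  start: "hopping_reachable V E B0 B0 {}"
| force: "hopping_reachable V E B0 B U \<Longrightarrow> can_hop V E B U b w \<Longrightarrow>
            hopping_reachable V E B0 (insert w B) (insert b U)"

definition hopping_feasible :: "'a set \<Rightarrow> 'a set set \<Rightarrow> 'a set \<Rightarrow> bool" where
  "hopping_feasible V E B \<longleftrightarrow> B \<subseteq> V \<and> (\<exists>U. hopping_reachable V E B V U)"

definition hopping_number :: "'a set \<Rightarrow> 'a set set \<Rightarrow> nat" where
  "hopping_number V E = Min (card ` {B. hopping_feasible V E B})"

text \<open>For finite \<open>V\<close> the minimum is over a finite nonempty set.\<close>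

lemma finite_hopping_feasible: "finite V \<Longrightarrow> finite {B. hopping_feasible V E B}"
  by (rule finite_subset[of _ "Pow V"]) (auto simp: hopping_feasible_def)

lemma hopping_feasible_all: "hopping_feasible V E V"
  unfolding hopping_feasible_def by (auto intro: hopping_reachable.start)


section \<open>Adjacency eigenvalues\<close>

text \<open>The matrix library indexes rows and columns by natural numbers, so the vertices have to be
  enumerated; by \<open>adj_eigenvalues_enum\<close> below, the enumeration does not matter.\<close>

definition adj_matrix :: "'a set set \<Rightarrow> nat \<Rightarrow> (nat \<Rightarrow> 'a) \<Rightarrow> real mat" where
  "adj_matrix E n f = mat n n (\<lambda>(i, j). of_bool ({f i, f j} \<in> E))"

definition vertex_enum :: "'a set \<Rightarrow> nat \<Rightarrow> 'a" where
  "vertex_enum V = (SOME f. bij_betw f {..<card V} V)"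

text \<open>The eigenvalues, with multiplicity and in non-increasing order:
  \<open>adj_eigenvalues V E ! (i - 1)\<close> is \<open>\<lambda>\<^sub>i\<close>.\<close>

definition adj_eigenvalues :: "'a set \<Rightarrow> 'a set set \<Rightarrow> real list" where
  "adj_eigenvalues V E =
     rev (sorted_list_of_multiset (proots (char_poly (adj_matrix E (card V) (vertex_enum V)))))"

text \<open>\<open>\<lambda>(G) = max(|\<lambda>\<^sub>2|, |\<lambda>\<^sub>n|)\<close>, meaningful only for graphs with at least two vertices.\<close>

definition graph_lambda :: "'a set \<Rightarrow> 'a set set \<Rightarrow> real" where
  "graph_lambda V E =
     max \<bar>adj_eigenvalues V E ! 1\<bar> \<bar>adj_eigenvalues V E ! (card V - 1)\<bar>"

lemma adj_matrix_carrier [simp]: "adj_matrix E n f \<in> carrier_mat n n"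
  by (simp add: adj_matrix_def)

lemma adj_eigenvalues_enum:
  assumes "finite V" and f: "bij_betw f {..<card V} V"
  shows "adj_eigenvalues V E =
    rev (sorted_list_of_multiset (proots (char_poly (adj_matrix E (card V) f))))"
proof -
  define n where "n = card V"
  define g where "g = vertex_enum V"
  have g: "bij_betw g {..<n} V"
    unfolding g_def vertex_enum_def n_def by (rule someI[of _ f]) (rule f)
  define h where "h = inv_into {..<n} f \<circ> g"
  have h: "bij_betw h {..<n} {..<n}"
    unfolding h_def by (rule bij_betw_trans[OF g]) (use f n_def in \<open>auto intro: bij_betw_inv_into\<close>)
  have fh: "f (h i) = g i" if "i < n" for i
    using that g f unfolding h_def n_def
    by (auto simp: bij_betw_def intro!: f_inv_into_f)
  have hlt: "h i < n" if "i < n" for i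
    using h that by (auto simp: bij_betw_def)
  have hinj: "h i = h j \<longleftrightarrow> i = j" if "i < n" "j < n" for i j
    using h that by (auto simp: bij_betw_def inj_on_def)
  define P where "P = mat n n (\<lambda>(i, j). of_bool (j = h i) :: real)"
  have P: "P \<in> carrier_mat n n" by (simp add: P_def)
  have sum1: "(\<Sum>k = 0..<n. of_bool (k = h i) * F k) = (F (h i) :: real)" if "i < n" for i F
    using hlt[OF that] by (simp add: of_bool_def if_distrib if_distribR sum.delta cong: if_cong)
  have single: "{0..<n} \<inter> {h i} = {h i}" if "i < n" for i
    using hlt[OF that] by auto
  have PPT: "P * P\<^sup>T = 1\<^sub>m n"
    by (rule eq_matI) (auto simp: P_def scalar_prod_def sum1 hinj single)
  have PTP: "P\<^sup>T * P = 1\<^sub>m n"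
    using PPT P mat_mult_left_right_inverse[of P n "P\<^sup>T"] by auto
  have PA: "P * adj_matrix E n f = mat n n (\<lambda>(i, j). of_bool ({g i, f j} \<in> E))"
    by (rule eq_matI) (auto simp: P_def adj_matrix_def scalar_prod_def sum1 fh single)
  have PAP: "P * adj_matrix E n f * P\<^sup>T = adj_matrix E n g"
    unfolding PA
    by (rule eq_matI)
       (auto simp: P_def adj_matrix_def scalar_prod_def sum1 fh single mult.commute[of _ "of_bool (_ = _)"])
  have "similar_mat (adj_matrix E n g) (adj_matrix E n f)"
    unfolding similar_mat_def similar_mat_wit_def
    by (rule exI[of _ P], rule exI[of _ "P\<^sup>T"])
       (use P PPT PTP PAP in \<open>auto simp: Let_def adj_matrix_def\<close>)
  from char_poly_similar[OF this] show ?thesis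
    by (simp add: adj_eigenvalues_def n_def g_def)
qed

lemma adj_matrix_root_real:
  fixes z :: complex
  assumes z: "poly (map_poly of_real (char_poly (adj_matrix E n f))) z = 0"
  shows "z \<in> \<real>"
proof -
  define A where "A = adj_matrix E n f"
  define C where "C = map_mat complex_of_real A"
  have A: "A \<in> carrier_mat n n" and C: "C \<in> carrier_mat n n"
    by (auto simp: A_def C_def)
  have "char_poly C = map_poly of_real (char_poly A)"
    unfolding C_def using of_real_hom.char_poly_hom[OF A, where 'a = complex] by simp
  hence "eigenvalue C z"
    using z eigenvalue_root_char_poly[OF C] by (simp add: A_def)
  then obtain v where v: "v \<in> carrier_vec n" "v \<noteq> 0\<^sub>v n" "C *\<^sub>v v = z \<cdot>\<^sub>v v"
    using C by (auto simp: eigenvalue_def eigenvector_def)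
  define a where "a i j = complex_of_real (of_bool ({f i, f j} \<in> E))" for i j
  have eq: "(\<Sum>j = 0..<n. a i j * vec_index v j) = z * vec_index v i" if "i < n" for i
  proof -
    have "vec_index (C *\<^sub>v v) i = (\<Sum>j = 0..<n. a i j * vec_index v j)"
      using that v(1) by (auto simp: C_def A_def adj_matrix_def scalar_prod_def a_def)
    thus ?thesis using v that by simp
  qed
  define s where "s = (\<Sum>i = 0..<n. \<Sum>j = 0..<n. a i j * vec_index v j * cnj (vec_index v i))"
  define r where "r = (\<Sum>i = 0..<n. (cmod (vec_index v i))\<^sup>2)"
  have "s = (\<Sum>i = 0..<n. (z * vec_index v i) * cnj (vec_index v i))"
    unfolding s_def by (rule sum.cong) (auto simp: eq[symmetric] sum_distrib_right)
  also have "\<dots> = z * of_real r"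
    unfolding r_def by (simp add: sum_distrib_left mult.assoc complex_norm_square[symmetric] del: of_real_power)
  finally have s: "s = z * of_real r" .
  have "cnj s = (\<Sum>i = 0..<n. \<Sum>j = 0..<n. a j i * cnj (vec_index v j) * vec_index v i)"
    unfolding s_def by (simp add: a_def insert_commute)
  also have "\<dots> = s"
    unfolding s_def by (subst sum.swap) (simp add: mult_ac)
  finally have cs: "cnj s = s" .
  obtain i where i: "i < n" "vec_index v i \<noteq> 0"
    using v by (metis carrier_vecD dim_vec eq_vecI index_zero_vec(1) index_zero_vec(2))
  have "r > 0"
    unfolding r_def by (rule sum_pos2[of _ i]) (use i in auto)
  hence "cnj z = z" using cs s by simp
  thus ?thesis by (simp add: Reals_cnj_iff)
qed

lemma size_proots_real:
  fixes p :: "real poly"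
  assumes "p \<noteq> 0" "\<And>z :: complex. poly (map_poly of_real p) z = 0 \<Longrightarrow> z \<in> \<real>"
  shows "size (proots p) = degree p"
  using assms
proof (induction "degree p" arbitrary: p)
  case 0
  then show ?case using size_proots_le[of p] by simp
next
  case (Suc m)
  interpret hom: map_poly_comm_ring_hom "complex_of_real" ..
  have "\<not> constant (poly (map_poly complex_of_real p))"
    using Suc.hyps(2) by (simp add: constant_degree)
  then obtain z where z: "poly (map_poly complex_of_real p) z = 0"
    using fundamental_theorem_of_algebra by blast
  with Suc.prems(2) obtain x where x: "z = of_real x" by (auto elim: Reals_cases)
  have "poly p x = 0" using z unfolding x by (simp add: of_real_hom.poly_map_poly)
  then obtain q where q: "p = [:-x, 1:] * q" by (auto simp: poly_eq_0_iff_dvd elim: dvdE)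
  have q0: "q \<noteq> 0" using q Suc.prems(1) by auto
  have deg: "degree p = Suc (degree q)"
    unfolding q using q0 by (subst degree_mult_eq) auto
  have "size (proots q) = degree q"
  proof (rule Suc.hyps(1))
    show "m = degree q" using Suc.hyps(2) deg by simp
    show "w \<in> \<real>" if "poly (map_poly complex_of_real q) w = 0" for w
      by (rule Suc.prems(2)) (use that in \<open>simp only: q hom.hom_mult poly_mult mult_zero_right\<close>)
  qed (rule q0)
  moreover have "proots p = {#x#} + proots q"
    unfolding q using q0 by (subst proots_mult) auto
  ultimately show ?case using deg by simp
qed

text \<open>All \<open>n\<close> complex eigenvalues are real, so the list above has length \<open>n\<close>.\<close>

lemma length_adj_eigenvalues: "length (adj_eigenvalues V E) = card V"
proof -
  let ?p = "char_poly (adj_matrix E (card V) (vertex_enum V))"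
  have "degree ?p = card V" "coeff ?p (degree ?p) = 1"
    using degree_monic_char_poly[OF adj_matrix_carrier, of E "card V" "vertex_enum V"] by auto
  moreover from this have "?p \<noteq> 0" by auto
  ultimately have "size (proots ?p) = card V"
    using size_proots_real[of ?p] adj_matrix_root_real by auto
  thus ?thesis
    unfolding adj_eigenvalues_def by (metis length_rev mset_sorted_list_of_multiset size_mset)
qed


section \<open>Random regular graphs\<close>

text \<open>\<open>\<G>\<^sub>n\<^sub>,\<^sub>d\<close> as a distribution on the edge set, on the labels \<open>0, \<dots>, n - 1\<close>. It is unspecified for
  the pairs \<open>n\<close>, \<open>d\<close> for which no such graph exists (\<open>d n\<close> odd, or \<open>0 < n \<le> d\<close>).\<close>

definition random_regular :: "nat \<Rightarrow> nat \<Rightarrow> nat set set pmf" where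
  "random_regular n d = pmf_of_set {E. regular_graph d {..<n} E}"

end

theory Submission
  imports Defs "Jordan_Normal_Form.Schur_Decomposition" "HOL-Combinatorics.Multiset_Permutations"
begin

text \<open>Let the forces of a successful run be \<open>b\<^sub>i \<rightarrow> w\<^sub>i\<close> for \<open>i < k = n - |B|\<close>. When \<open>b\<^sub>i\<close> forces, it and
  its neighbours are blue while \<open>w\<^sub>j\<close> is still white for \<open>j \<ge> i\<close>. So the first half of the \<open>b\<^sub>i\<close> and the
  last half of the \<open>w\<^sub>j\<close> are two disjoint sets of size \<open>s \<ge> k / 2\<close> with no edges between them.
  The quadratic form of the adjacency matrix at \<open>1\<^sub>S - 1\<^sub>T\<close> and at \<open>1\<^sub>S + 1\<^sub>T - 2 s / n\<close> then yields
  \<open>d s \<le> \<lambda> (n - s)\<close>, that is \<open>H \<ge> (d - \<lambda>) / (d + \<lambda>) n\<close>, which is stronger than both bounds.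

  This slack makes Friedman's theorem on \<open>\<lambda>(\<G>\<^sub>n\<^sub>,\<^sub>d)\<close> unnecessary: the expected number of pairs of
  disjoint sets of the required size without edges between them is exponentially small already
  in the configuration model. A bounded number of switchings turns at least half of the
  configurations into simple graphs, so that passing to simple graphs costs only a polynomial
  factor.\<close>


section \<open>Separated sets from hopping forcing\<close>


text \<open>The unknown numbers of edges inside \<open>S\<close> and inside \<open>T\<close> enter
  both quadratic forms with the same sign, so they cancel in the difference of the forms; what
  remains is fixed by regularity alone. This is why two test vectors are used instead of one. For
  random graphs, the words without an \<open>S\<close>-\<open>T\<close> edge are counted through
  their colour patterns. A multiplicative weight on the colours makes the sum over patterns factor
  over the edges, and with the colour proportions as weights this loses only a polynomial factor
  against the exact multinomial count. The result is \<open>(1 - 2 * (s / n)\<^sup>2) ^ m\<close>. A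
  second weighting bounds the number of pairs \<open>(S, T)\<close> by about
  \<open>1 / \<gamma> ^ n\<close>. Since there are \<open>d * n / 2\<close> edges, the union bound
  decays as soon as \<open>(1 - 2 * \<sigma>\<^sup>2) ^ d < \<gamma>\<^sup>2\<close>, where
  \<open>\<sigma>\<close> is the fraction of vertices in each set. The obstacle is this numerical
  inequality for small \<open>d\<close>.\<close>

text \<open>The index is the time of the force. A new force from \<open>c\<close> to
  \<open>x\<close> is put at index \<open>k\<close>, so the only new pairs \<open>i \<le> j\<close>
  have \<open>j = k\<close>. They are harmless because \<open>x\<close> is white while all forcing
  vertices so far, and their neighbours, are blue; the invariant carries this last fact since blue
  sets only grow.\<close>

lemma hopping_reachable_forces:
  assumes "hopping_reachable V E B0 B U" "B0 \<subseteq> V"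
  shows "\<exists>(k::nat) b w. B \<subseteq> V \<and> B = B0 \<union> w ` {..<k} \<and> U = b ` {..<k} \<and> inj_on b {..<k} \<and> inj_on w {..<k} \<and>
     w ` {..<k} \<inter> B0 = {} \<and> (\<forall>i<k. b i \<in> B \<and> neighbours E (b i) \<subseteq> B) \<and>
     (\<forall>i<k. \<forall>j<k. i \<le> j \<longrightarrow> {b i, w j} \<notin> E \<and> b i \<noteq> w j)"
  using assms
proof induction
  case start
  then show ?case by (intro exI[of _ "0::nat"]) auto
next
  case (force B U c x)
  from force.IH[OF force.prems] obtain k :: nat and b w where conj: "B \<subseteq> V \<and> B = B0 \<union> w ` {..<k} \<and>
     U = b ` {..<k} \<and> inj_on b {..<k} \<and> inj_on w {..<k} \<and>
     w ` {..<k} \<inter> B0 = {} \<and> (\<forall>i<k. b i \<in> B \<and> neighbours E (b i) \<subseteq> B) \<and>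
     (\<forall>i<k. \<forall>j<k. i \<le> j \<longrightarrow> {b i, w j} \<notin> E \<and> b i \<noteq> w j)"
    by (elim exE) (rule that)
  then have IH: "B \<subseteq> V" "B = B0 \<union> w ` {..<k}" "U = b ` {..<k}"
    "inj_on b {..<k}" "inj_on w {..<k}" "w ` {..<k} \<inter> B0 = {}"
    and inB: "\<forall>i<k. b i \<in> B \<and> neighbours E (b i) \<subseteq> B"
    and sep: "\<forall>i<k. \<forall>j<k. i \<le> j \<longrightarrow> {b i, w j} \<notin> E \<and> b i \<noteq> w j"
    by - (elim conjE, assumption)+
  have c: "c \<in> B" "c \<notin> U" "neighbours E c \<subseteq> B" "x \<in> V" "x \<notin> B"
    using force.hyps(2) by (auto simp: can_hop_def)
  let ?b = "b(k := c)" and ?w = "w(k := x)"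
  have b: "?b i \<in> B" "neighbours E (?b i) \<subseteq> B" if "i < Suc k" for i
    using inB c that by (auto simp: less_Suc_eq)
  have img: "?w ` {..<Suc k} = insert x (w ` {..<k})" "?b ` {..<Suc k} = insert c (b ` {..<k})"
    by (auto simp: lessThan_Suc)
  show ?case
  proof (intro exI conjI allI impI)
    show "insert x B \<subseteq> V" using c IH(1) by auto
    show "insert x B = B0 \<union> ?w ` {..<Suc k}" "insert c U = ?b ` {..<Suc k}"
      using img IH(2,3) by auto
    show "inj_on ?b {..<Suc k}" "inj_on ?w {..<Suc k}"
      using IH(2-5) c by (auto simp: lessThan_Suc inj_on_def image_iff)
    show "?w ` {..<Suc k} \<inter> B0 = {}"
      using img IH(2,6) c by auto
    fix i assume i: "i < Suc k"
    show "?b i \<in> insert x B" "neighbours E (?b i) \<subseteq> insert x B" using b[OF i] by auto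
    fix j assume j: "j < Suc k" "i \<le> j"
    have "{?b i, ?w j} \<notin> E \<and> ?b i \<noteq> ?w j"
    proof (cases "j = k")
      case True
      then show ?thesis using b[OF i] c(5) by (auto simp: neighbours_def)
    next
      case False
      then show ?thesis using sep i j by auto
    qed
    then show "{?b i, ?w j} \<notin> E" "?b i \<noteq> ?w j" by auto
  qed
qed

definition separated :: "'a set set \<Rightarrow> 'a set \<Rightarrow> 'a set \<Rightarrow> bool" where
  "separated E S T \<longleftrightarrow> S \<inter> T = {} \<and> (\<forall>u\<in>S. \<forall>v\<in>T. {u, v} \<notin> E)"

text \<open>No edge joins the vertices that force first to the vertices that are forced last. These sets
  are moreover disjoint, since a vertex has to be blue when it forces.\<close>

lemma hopping_feasible_separated:
  assumes "finite V" "hopping_feasible V E B" "2 * s + card B \<le> card V + 1"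
  shows "\<exists>S T. S \<subseteq> V \<and> T \<subseteq> V \<and> card S = s \<and> card T = s \<and> separated E S T"
proof -
  obtain U where U: "B \<subseteq> V" "hopping_reachable V E B V U"
    using assms(2) by (auto simp: hopping_feasible_def)
  from hopping_reachable_forces[OF U(2,1)] obtain k :: nat and b w where conj: "V \<subseteq> V \<and> V = B \<union> w ` {..<k} \<and>
     U = b ` {..<k} \<and> inj_on b {..<k} \<and> inj_on w {..<k} \<and>
     w ` {..<k} \<inter> B = {} \<and> (\<forall>i<k. b i \<in> V \<and> neighbours E (b i) \<subseteq> V) \<and>
     (\<forall>i<k. \<forall>j<k. i \<le> j \<longrightarrow> {b i, w j} \<notin> E \<and> b i \<noteq> w j)"
    by (elim exE) (rule that)
  then have f: "V = B \<union> w ` {..<k}" "inj_on b {..<k}" "inj_on w {..<k}" "w ` {..<k} \<inter> B = {}"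
     "\<forall>i<k. b i \<in> V \<and> neighbours E (b i) \<subseteq> V"
     "\<forall>i<k. \<forall>j<k. i \<le> j \<longrightarrow> {b i, w j} \<notin> E \<and> b i \<noteq> w j"
    by - (elim conjE, assumption)+
  have "card V = card B + k"
    using f(1,3,4) assms(1) finite_subset[OF U(1)]
    by (subst f(1), subst card_Un_disjoint) (auto simp: card_image)
  \<comment> \<open>The pairs with equal indices are also non-adjacent, so the two index ranges may
    share one index: \<open>s - 1 \<le> k - s\<close> is enough. Hence \<open>s\<close> may be half
    of \<open>k\<close> rounded up.\<close>
  then have s: "2 * s \<le> k + 1" "s \<le> k" using assms(3) by auto
  let ?S = "b ` {..<s}" and ?T = "w ` {k - s..<k}"
  have "card ?S = s" "card ?T = s"
    using s f(2,3) by (auto intro!: card_image[THEN trans] intro: inj_on_subset)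
  moreover have "?S \<subseteq> V" using f(5) s by auto
  moreover have "?T \<subseteq> V" by (subst f(1)) auto
  moreover have "separated E ?S ?T"
  proof -
    have "{b i, w j} \<notin> E \<and> b i \<noteq> w j" if "i < s" "k - s \<le> j" "j < k" for i j
      using f(6) that s by auto
    then show ?thesis by (auto simp: separated_def)
  qed
  ultimately show ?thesis by blast
qed

lemma hopping_number_attained:
  assumes "finite V"
  obtains B where "hopping_feasible V E B" "card B = hopping_number V E"
proof -
  have "hopping_number V E \<in> card ` {B. hopping_feasible V E B}"
    unfolding hopping_number_def
    by (rule Min_in) (use finite_hopping_feasible[OF assms] hopping_feasible_all in auto)
  then show ?thesis using that by auto
qed

lemma hopping_number_separated:
  assumes "finite V" "2 * s + hopping_number V E \<le> card V + 1"
  shows "\<exists>S T. S \<subseteq> V \<and> T \<subseteq> V \<and> card S = s \<and> card T = s \<and> separated E S T"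
  using hopping_number_attained[OF assms(1)] hopping_feasible_separated[OF assms(1)] assms(2)
  by metis

text \<open>Needed for degree 0, where division by zero turns the spectral bound into
  \<open>card V\<close>.\<close>

lemma hopping_reachable_edgeless: "hopping_reachable V {} B0 B U \<Longrightarrow> B = B0"
proof (induction rule: hopping_reachable.induct)
  case (force B U b w)
  \<comment> \<open>The walk of length 0 joins \<open>b\<close> only to itself, and \<open>w\<close>
    differs from \<open>b\<close> because it is white. The infimum is then over the empty
    set.\<close>
  have empty: "{k. (b, w) \<in> {(x, y). {x, y} \<in> ({} :: 'a set set)} ^^ k} = {}"
  proof -
    have "(b, w) \<notin> {(x, y). {x, y} \<in> ({} :: 'a set set)} ^^ k" for k
      using force.hyps(2) by (cases k) (auto simp: can_hop_def)
    then show ?thesis by blast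
  qed
  have "graph_dist {} b w = \<infinity>"
    unfolding graph_dist_def empty by (simp add: top_enat_def)
  then show ?case using force.hyps(2) by (simp add: can_hop_def)
qed simp

lemma hopping_number_edgeless:
  assumes "finite V"
  shows "hopping_number V {} = card V"
  using hopping_number_attained[OF assms] hopping_reachable_edgeless
  unfolding hopping_feasible_def by metis

lemma hopping_number_le: "finite V \<Longrightarrow> hopping_number V E \<le> card V"
  unfolding hopping_number_def
  by (rule Min_le) (use finite_hopping_feasible hopping_feasible_all in \<open>auto intro!: imageI\<close>)

section \<open>Diagonalization of real symmetric matrices\<close>


text \<open>Complete \<open>v\<close> to a basis and orthogonalize. Gram-Schmidt leaves the head of
  the list unchanged and does not normalize, so dividing each column by its norm \<open>r j\<close>
  still leaves a multiple of \<open>v\<close> in front.\<close>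

lemma orthogonal_mat_first_column:
  fixes v :: "real vec"
  assumes v: "v \<in> carrier_vec n" "v \<noteq> 0\<^sub>v n"
  obtains W c where "W \<in> carrier_mat n n" "transpose_mat W * W = 1\<^sub>m n" "col W 0 = c \<cdot>\<^sub>v v"
proof -
  have n: "n \<noteq> 0" using v by (intro notI) (auto intro!: eq_vecI)
  interpret cof_vec_space n "TYPE(real)" .
  define b where "b = basis_completion v"
  note bc = basis_completion[OF v, folded b_def]
  define ws where "ws = gram_schmidt n b"
  from gram_schmidt_result[OF bc(2) bc(4) bc(5) ws_def]
  have ws: "set ws \<subseteq> carrier_vec n" "corthogonal ws" "length ws = n"
    by (auto simp: bc(6))
  obtain vs where "b = v # vs" using bc(6,7) n by (cases b) auto
  then have hd: "hd ws = v" unfolding ws_def using gram_schmidt_hd[OF v(1)] by simp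
  have car: "ws ! i \<in> carrier_vec n" if "i < n" for i using ws that by auto
  define r where "r i = sqrt (scalar_prod (ws ! i) (ws ! i))" for i
  define W where "W = mat n n (\<lambda>(i, j). vec_index (ws ! j) i / r j)"
  have conj: "conjugate w = (w :: real vec)" for w
    by (rule eq_vecI) auto
  \<comment> \<open>Orthogonality in the sense of \<open>corthogonal\<close> is an equivalence, so
    it also says that no basis vector has norm zero; this makes the division by \<open>r j\<close>
    legitimate.\<close>
  have orth: "scalar_prod (ws ! i) (ws ! j) = 0 \<longleftrightarrow> i \<noteq> j" if "i < n" "j < n" for i j
    using corthogonalD[OF ws(2), of i j] that ws(3) by (simp add: conj)
  have pos: "scalar_prod (ws ! i) (ws ! i) \<ge> 0" for i
    unfolding scalar_prod_def by (rule sum_nonneg) simp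
  have rr: "r i * r i = scalar_prod (ws ! i) (ws ! i)" for i
    using pos[of i] by (simp add: r_def)
  have W: "W \<in> carrier_mat n n" by (simp add: W_def)
  have "transpose_mat W * W = 1\<^sub>m n"
  proof (rule eq_matI)
    fix i j assume ij: "i < dim_row (1\<^sub>m n :: real mat)" "j < dim_col (1\<^sub>m n :: real mat)"
    then have ij: "i < n" "j < n" by auto
    have "(transpose_mat W * W) $$ (i, j) = (\<Sum>k = 0..<n. vec_index (ws ! i) k / r i * (vec_index (ws ! j) k / r j))"
      using ij W by (auto simp: scalar_prod_def W_def)
    also have "\<dots> = scalar_prod (ws ! i) (ws ! j) / (r i * r j)"
      using car[OF ij(2)] by (simp add: scalar_prod_def sum_divide_distrib)
    also have "\<dots> = (1\<^sub>m n :: real mat) $$ (i, j)"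
      using orth[OF ij] orth[of i i] ij rr[of i] by (auto simp: one_mat_def)
    finally show "(transpose_mat W * W) $$ (i, j) = (1\<^sub>m n :: real mat) $$ (i, j)" .
  qed (simp_all add: W_def)
  moreover have "col W 0 = (1 / r 0) \<cdot>\<^sub>v v"
  proof -
    have "ws ! 0 = v" using hd ws(3) n by (cases ws) auto
    then show ?thesis using n v(1) by (intro eq_vecI) (auto simp: W_def)
  qed
  ultimately show ?thesis using that W by blast
qed

text \<open>Deflation: conjugating by an orthogonal matrix whose first column is an eigenvector for
  \<open>e\<close> clears the rest of the first column, and by symmetry the rest of the first row.
  The remaining block is symmetric and its characteristic polynomial has the remaining factors. The
  diagonal follows the order of \<open>es\<close>, so that the sorted list of eigenvalues can be
  used later.\<close>

lemma real_symmetric_diagonalization: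
  fixes A :: "real mat"
  assumes "A \<in> carrier_mat n n" "transpose_mat A = A" "char_poly A = (\<Prod>e\<leftarrow>es. [:- e, 1:])"
  shows "\<exists>P\<in>carrier_mat n n. transpose_mat P * P = 1\<^sub>m n \<and>
           transpose_mat P * A * P = mat n n (\<lambda>(i, j). if i = j then es ! i else 0)"
  using assms
proof (induction es arbitrary: n A)
  case Nil
  with degree_monic_char_poly[of A n] have "n = 0" by simp
  then show ?case using Nil by (intro bexI[of _ "1\<^sub>m n"]) auto
next
  case (Cons e es)
  note A = Cons.prems(1) and sym = Cons.prems(2)
  have root: "poly (char_poly A) e = 0" using Cons.prems(3) by simp
  have "degree (char_poly A) \<noteq> 0"
  proof
    assume "degree (char_poly A) = 0"
    then have "char_poly A = 1"
      using degree_monic_char_poly[OF A] monic_degree_0[of "char_poly A"] by simp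
    then show False using root by simp
  qed
  then obtain k where n: "n = Suc k" using degree_monic_char_poly[OF A] by (cases n) auto
  from root have "eigenvalue A e" using eigenvalue_root_char_poly[OF A] by simp
  then obtain v where v: "v \<in> carrier_vec n" "v \<noteq> 0\<^sub>v n" "A *\<^sub>v v = e \<cdot>\<^sub>v v"
    using A by (auto simp: eigenvalue_def eigenvector_def)
  obtain W c where W: "W \<in> carrier_mat n n" "transpose_mat W * W = 1\<^sub>m n" "col W 0 = c \<cdot>\<^sub>v v"
    using orthogonal_mat_first_column[OF v(1,2)] .
  let ?Wt = "transpose_mat W"
  have Wt: "?Wt \<in> carrier_mat n n" using W by simp
  have WWt: "W * ?Wt = 1\<^sub>m n" using mat_mult_left_right_inverse[OF Wt W(1) W(2)] .
  define A' where "A' = ?Wt * A * W"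
  have A': "A' \<in> carrier_mat n n" using W A by (simp add: A'_def)
  have symA': "transpose_mat A' = A'"
    unfolding A'_def using W(1) A
    by (simp add: sym transpose_mult[of _ n n _ n] assoc_mult_mat[of _ n n _ n _ n])
  have sim: "similar_mat A' A"
    unfolding similar_mat_def similar_mat_wit_def
    by (rule exI[of _ ?Wt], rule exI[of _ W]) (use W A A' WWt in \<open>auto simp: A'_def Let_def\<close>)
  have colA': "A' $$ (i, 0) = (if i = 0 then e else 0)" if i: "i < n" for i
  proof -
    have "A' $$ (i, 0) = scalar_prod (row ?Wt i) (col (A * W) 0)"
      unfolding A'_def using W(1) A i n by (subst assoc_mult_mat[of _ n n _ n _ n]) auto
    also have "col (A * W) 0 = A *\<^sub>v col W 0" using A W(1) n by auto
    also have "\<dots> = e \<cdot>\<^sub>v col W 0"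
      unfolding W(3) using v A by (simp add: mult_mat_vec[of _ n n] smult_smult_assoc mult.commute)
    also have "scalar_prod (row ?Wt i) (e \<cdot>\<^sub>v col W 0) = e * scalar_prod (row ?Wt i) (col W 0)"
      using W(1) i by (intro scalar_prod_smult_right) auto
    also have "scalar_prod (row ?Wt i) (col W 0) = (?Wt * W) $$ (i, 0)"
      using W(1) i n by simp
    also have "e * \<dots> = (if i = 0 then e else 0)"
      using W(2) i n by simp
    finally show ?thesis .
  qed
  have rowA': "A' $$ (0, i) = (if i = 0 then e else 0)" if i: "i < n" for i
    using colA'[OF i] arg_cong[OF symA', of "\<lambda>M. M $$ (i, 0)"] A' i n by auto
  define A3 where "A3 = mat k k (\<lambda>(i, j). A' $$ (Suc i, Suc j))"
  define A1 where "A1 = mat 1 1 (\<lambda>_. e)"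
  have A3: "A3 \<in> carrier_mat k k" and A1: "A1 \<in> carrier_mat 1 1" by (auto simp: A3_def A1_def)
  have block: "A' = four_block_mat A1 (0\<^sub>m 1 k) (0\<^sub>m k 1) A3"
  proof (rule eq_matI)
    fix i j assume "i < dim_row (four_block_mat A1 (0\<^sub>m 1 k) (0\<^sub>m k 1) A3)"
      "j < dim_col (four_block_mat A1 (0\<^sub>m 1 k) (0\<^sub>m k 1) A3)"
    then show "A' $$ (i, j) = four_block_mat A1 (0\<^sub>m 1 k) (0\<^sub>m k 1) A3 $$ (i, j)"
      using colA' rowA' n by (cases i; cases j) (auto simp: A1_def A3_def)
  qed (use A' A1 A3 n in auto)
  have symA3: "transpose_mat A3 = A3"
  proof (rule eq_matI)
    fix i j assume "i < dim_row A3" "j < dim_col A3"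
    then show "transpose_mat A3 $$ (i, j) = A3 $$ (i, j)"
      using arg_cong[OF symA', of "\<lambda>M. M $$ (Suc i, Suc j)"] A' n by (auto simp: A3_def)
  qed (use A3 in auto)
  have "char_poly A1 * char_poly A3 = [:-e, 1:] * (\<Prod>e\<leftarrow>es. [:- e, 1:])"
    using char_poly_similar[OF sim] Cons.prems(3) block
      char_poly_four_block_zeros_col[OF A1 zero_carrier_mat A3] by simp
  moreover have "char_poly A1 = [:-e, 1:]"
    by (simp add: A1_def char_poly_defs det_def sign_def)
  ultimately have "char_poly A3 = (\<Prod>e\<leftarrow>es. [:- e, 1:])"
    by (simp del: mult_pCons_left)
  from Cons.IH[OF A3 symA3 this] obtain P3 where P3: "P3 \<in> carrier_mat k k"
    "transpose_mat P3 * P3 = 1\<^sub>m k"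
    "transpose_mat P3 * A3 * P3 = mat k k (\<lambda>(i, j). if i = j then es ! i else 0)" by blast
  define R where "R = four_block_mat (1\<^sub>m 1) (0\<^sub>m 1 k) (0\<^sub>m k 1) P3"
  have R: "R \<in> carrier_mat n n" using four_block_carrier_mat[OF one_carrier_mat[of 1] P3(1)] n by (simp add: R_def)
  have Rt: "transpose_mat R = four_block_mat (1\<^sub>m 1) (0\<^sub>m 1 k) (0\<^sub>m k 1) (transpose_mat P3)"
    unfolding R_def using P3(1) by (subst transpose_four_block_mat) auto
  have RR: "transpose_mat R * R = 1\<^sub>m n"
    unfolding Rt unfolding R_def
    using P3(1) n by (subst mult_four_block_mat[of _ 1 1 _ k _ k]) (auto simp: P3(2))
  have "transpose_mat R * A' = four_block_mat A1 (0\<^sub>m 1 k) (0\<^sub>m k 1) (transpose_mat P3 * A3)"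
    unfolding Rt block
    using P3(1) A1 A3 by (subst mult_four_block_mat[of _ 1 1 _ k _ k]) auto
  then have "transpose_mat R * A' * R =
      four_block_mat A1 (0\<^sub>m 1 k) (0\<^sub>m k 1) (transpose_mat P3 * A3 * P3)"
    unfolding R_def
    using P3(1) A1 A3 by (simp, subst mult_four_block_mat[of _ 1 1 _ k _ k]) auto
  also have "\<dots> = mat n n (\<lambda>(i, j). if i = j then (e # es) ! i else 0)"
    unfolding P3(3)
    by (rule eq_matI) (auto simp: A1_def n nth_Cons split: nat.splits)
  finally have RAR: "transpose_mat R * A' * R = mat n n (\<lambda>(i, j). if i = j then (e # es) ! i else 0)" .
  show ?case
  proof (intro bexI[of _ "W * R"] conjI)
    show "W * R \<in> carrier_mat n n" using W(1) R by simp
    have Rtc: "transpose_mat R \<in> carrier_mat n n" using R by simp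
    have tr: "transpose_mat (W * R) = transpose_mat R * ?Wt" using W(1) R by (simp add: transpose_mult[of _ n n _ n])
    have "transpose_mat R * ?Wt * (W * R) = transpose_mat R * (?Wt * W) * R"
      using W(1) Wt R Rtc by (simp add: assoc_mult_mat[of _ n n _ n _ n])
    then show "transpose_mat (W * R) * (W * R) = 1\<^sub>m n"
      using W(1,2) R RR tr by simp
    have "transpose_mat R * ?Wt * A * (W * R) = transpose_mat R * A' * R"
      unfolding A'_def using W(1) Wt R Rtc A by (simp add: assoc_mult_mat[of _ n n _ n _ n])
    then show "transpose_mat (W * R) * A * (W * R) = mat n n (\<lambda>(i, j). if i = j then (e # es) ! i else 0)"
      using tr RAR by simp
  qed
qed

lemma real_split_prod_proots:
  fixes p :: "real poly"
  assumes "size (proots p) = degree p" "lead_coeff p = 1"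
  shows "p = (\<Prod>e\<in>#proots p. [:- e, 1:])"
  using assms
proof (induction "degree p" arbitrary: p)
  case 0
  then have "p = 1" using monic_degree_0[of p] by simp
  then show ?case by simp
next
  case (Suc m)
  then obtain x where x: "x \<in># proots p" by (cases "proots p") auto
  have p0: "p \<noteq> 0" using Suc.prems by auto
  have "poly p x = 0" using x p0 by simp
  then obtain q where q: "p = [:-x, 1:] * q" by (auto simp: poly_eq_0_iff_dvd elim: dvdE)
  have q0: "q \<noteq> 0" using q p0 by auto
  have pr: "proots p = {#x#} + proots q"
    unfolding q using q0 by (subst proots_mult) auto
  have deg: "degree p = Suc (degree q)"
    unfolding q using q0 by (subst degree_mult_eq) auto
  have lc: "lead_coeff q = 1"
    using Suc.prems(2) unfolding q lead_coeff_mult by simp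
  have "q = (\<Prod>e\<in>#proots q. [:- e, 1:])"
    using Suc.hyps(1)[of q] Suc.hyps(2) Suc.prems pr deg lc by simp
  then have "[:-x, 1:] * q = (\<Prod>e\<in>#{#x#} + proots q. [:- e, 1:])" by simp
  then show ?case using q pr by simp
qed

section \<open>The spectral bound\<close>


lemma char_poly_adj_matrix_split:
  assumes "finite V" and f: "bij_betw f {..<card V} V"
  shows "char_poly (adj_matrix E (card V) f) = (\<Prod>e\<leftarrow>adj_eigenvalues V E. [:- e, 1:])"
proof -
  let ?p = "char_poly (adj_matrix E (card V) f)"
  have monic: "lead_coeff ?p = 1"
    using degree_monic_char_poly[OF adj_matrix_carrier, of E "card V" f] by auto
  then have "?p \<noteq> 0" by auto
  then have "size (proots ?p) = degree ?p"
    using size_proots_real[of ?p] adj_matrix_root_real by auto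
  then have "?p = (\<Prod>e\<in>#proots ?p. [:- e, 1:])"
    using monic by (rule real_split_prod_proots)
  also have "proots ?p = mset (adj_eigenvalues V E)"
    by (simp add: adj_eigenvalues_enum[OF assms])
  also have "(\<Prod>e\<in>#mset (adj_eigenvalues V E). [:- e, 1:]) = (\<Prod>e\<leftarrow>adj_eigenvalues V E. [:- e, 1:])"
    by (simp flip: prod_mset_prod_list)
  finally show ?thesis .
qed

text \<open>\<open>\<phi> l\<close> is the \<open>l\<close>-th column of the orthogonal
  diagonalizing matrix \<open>P\<close>, read as a function on \<open>V\<close>. The second clause
  is \<open>P * transpose_mat P = 1\<close>, which gives expansions and Parseval; the third is the
  diagonal of \<open>transpose_mat P * P = 1\<close>, which makes each \<open>\<phi> l\<close>
  nonzero.\<close>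

lemma adjacency_eigenbasis:
  assumes V: "finite V"
  shows "\<exists>\<phi> :: nat \<Rightarrow> 'a \<Rightarrow> real. (\<forall>l<card V. \<forall>v\<in>V.
       (\<Sum>u\<in>V. of_bool ({v, u} \<in> E) * \<phi> l u) = adj_eigenvalues V E ! l * \<phi> l v) \<and>
    (\<forall>u\<in>V. \<forall>v\<in>V. (\<Sum>l<card V. \<phi> l u * \<phi> l v) = of_bool (u = v)) \<and>
    (\<forall>l<card V. (\<Sum>v\<in>V. \<phi> l v * \<phi> l v) = 1)"
proof -
  define n where "n = card V"
  define es where "es = adj_eigenvalues V E"
  obtain f where f: "bij_betw f {..<n} V"
    using ex_bij_betw_nat_finite[OF V] by (auto simp: n_def atLeast0LessThan)
  define A where "A = adj_matrix E n f"
  have A: "A \<in> carrier_mat n n" by (simp add: A_def)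
  have "transpose_mat A = A"
    by (rule eq_matI) (auto simp: A_def adj_matrix_def insert_commute)
  moreover have "char_poly A = (\<Prod>e\<leftarrow>es. [:- e, 1:])"
    using char_poly_adj_matrix_split[OF V, of f E] f by (simp add: A_def es_def n_def)
  ultimately obtain P where P: "P \<in> carrier_mat n n" "transpose_mat P * P = 1\<^sub>m n"
    "transpose_mat P * A * P = mat n n (\<lambda>(i, j). if i = j then es ! i else 0)"
    using real_symmetric_diagonalization[OF A] by blast
  define D where "D = mat n n (\<lambda>(i, j). if i = j then es ! i else 0)"
  have D: "D \<in> carrier_mat n n" by (simp add: D_def)
  have Pt: "transpose_mat P \<in> carrier_mat n n" using P(1) by simp
  have PPt: "P * transpose_mat P = 1\<^sub>m n" using mat_mult_left_right_inverse[OF Pt P(1,2)] .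
  have "P * (transpose_mat P * A * P) = (P * transpose_mat P) * A * P"
    using P(1) Pt A by (simp add: assoc_mult_mat[of _ n n _ n _ n])
  then have AP: "A * P = P * D" using A P(3) PPt by (simp add: D_def)
  define p where "p i l = P $$ (i, l)" for i l
  have e1: "(\<Sum>j<n. of_bool ({f i, f j} \<in> E) * p j l) = es ! l * p i l" if "i < n" "l < n" for i l
  proof -
    have "(\<Sum>j<n. of_bool ({f i, f j} \<in> E) * p j l) = (A * P) $$ (i, l)"
      using that P(1) by (auto simp: A_def adj_matrix_def scalar_prod_def p_def atLeast0LessThan)
    also have "\<dots> = (P * D) $$ (i, l)" by (simp add: AP)
    also have "\<dots> = (\<Sum>j<n. p i j * (if j = l then es ! j else 0))"
      using that P(1) by (auto simp: D_def scalar_prod_def p_def atLeast0LessThan)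
    also have "\<dots> = es ! l * p i l"
      using that by (simp add: if_distrib[of "\<lambda>x. _ * x"] sum.delta cong: if_cong)
    finally show ?thesis .
  qed
  have e2: "(\<Sum>l<n. p i l * p j l) = of_bool (i = j)" if "i < n" "j < n" for i j
  proof -
    have "(\<Sum>l<n. p i l * p j l) = (P * transpose_mat P) $$ (i, j)"
      using that P(1) by (auto simp: scalar_prod_def p_def atLeast0LessThan)
    then show ?thesis using that by (simp add: PPt)
  qed
  have e3: "(\<Sum>i<n. p i l * p i l) = 1" if "l < n" for l
  proof -
    have "(\<Sum>i<n. p i l * p i l) = (transpose_mat P * P) $$ (l, l)"
      using that P(1) by (auto simp: scalar_prod_def p_def atLeast0LessThan)
    then show ?thesis using that by (simp add: P(2))
  qed
  define g where "g = inv_into {..<n} f"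
  have fg: "f (g v) = v" "g v < n" if "v \<in> V" for v
    using f that unfolding g_def bij_betw_def by (auto simp: f_inv_into_f intro: inv_into_into[of _ f "{..<n}", simplified])
  have gf: "g (f i) = i" if "i < n" for i
    using f that unfolding g_def bij_betw_def by simp
  have geq: "g u = g v \<longleftrightarrow> u = v" if "u \<in> V" "v \<in> V" for u v
    using fg that by metis
  have sumV: "(\<Sum>v\<in>V. h v) = (\<Sum>i<n. h (f i))" for h :: "'a \<Rightarrow> real"
    using sum.reindex_bij_betw[OF f, of h] by simp
  show ?thesis
  proof (intro exI[of _ "\<lambda>l v. p (g v) l"] conjI allI impI ballI)
    fix l v assume "l < card V" "v \<in> V"
    then show "(\<Sum>u\<in>V. of_bool ({v, u} \<in> E) * p (g u) l) = adj_eigenvalues V E ! l * p (g v) l"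
      using e1[of "g v" l] fg[of v] by (simp add: sumV gf n_def es_def)
  next
    fix u v assume "u \<in> V" "v \<in> V"
    then show "(\<Sum>l<card V. p (g u) l * p (g v) l) = of_bool (u = v)"
      using e2[of "g u" "g v"] fg geq[of u v] by (simp add: n_def)
  next
    fix l assume "l < card V"
    then show "(\<Sum>v\<in>V. p (g v) l * p (g v) l) = 1"
      using e3[of l] by (simp add: sumV gf n_def)
  qed
qed

lemma regular_row_sum:
  assumes "regular_graph d V E" "v \<in> V"
  shows "(\<Sum>u\<in>V. of_bool ({v, u} \<in> E)) = real d"
proof -
  have V: "finite V" "\<And>e. e \<in> E \<Longrightarrow> e \<subseteq> V" and d: "card (neighbours E v) = d"
    using assms by (auto simp: regular_graph_def simple_graph_def)
  have "(\<Sum>u\<in>V. of_bool ({v, u} \<in> E)) = real (card (V \<inter> {u. {v, u} \<in> E}))"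
    using V(1) by simp
  also have "V \<inter> {u. {v, u} \<in> E} = neighbours E v"
    using V(2) by (auto simp: neighbours_def)
  finally show ?thesis using d by simp
qed

lemma adj_eigenvalues_antimono:
  assumes "i \<le> j" "j < card V"
  shows "adj_eigenvalues V E ! j \<le> adj_eigenvalues V E ! i"
proof -
  let ?xs = "adj_eigenvalues V E"
  have "sorted (rev ?xs)" by (simp add: adj_eigenvalues_def)
  then show ?thesis
    using assms length_adj_eigenvalues[of V E] sorted_rev_nth_mono[of ?xs i j] by simp
qed

text \<open>By the ordering, every eigenvalue but the first lies between the second and the
  last.\<close>

lemma abs_adj_eigenvalue_le:
  assumes "1 \<le> l" "l < card V"
  shows "\<bar>adj_eigenvalues V E ! l\<bar> \<le> graph_lambda V E"
  using adj_eigenvalues_antimono[of 1 l V E] adj_eigenvalues_antimono[of l "card V - 1" V E] assms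
  unfolding graph_lambda_def by linarith

text \<open>Evaluate the eigenvalue equation at a vertex where \<open>\<phi>\<close> is largest in
  absolute value: its left side is a sum of \<open>d\<close> values that are at most this
  large.\<close>

lemma regular_eigenvalue_le_degree:
  assumes reg: "regular_graph d V E" and "v0 \<in> V" "\<phi> v0 \<noteq> 0"
    and eig: "\<And>v. v \<in> V \<Longrightarrow> (\<Sum>u\<in>V. of_bool ({v, u} \<in> E) * \<phi> u) = \<mu> * \<phi> v"
  shows "\<mu> \<le> real d"
proof -
  have V: "finite V" using reg by (auto simp: regular_graph_def simple_graph_def)
  obtain w where w: "w \<in> V" "\<And>v. v \<in> V \<Longrightarrow> \<bar>\<phi> v\<bar> \<le> \<bar>\<phi> w\<bar>"
    using obtains_MAX[OF V, of "\<lambda>v. \<bar>\<phi> v\<bar>"] assms(2) V by (metis Max_ge empty_iff finite_imageI image_eqI)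
  have "\<mu> * \<bar>\<phi> w\<bar> \<le> \<bar>\<mu> * \<phi> w\<bar>" by (simp add: abs_mult mult_right_mono)
  also have "\<dots> = \<bar>\<Sum>u\<in>V. of_bool ({w, u} \<in> E) * \<phi> u\<bar>" using eig[OF w(1)] by simp
  also have "\<dots> \<le> (\<Sum>u\<in>V. of_bool ({w, u} \<in> E) * \<bar>\<phi> w\<bar>)"
    by (rule sum_abs[THEN order_trans]) (auto intro!: sum_mono w(2))
  also have "\<dots> = real d * \<bar>\<phi> w\<bar>"
    using regular_row_sum[OF reg w(1)] by (simp add: sum_distrib_right[symmetric])
  finally have "\<mu> * \<bar>\<phi> w\<bar> \<le> real d * \<bar>\<phi> w\<bar>" .
  moreover have "\<bar>\<phi> w\<bar> > 0" using w(2)[OF assms(2)] assms(3) by linarith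
  ultimately show ?thesis by simp
qed

text \<open>In the eigenbasis the form is a weighted sum of squared coefficients, and
  \<open>graph_lambda\<close> bounds every weight except perhaps the first. If the first two
  eigenvalues agree, it bounds the first as well. Otherwise all others are smaller than
  \<open>d\<close>, so the constant function can only be a multiple of \<open>\<phi> 0\<close>, and
  the coefficient of \<open>x\<close> there vanishes because the entries of \<open>x\<close> sum to
  0.\<close>

lemma regular_quadratic_form_le:
  assumes reg: "regular_graph d V E" and n2: "card V \<ge> 2" and x0: "(\<Sum>v\<in>V. x v) = (0 :: real)"
  shows "\<bar>\<Sum>u\<in>V. \<Sum>v\<in>V. of_bool ({u, v} \<in> E) * x u * x v\<bar> \<le> graph_lambda V E * (\<Sum>v\<in>V. x v * x v)"
proof -
  have V: "finite V" using reg by (auto simp: regular_graph_def simple_graph_def)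
  define n where "n = card V"
  define es where "es = adj_eigenvalues V E"
  obtain \<phi> where eigenbasis: "(\<forall>l<card V. \<forall>v\<in>V.
       (\<Sum>u\<in>V. of_bool ({v, u} \<in> E) * \<phi> l u) = adj_eigenvalues V E ! l * \<phi> l v) \<and>
    (\<forall>u\<in>V. \<forall>v\<in>V. (\<Sum>l<card V. \<phi> l u * \<phi> l v) = of_bool (u = v)) \<and>
    (\<forall>l<card V. (\<Sum>v\<in>V. \<phi> l v * \<phi> l v) = 1)"
    using adjacency_eigenbasis[OF V, of E] by (elim exE) (rule that)
  have eig: "(\<Sum>u\<in>V. of_bool ({v, u} \<in> E) * \<phi> l u) = es ! l * \<phi> l v" if "l < n" "v \<in> V" for l v
    using eigenbasis that unfolding n_def es_def by simp
  have compl: "(\<Sum>l<n. \<phi> l u * \<phi> l v) = of_bool (u = v)" if "u \<in> V" "v \<in> V" for u v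
    using eigenbasis that unfolding n_def by simp
  have norm: "(\<Sum>v\<in>V. \<phi> l v * \<phi> l v) = 1" if "l < n" for l
    using eigenbasis that unfolding n_def by simp
  define co where "co z l = (\<Sum>v\<in>V. \<phi> l v * z v)" for z :: "'a \<Rightarrow> real" and l
  have expand: "z v = (\<Sum>l<n. co z l * \<phi> l v)" if "v \<in> V" for z v
  proof -
    have "(\<Sum>l<n. co z l * \<phi> l v) = (\<Sum>u\<in>V. \<Sum>l<n. \<phi> l u * \<phi> l v * z u)"
      unfolding co_def sum_distrib_right by (subst sum.swap) (simp add: mult_ac)
    also have "\<dots> = (\<Sum>u\<in>V. of_bool (u = v) * z u)"
      using compl that by (simp add: sum_distrib_right[symmetric])
    also have "\<dots> = (\<Sum>u\<in>V. if u = v then z u else 0)"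
      by (intro sum.cong) auto
    also have "\<dots> = z v" using V that by simp
    finally show ?thesis by simp
  qed
  have parseval: "(\<Sum>v\<in>V. z v * y v) = (\<Sum>l<n. co z l * co y l)" for z y
  proof -
    have "(\<Sum>v\<in>V. z v * y v) = (\<Sum>v\<in>V. \<Sum>l<n. co z l * (\<phi> l v * y v))"
      by (rule sum.cong[OF refl], subst expand[of _ z]) (auto simp: sum_distrib_left sum_distrib_right mult_ac)
    also have "\<dots> = (\<Sum>l<n. co z l * co y l)"
      unfolding co_def[of y] sum_distrib_left by (rule sum.swap)
    finally show ?thesis .
  qed
  have quad: "(\<Sum>u\<in>V. \<Sum>v\<in>V. of_bool ({u, v} \<in> E) * x u * x v) = (\<Sum>l<n. es ! l * (co x l * co x l))"
  proof -
    have "(\<Sum>u\<in>V. \<Sum>v\<in>V. of_bool ({u, v} \<in> E) * x u * x v)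
        = (\<Sum>u\<in>V. x u * (\<Sum>v\<in>V. \<Sum>l<n. of_bool ({u, v} \<in> E) * (co x l * \<phi> l v)))"
    proof (rule sum.cong[OF refl])
      fix u assume "u \<in> V"
      have "(\<Sum>v\<in>V. of_bool ({u, v} \<in> E) * x u * x v) = x u * (\<Sum>v\<in>V. of_bool ({u, v} \<in> E) * x v)"
        by (simp add: sum_distrib_left mult_ac)
      also have "(\<Sum>v\<in>V. of_bool ({u, v} \<in> E) * x v) = (\<Sum>v\<in>V. \<Sum>l<n. of_bool ({u, v} \<in> E) * (co x l * \<phi> l v))"
        by (rule sum.cong[OF refl], subst expand[of _ x]) (auto simp: sum_distrib_left)
      finally show "(\<Sum>v\<in>V. of_bool ({u, v} \<in> E) * x u * x v)
        = x u * (\<Sum>v\<in>V. \<Sum>l<n. of_bool ({u, v} \<in> E) * (co x l * \<phi> l v))" .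
    qed
    also have "\<dots> = (\<Sum>u\<in>V. x u * (\<Sum>l<n. co x l * (\<Sum>v\<in>V. of_bool ({u, v} \<in> E) * \<phi> l v)))"
    proof (rule sum.cong[OF refl])
      fix u
      show "x u * (\<Sum>v\<in>V. \<Sum>l<n. of_bool ({u, v} \<in> E) * (co x l * \<phi> l v))
          = x u * (\<Sum>l<n. co x l * (\<Sum>v\<in>V. of_bool ({u, v} \<in> E) * \<phi> l v))"
        by (subst sum.swap) (simp add: sum_distrib_left mult_ac)
    qed
    also have "\<dots> = (\<Sum>u\<in>V. \<Sum>l<n. es ! l * co x l * (\<phi> l u * x u))"
      by (intro sum.cong refl, simp add: eig) (simp add: sum_distrib_left mult_ac)
    also have "\<dots> = (\<Sum>l<n. es ! l * (co x l * co x l))"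
      by (subst sum.swap) (simp add: co_def sum_distrib_left mult_ac)
    finally show ?thesis .
  qed
  have term_le: "\<bar>es ! l * (co x l * co x l)\<bar> \<le> graph_lambda V E * (co x l * co x l)" if l: "l < n" for l
  proof -
    have "\<bar>es ! l\<bar> \<le> graph_lambda V E \<or> co x l = 0"
    proof (cases "l \<ge> 1")
      case True
      then show ?thesis using abs_adj_eigenvalue_le l by (auto simp: es_def n_def)
    next
      case False
      then have l0: "l = 0" by simp
      show ?thesis
      proof (cases "es ! 0 = es ! 1")
        case True
        then show ?thesis using abs_adj_eigenvalue_le[of 1 V E] n2 l0 by (simp add: es_def)
      next
        case False
        have lt: "es ! k < es ! 0" if "k \<ge> 1" "k < n" for k
          using adj_eigenvalues_antimono[of 1 k V E] adj_eigenvalues_antimono[of 0 1 V E] that False n2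
          by (auto simp: es_def n_def)
        have "\<exists>v\<in>V. \<phi> 0 v \<noteq> 0"
        proof (rule ccontr)
          assume "\<not> ?thesis"
          then have "(\<Sum>v\<in>V. \<phi> 0 v * \<phi> 0 v) = 0" by simp
          then show False using norm[of 0] n2 by (simp add: n_def)
        qed
        then have e0: "es ! 0 \<le> real d"
          using regular_eigenvalue_le_degree[OF reg, of _ "\<phi> 0" "es ! 0"] eig[of 0] n2
          by (auto simp: n_def)
        define c where "c = co (\<lambda>_. 1)"
        \<comment> \<open>The adjacency operator is symmetric and multiplies the constant function
          by \<open>d\<close>. A coefficient of the constant function can thus be nonzero only where
          the eigenvalue equals \<open>d\<close>.\<close>
        have "es ! k * c k = real d * c k" if "k < n" for k
        proof -
          have "es ! k * c k = (\<Sum>v\<in>V. \<Sum>u\<in>V. of_bool ({u, v} \<in> E) * \<phi> k u)"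
            using eig[OF that] by (simp add: c_def co_def sum_distrib_left insert_commute)
          also have "\<dots> = (\<Sum>u\<in>V. \<phi> k u * (\<Sum>v\<in>V. of_bool ({u, v} \<in> E)))"
            by (subst sum.swap) (simp add: sum_distrib_left mult_ac)
          also have "\<dots> = real d * c k"
            using regular_row_sum[OF reg] by (simp add: c_def co_def sum_distrib_left mult_ac)
          finally show ?thesis .
        qed
        then have ck: "c k = 0" if "k \<ge> 1" "k < n" for k
          using lt[OF that] e0 that by fastforce
        have "(\<Sum>k<n. F k * c k) = F 0 * c 0" for F
          using sum.mono_neutral_right[of "{..<n}" "{0}" "\<lambda>k. F k * c k"] ck n2 by (auto simp: n_def)
        \<comment> \<open>Parseval for the constant function with itself shows
          \<open>c 0 \<noteq> 0\<close>; Parseval with \<open>x\<close> then forces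
          \<open>co x 0 = 0\<close>.\<close>
        then have "real n = c 0 * c 0" "0 = co x 0 * c 0"
          using parseval[of "\<lambda>_. 1" "\<lambda>_. 1"] parseval[of x "\<lambda>_. 1"] x0 by (simp_all add: c_def n_def)
        then show ?thesis using n2 l0 by (auto simp: n_def)
      qed
    qed
    then show ?thesis
    proof
      assume "\<bar>es ! l\<bar> \<le> graph_lambda V E"
      then have "\<bar>es ! l\<bar> * (co x l * co x l) \<le> graph_lambda V E * (co x l * co x l)"
        by (rule mult_right_mono) simp
      then show ?thesis by (simp add: abs_mult)
    qed simp
  qed
  have "\<bar>\<Sum>l<n. es ! l * (co x l * co x l)\<bar> \<le> (\<Sum>l<n. graph_lambda V E * (co x l * co x l))"
    by (rule sum_abs[THEN order_trans]) (auto intro!: sum_mono term_le)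
  then show ?thesis unfolding quad parseval[of x x] by (simp add: sum_distrib_left)
qed


text \<open>Off the products \<open>S \<times> T\<close> and \<open>T \<times> S\<close>, where
  there are no edges, the summands of the two forms differ by terms that involve at most one
  indicator. Row sums evaluate these exactly, to \<open>(4 * s / n) * (d * s)\<close>; the squared
  norms of \<open>x\<close> and \<open>y\<close> add up to
  \<open>(4 * s / n) * (n - s)\<close>.\<close>

lemma separated_mixing:
  assumes reg: "regular_graph d V E" and n2: "card V \<ge> 2" and ST: "S \<subseteq> V" "T \<subseteq> V"
    and card: "card S = s" "card T = s" and s: "s > 0" and sep: "separated E S T"
  shows "real d * real s \<le> graph_lambda V E * (real (card V) - real s)"
proof -
  have V: "finite V" using reg by (auto simp: regular_graph_def simple_graph_def)
  define n where "n = real (card V)"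
  have n: "n > 0" using n2 by (simp add: n_def)
  define a where "a u v = (of_bool ({u, v} \<in> E) :: real)" for u v
  define I where "I A v = (of_bool (v \<in> A) :: real)" for A and v :: 'a
  \<comment> \<open>The shift that makes the entries of \<open>x\<close> sum to 0.\<close>
  define r where "r = 2 * real s / n"
  define x where "x v = I S v + I T v - r" for v
  define y where "y v = I S v - I T v" for v
  have sumI: "(\<Sum>v\<in>V. I S v) = s" "(\<Sum>v\<in>V. I T v) = s"
    using card ST V by (auto simp: I_def inf.absorb2)
  have II: "I S v * I S v = I S v" "I T v * I T v = I T v" "I S v * I T v = 0" for v
    using sep by (auto simp: I_def separated_def)
  have "(\<Sum>v\<in>V. x v) = 0"
    using n by (simp add: x_def sum.distrib sum_subtractf sumI r_def n_def[symmetric])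
  then have qx: "\<bar>\<Sum>u\<in>V. \<Sum>v\<in>V. a u v * x u * x v\<bar> \<le> graph_lambda V E * (\<Sum>v\<in>V. x v * x v)"
    unfolding a_def by (rule regular_quadratic_form_le[OF reg n2])
  have "(\<Sum>v\<in>V. y v) = 0" by (simp add: y_def sum_subtractf sumI)
  then have qy: "\<bar>\<Sum>u\<in>V. \<Sum>v\<in>V. a u v * y u * y v\<bar> \<le> graph_lambda V E * (\<Sum>v\<in>V. y v * y v)"
    unfolding a_def by (rule regular_quadratic_form_le[OF reg n2])
  have xv: "x v * x v = I S v + I T v - 2 * r * (I S v + I T v) + r * r" for v
  proof -
    have "x v * x v = I S v * I S v + I T v * I T v + 2 * (I S v * I T v) - 2 * r * (I S v + I T v) + r * r"
      by (simp add: x_def algebra_simps)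
    then show ?thesis by (simp add: II)
  qed
  have xx: "(\<Sum>v\<in>V. x v * x v) = 2 * s - 4 * r * s + r * r * n"
    unfolding xv sum.distrib sum_subtractf sum_distrib_left[symmetric] sumI by (simp add: n_def)
  have "y v * y v = I S v + I T v" for v
  proof -
    have "y v * y v = I S v * I S v + I T v * I T v - 2 * (I S v * I T v)"
      by (simp add: y_def algebra_simps)
    then show ?thesis by (simp add: II)
  qed
  then have yy: "(\<Sum>v\<in>V. y v * y v) = 2 * s"
    by (simp add: sum.distrib sumI)
  have row: "(\<Sum>v\<in>V. a u v) = d" if "u \<in> V" for u
    using regular_row_sum[OF reg that] by (simp add: a_def)
  have col: "(\<Sum>u\<in>V. a u v) = d" if "v \<in> V" for v
    using row[OF that] by (simp add: a_def insert_commute)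
  have a0: "a u v * (I S u * I T v) = 0" "a u v * (I T u * I S v) = 0" for u v
    using sep by (auto simp: a_def I_def separated_def insert_commute)
  have "a u v * y u * y v - a u v * x u * x v
     = r * ((I S u + I T u) * a u v) + r * ((I S v + I T v) * a u v) - r * r * a u v" for u v
  proof -
    have "a u v * y u * y v - a u v * x u * x v
       = r * ((I S u + I T u) * a u v) + r * ((I S v + I T v) * a u v) - r * r * a u v
         - 2 * (a u v * (I S u * I T v)) - 2 * (a u v * (I T u * I S v))"
      by (simp add: x_def y_def algebra_simps)
    then show ?thesis by (simp only: a0)
  qed
  then have "(\<Sum>u\<in>V. \<Sum>v\<in>V. a u v * y u * y v) - (\<Sum>u\<in>V. \<Sum>v\<in>V. a u v * x u * x v)
     = (\<Sum>u\<in>V. \<Sum>v\<in>V. r * ((I S u + I T u) * a u v) + r * ((I S v + I T v) * a u v) - r * r * a u v)"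
    by (simp add: sum_subtractf[symmetric])
  also have "\<dots> = r * (\<Sum>u\<in>V. (I S u + I T u) * (\<Sum>v\<in>V. a u v))
       + r * (\<Sum>v\<in>V. (I S v + I T v) * (\<Sum>u\<in>V. a u v)) - r * r * (\<Sum>u\<in>V. \<Sum>v\<in>V. a u v)"
  proof -
    have "(\<Sum>u\<in>V. \<Sum>v\<in>V. r * ((I S u + I T u) * a u v)) = r * (\<Sum>u\<in>V. (I S u + I T u) * (\<Sum>v\<in>V. a u v))"
      by (simp add: sum_distrib_left)
    moreover have "(\<Sum>u\<in>V. \<Sum>v\<in>V. r * ((I S v + I T v) * a u v)) = r * (\<Sum>v\<in>V. (I S v + I T v) * (\<Sum>u\<in>V. a u v))"
      by (subst sum.swap) (simp add: sum_distrib_left)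
    moreover have "(\<Sum>u\<in>V. \<Sum>v\<in>V. r * r * a u v) = r * r * (\<Sum>u\<in>V. \<Sum>v\<in>V. a u v)"
      by (simp add: sum_distrib_left)
    ultimately show ?thesis unfolding sum.distrib sum_subtractf by presburger
  qed
  also have "\<dots> = r * (2 * s * d) + r * (2 * s * d) - r * r * (n * d)"
    using row col by (simp add: sum_distrib_right[symmetric] sum.distrib sumI n_def)
  finally have "r * (2 * s * d) + r * (2 * s * d) - r * r * (n * d)
      \<le> graph_lambda V E * (2 * s - 4 * r * s + r * r * n) + graph_lambda V E * (2 * s)"
    using qx qy unfolding xx yy by linarith
  moreover have "r * (2 * s * d) + r * (2 * s * d) - r * r * (n * d) = (4 * s / n) * (real d * s)"
    using n by (simp add: r_def field_simps)
  moreover have "graph_lambda V E * (2 * s - 4 * r * s + r * r * n) + graph_lambda V E * (2 * s)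
      = (4 * s / n) * (graph_lambda V E * (n - s))"
    using n by (simp add: r_def field_simps)
  ultimately have "(4 * s / n) * (real d * s) \<le> (4 * s / n) * (graph_lambda V E * (n - s))" by simp
  moreover have "4 * s / n > 0" using n s by simp
  ultimately show ?thesis unfolding n_def by (simp only: mult_le_cancel_left_pos)
qed

lemma regular_degree_less_card:
  assumes "regular_graph d V E" "V \<noteq> {}"
  shows "d < card V"
proof -
  obtain v where v: "v \<in> V" using assms(2) by auto
  have V: "finite V" "\<And>e. e \<in> E \<Longrightarrow> e \<subseteq> V \<and> card e = 2" and d: "card (neighbours E v) = d"
    using assms(1) v by (auto simp: regular_graph_def simple_graph_def)
  have "neighbours E v \<subset> V" using V(2) v by (force simp: neighbours_def)
  then show ?thesis using psubset_card_mono[OF V(1)] d by blast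
qed

text \<open>With \<open>k = n - H\<close>, mixing gives
  \<open>(d + \<lambda>) * k \<le> 2 * \<lambda> * n\<close>. The first bound follows from
  \<open>d \<le> d + \<lambda>\<close>. The second follows from
  \<open>d + 3 * \<lambda> \<le> 2 * (d + \<lambda>)\<close> if \<open>\<lambda> \<le> d\<close>,
  and from \<open>k \<le> n\<close> otherwise.\<close>

theorem regular_hopping_number_ge:
  fixes V :: "'a set"
  assumes reg: "regular_graph d V E"
  shows "max (1 - 2 * graph_lambda V E / real d) ((real d - graph_lambda V E) / (real d + 3 * graph_lambda V E)) * real (card V)
          \<le> real (hopping_number V E)" (is "?b * _ \<le> _")
    and "max (1 - 2 * graph_lambda V E / real d) ((real d - graph_lambda V E) / (real d + 3 * graph_lambda V E)) * real (card V)
           = (1 - min (2 * graph_lambda V E / real d) (4 * graph_lambda V E / (real d + 3 * graph_lambda V E))) * real (card V)"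
proof -
  define l where "l = graph_lambda V E"
  define n where "n = card V"
  define H where "H = hopping_number V E"
  have V: "finite V" and E: "\<And>e. e \<in> E \<Longrightarrow> e \<subseteq> V \<and> card e = 2"
    using reg by (auto simp: regular_graph_def simple_graph_def)
  have l0: "l \<ge> 0" by (simp add: l_def graph_lambda_def le_max_iff_disj)
  have "max (1 - 2 * l / d) ((d - l) / (d + 3 * l)) * n \<le> H \<and>
    max (1 - 2 * l / d) ((d - l) / (d + 3 * l)) * n = (1 - min (2 * l / d) (4 * l / (d + 3 * l))) * n"
  proof (cases "d = 0")
    case True
    have "E = {}"
    proof (rule equals0I)
      fix e assume e: "e \<in> E"
      then obtain u v where uv: "e = {u, v}" "u \<in> V" using E by (metis card_2_iff insert_subset)
      have "finite (neighbours E u)"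
        by (rule finite_subset[OF _ V]) (use E in \<open>auto simp: neighbours_def\<close>)
      then have "neighbours E u = {}" using reg uv(2) True by (auto simp: regular_graph_def)
      then show False using e uv by (auto simp: neighbours_def)
    qed
    then have "H = n" using hopping_number_edgeless[OF V] by (simp add: H_def n_def)
    \<comment> \<open>Here \<open>2 * l / d\<close> is 0 by convention and the other quotient is at
      most 0, so the claimed bound is exactly \<open>n\<close>.\<close>
    then show ?thesis using True l0 by (cases "l = 0") (auto simp: max_def min_def)
  next
    case False
    show ?thesis
    proof (cases "V = {}")
      case True
      then show ?thesis by (simp add: n_def)
    next
      case V0: False
      \<comment> \<open>As \<open>d\<close> is positive, there are at least two vertices, without
        which \<open>graph_lambda\<close> has no meaning.\<close>
      have n: "n > d" using regular_degree_less_card[OF reg V0] by (simp add: n_def)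
      have d: "real d > 0" using False by simp
      have Hn: "H \<le> n" using hopping_number_le[OF V] by (simp add: H_def n_def)
      define k where "k = n - H"
      have k: "real k = real n - real H" using Hn by (simp add: k_def)
      define s where "s = (k + 1) div 2"
      have s: "2 * s + H \<le> n + 1" "k \<le> 2 * s" using Hn by (auto simp: s_def k_def)
      have ds: "d * real s \<le> l * (real n - real s)"
      proof (cases "s = 0")
        case True
        then show ?thesis using l0 by simp
      next
        case False
        obtain S T where "S \<subseteq> V" "T \<subseteq> V" "card S = s" "card T = s" "separated E S T"
          using hopping_number_separated[OF V, of s E] s(1) by (auto simp: H_def n_def)
        then show ?thesis
          using separated_mixing[OF reg, of S T s] n False \<open>d \<noteq> 0\<close> unfolding n_def l_def by linarith
      qed
      have "real s \<ge> real k / 2" using s(2) by linarith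
      then have "(d + l) * (real k / 2) \<le> (d + l) * s" using l0 by (intro mult_left_mono) auto
      also have "\<dots> \<le> l * n" using ds by (simp add: algebra_simps)
      finally have dk: "(d + l) * k \<le> 2 * l * n" by simp
      have "d * k \<le> (d + l) * k" using l0 by (simp add: algebra_simps)
      then have "k \<le> 2 * l / d * n" using dk d by (simp add: field_simps)
      then have b1: "(1 - 2 * l / d) * n \<le> H" using k by (simp add: algebra_simps)
      have "(d + 3 * l) * k \<le> 4 * l * n"
      proof (cases "l \<le> d")
        case True
        have "(d + 3 * l) * k \<le> 2 * ((d + l) * k)"
          using mult_right_mono[of "d + 3 * l" "2 * (d + l)" k] True by (simp add: algebra_simps)
        then show ?thesis using dk by linarith
      next
        case False
        have "(d + 3 * l) * k \<le> (4 * l) * n"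
          using False l0 k by (intro mult_mono) auto
        then show ?thesis by simp
      qed
      then have "k \<le> 4 * l / (d + 3 * l) * n" using d l0 by (simp add: field_simps)
      moreover
      have e2: "(d - l) / (d + 3 * l) = 1 - 4 * l / (d + 3 * l)"
        using d l0 by (simp add: field_simps)
      have "(d - l) / (d + 3 * l) * n = n - 4 * l / (d + 3 * l) * n"
        unfolding e2 left_diff_distrib by simp
      ultimately have "(d - l) / (d + 3 * l) * n \<le> H" using k by linarith
      moreover have "max (1 - 2 * l / d) (1 - 4 * l / (d + 3 * l)) = 1 - min (2 * l / d) (4 * l / (d + 3 * l))"
        by (simp add: max_def min_def)
      ultimately show ?thesis using b1 e2 by (simp add: max_def)
    qed
  qed
  then show "?b * real (card V) \<le> real (hopping_number V E)"
    "?b * real (card V) = (1 - min (2 * graph_lambda V E / real d) (4 * graph_lambda V E / (real d + 3 * graph_lambda V E))) * real (card V)"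
    by (auto simp: l_def n_def H_def)
qed

section \<open>The configuration model\<close>


text \<open>A loop shows up as a singleton and a multiple edge as a repeated entry, so the list
  still records the whole multigraph.\<close>

fun edge_list :: "'a list \<Rightarrow> 'a set list" where
  "edge_list (a # b # xs) = {a, b} # edge_list xs"
| "edge_list _ = []"

lemma length_edge_list: "length (edge_list xs) = length xs div 2"
  by (induction xs rule: edge_list.induct) auto

lemma nth_edge_list: "i < length xs div 2 \<Longrightarrow> edge_list xs ! i = {xs ! (2 * i), xs ! (2 * i + 1)}"
proof (induction xs arbitrary: i rule: edge_list.induct)
  case (1 a b xs)
  then show ?case by (cases i) auto
qed auto

lemma edge_list_map: "edge_list (map f xs) = map ((`) f) (edge_list xs)"
  by (induction xs rule: edge_list.induct) auto

lemma Union_edge_list_subset: "\<Union>(set (edge_list xs)) \<subseteq> set xs"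
  by (induction xs rule: edge_list.induct) auto

lemma length_Suc_Suc_cases:
  assumes "length xs = 2 * Suc m"
  obtains a b ys where "xs = a # b # ys" "length ys = 2 * m"
proof -
  have "length xs = Suc (Suc (2 * m))" using assms by simp
  then show ?thesis using that by (auto simp: length_Suc_conv)
qed

section \<open>Orderings and orientations of a set of edges\<close>

lemma card_orientations:
  assumes "finite G" "\<And>e. e \<in> G \<Longrightarrow> card e = 2"
  shows "finite {(a, b). {a, b} \<in> G}" "card {(a, b). {a, b} \<in> G} = 2 * card G"
proof -
  have un: "{(a, b). {a, b} \<in> G} = (\<Union>e\<in>G. {(a, b). {a, b} = e})" by auto
  have two: "finite {(a, b). {a, b} = e} \<and> card {(a, b). {a, b} = e} = 2" if e: "e \<in> G" for e
  proof -
    obtain u v where "e = {u, v}" "u \<noteq> v" using assms(2)[OF e] unfolding card_2_iff by blast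
    then have "{(a, b). {a, b} = e} = {(u, v), (v, u)}" "(u, v) \<noteq> (v, u)"
      by (auto simp: doubleton_eq_iff)
    then show ?thesis by simp
  qed
  show "finite {(a, b). {a, b} \<in> G}" unfolding un using two assms(1) by simp
  have "card {(a, b). {a, b} \<in> G} = (\<Sum>e\<in>G. card {(a, b). {a, b} = e})"
    unfolding un by (rule card_UN_disjoint) (use two assms(1) in auto)
  then show "card {(a, b). {a, b} \<in> G} = 2 * card G" using two by simp
qed

text \<open>The first two entries can be any edge in either of its two orientations; the remaining
  entries then list the other edges. This gives the factor \<open>2 * Suc m\<close> in each
  step.\<close>

lemma card_edge_orderings:
  assumes "finite G" "card G = m" "\<And>e. e \<in> G \<Longrightarrow> card e = 2"
  shows "finite {xs. length xs = 2 * m \<and> set (edge_list xs) = G} \<and>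
    card {xs. length xs = 2 * m \<and> set (edge_list xs) = G} = 2 ^ m * fact m"
  using assms
proof (induction m arbitrary: G)
  case 0
  then have "{xs. length xs = 2 * 0 \<and> set (edge_list xs) = G} = {[]}" by auto
  then show ?case by simp
next
  case (Suc m)
  define F where "F H = {xs :: 'a list. length xs = 2 * m \<and> set (edge_list xs) = H}" for H
  let ?A = "{(a, b). {a, b} \<in> G}"
  let ?B = "SIGMA p:?A. F (G - {{fst p, snd p}})"
  let ?g = "\<lambda>((a, b), xs). a # b # xs :: 'a list"
  have eq: "{xs. length xs = 2 * Suc m \<and> set (edge_list xs) = G} = ?g ` ?B"
  proof (intro equalityI subsetI)
    fix xs assume "xs \<in> {xs. length xs = 2 * Suc m \<and> set (edge_list xs) = G}"
    then have xs: "length xs = 2 * Suc m" "set (edge_list xs) = G" by auto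
    obtain a b ys where ys: "xs = a # b # ys" "length ys = 2 * m"
      using length_Suc_Suc_cases[OF xs(1)] .
    \<comment> \<open>Only \<open>m\<close> pairs are left for the other \<open>m\<close> edges, so
      the first edge cannot occur again.\<close>
    have "card (set (edge_list ys)) \<le> m"
      using card_length[of "edge_list ys"] ys(2) by (simp add: length_edge_list)
    moreover have "G = insert {a, b} (set (edge_list ys))" using xs ys by auto
    ultimately have "{a, b} \<notin> set (edge_list ys)"
      using Suc.prems(2) by (metis insert_absorb Suc_n_not_le_n)
    then have "ys \<in> F (G - {{a, b}})" using xs ys by (auto simp: F_def)
    then have "((a, b), ys) \<in> ?B" using xs ys by auto
    then show "xs \<in> ?g ` ?B" using ys(1) by (auto simp: image_iff)
  next
    fix xs assume "xs \<in> ?g ` ?B"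
    then obtain a b ys where xs: "xs = a # b # ys" "{a, b} \<in> G" "ys \<in> F (G - {{a, b}})" by auto
    then have "set (edge_list xs) = insert {a, b} (G - {{a, b}})" "length xs = 2 * Suc m"
      by (simp_all add: F_def)
    then show "xs \<in> {xs. length xs = 2 * Suc m \<and> set (edge_list xs) = G}"
      using insert_Diff[OF xs(2)] by simp
  qed
  have F: "finite (F (G - {{fst p, snd p}})) \<and> card (F (G - {{fst p, snd p}})) = 2 ^ m * fact m" if pA: "p \<in> ?A" for p
  proof -
    from pA obtain a b where p: "p = (a, b)" "{a, b} \<in> G" by auto
    have "finite (G - {{a, b}})" using Suc.prems(1) by (rule finite_Diff)
    moreover have "card (G - {{a, b}}) = m" using Suc.prems(2) p(2) by (simp only: card_Diff_singleton)
    moreover have "card e = 2" if "e \<in> G - {{a, b}}" for e using Suc.prems(3) that by blast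
    ultimately show ?thesis
      unfolding F_def p(1) fst_conv snd_conv by (rule Suc.IH)
  qed
  have inj: "inj_on ?g ?B" by (intro inj_onI) clarsimp
  note A = card_orientations[OF Suc.prems(1,3)]
  have "card ?B = 2 * card G * (2 ^ m * fact m)"
  proof -
    have "card ?B = (\<Sum>p\<in>?A. card (F (G - {{fst p, snd p}})))"
    proof (rule card_SigmaI)
      show "\<forall>p\<in>?A. finite (F (G - {{fst p, snd p}}))" using F by simp
    qed (rule A(1))
    also have "\<dots> = (\<Sum>p\<in>?A. 2 ^ m * fact m)"
    proof (rule sum.cong[OF refl])
      show "card (F (G - {{fst p, snd p}})) = 2 ^ m * fact m" if "p \<in> ?A" for p
        using F[OF that] by simp
    qed
    finally show ?thesis by (simp add: A(2))
  qed
  moreover have "finite ?B"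
  proof (rule finite_SigmaI)
    show "finite (F (G - {{fst p, snd p}}))" if "p \<in> ?A" for p using F[OF that] by simp
  qed (rule A(1))
  ultimately show ?case
    unfolding eq card_image[OF inj] using Suc.prems(2) finite_imageI[of ?B ?g] by (simp add: algebra_simps)
qed

text \<open>The ends at one vertex are not labelled: a configuration is a word in which each vertex
  occurs \<open>d\<close> times. A uniform word induces the same random multigraph as a uniform
  matching of labelled ends, and words are counted by a multinomial coefficient.\<close>

definition degree_mset :: "nat \<Rightarrow> 'a set \<Rightarrow> 'a multiset" where
  "degree_mset d V = (\<Sum>v\<in>V. replicate_mset d v)"

lemma count_degree_mset: "finite V \<Longrightarrow> count (degree_mset d V) v = (if v \<in> V then d else 0)"
  unfolding degree_mset_def by (simp add: count_sum)

lemma size_degree_mset: "size (degree_mset d V) = d * card V"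
  unfolding degree_mset_def by (simp add: size_multiset_sum)

text \<open>The configuration model: a list of the \<open>d n\<close> ends of the edges, those of the \<open>i\<close>-th edge
  being in the positions \<open>2 i\<close> and \<open>2 i + 1\<close>.\<close>

definition configs :: "nat \<Rightarrow> 'a set \<Rightarrow> 'a list set" where
  "configs d V = permutations_of_multiset (degree_mset d V)"

lemma configs_iff: "xs \<in> configs d V \<longleftrightarrow> mset xs = degree_mset d V"
  by (simp add: configs_def permutations_of_multiset_def)

lemma finite_configs [simp]: "finite (configs d V)"
  by (simp add: configs_def)

lemma length_configs: "xs \<in> configs d V \<Longrightarrow> length xs = d * card V"
  by (metis configs_iff size_degree_mset size_mset)

lemma card_configs:
  assumes "finite V"
  shows "card (configs d V) * fact d ^ card V = fact (d * card V)"
proof -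
  have prod: "(\<Prod>x\<in>set_mset (degree_mset d V). fact (count (degree_mset d V) x)) = (fact d ^ card V :: nat)"
  proof (cases "d = 0")
    case True
    then have "degree_mset d V = {#}" by (intro multiset_eqI) (simp add: count_degree_mset assms)
    then show ?thesis using True by simp
  next
    case False
    then have "set_mset (degree_mset d V) = V"
      by (auto simp: set_mset_def count_degree_mset assms)
    then show ?thesis by (simp add: count_degree_mset assms)
  qed
  show ?thesis
    unfolding configs_def using card_permutations_of_multiset_aux[of "degree_mset d V"]
    by (simp only: prod size_degree_mset)
qed

section \<open>Simple configurations and regular graphs\<close>

definition simple_config :: "'a list \<Rightarrow> bool" where
  "simple_config xs \<longleftrightarrow> distinct (edge_list xs) \<and> (\<forall>e\<in>set (edge_list xs). card e = 2)"

lemma count_mset_edge_list: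
  assumes "even (length xs)" "\<forall>e\<in>set (edge_list xs). card e = 2"
  shows "count (mset xs) v = length (filter (\<lambda>e. v \<in> e) (edge_list xs))"
  using assms
proof (induction xs rule: edge_list.induct)
  case (1 a b xs)
  then have "a \<noteq> b" by auto
  then show ?case using 1 by auto
qed auto

lemma card_neighbours_eq:
  assumes "\<And>e. e \<in> G \<Longrightarrow> card e = 2"
  shows "card (neighbours G v) = card {e \<in> G. v \<in> e}"
proof -
  have "{e \<in> G. v \<in> e} = (\<lambda>u. {v, u}) ` neighbours G v"
  proof (intro equalityI subsetI)
    fix e assume e: "e \<in> {e \<in> G. v \<in> e}"
    then obtain u w where "e = {u, w}" using assms[of e] unfolding card_2_iff by blast
    then have "\<exists>x. e = {v, x}" using e by auto
    then show "e \<in> (\<lambda>u. {v, u}) ` neighbours G v" using e by (auto simp: neighbours_def)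
  qed (auto simp: neighbours_def)
  moreover have "inj_on (\<lambda>u. {v, u}) (neighbours G v)"
    by (auto simp: inj_on_def doubleton_eq_iff)
  ultimately show ?thesis by (simp add: card_image)
qed

text \<open>Without loops, every edge at \<open>v\<close> contributes exactly one occurrence of
  \<open>v\<close>; without repetitions, these edges correspond to the neighbours.\<close>

lemma count_mset_simple_config:
  assumes "even (length xs)" "simple_config xs"
  shows "count (mset xs) v = card (neighbours (set (edge_list xs)) v)"
proof -
  have "count (mset xs) v = card (set (filter (\<lambda>e. v \<in> e) (edge_list xs)))"
    using assms by (simp add: count_mset_edge_list simple_config_def distinct_card del: set_filter)
  then show ?thesis using assms by (subst card_neighbours_eq) (auto simp: simple_config_def)
qed

lemma regular_graph_edge_list_iff:
  assumes "finite V" "even (length xs)" "simple_config xs"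
  shows "regular_graph d V (set (edge_list xs)) \<longleftrightarrow> xs \<in> configs d V"
proof
  let ?G = "set (edge_list xs)"
  assume reg: "regular_graph d V ?G"
  have "neighbours ?G v = {}" if "v \<notin> V" for v
    using reg that by (auto simp: regular_graph_def simple_graph_def neighbours_def)
  then show "xs \<in> configs d V"
    using reg unfolding configs_iff
    by (intro multiset_eqI) (auto simp: count_mset_simple_config assms count_degree_mset regular_graph_def)
next
  let ?G = "set (edge_list xs)"
  assume c: "xs \<in> configs d V"
  then have deg: "card (neighbours ?G v) = (if v \<in> V then d else 0)" for v
    using count_mset_simple_config[OF assms(2,3), of v] by (simp add: configs_iff count_degree_mset assms(1))
  have "set xs \<subseteq> V"
  proof
    fix v assume "v \<in> set xs"
    then have "count (degree_mset d V) v \<noteq> 0" using c by (metis configs_iff count_eq_zero_iff set_mset_mset)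
    then show "v \<in> V" by (simp add: count_degree_mset assms(1) split: if_splits)
  qed
  then show "regular_graph d V ?G"
    using deg Union_edge_list_subset[of xs] assms by (auto simp: regular_graph_def simple_graph_def simple_config_def)
qed

text \<open>Listing the edges of \<open>G\<close> in any order gives a simple word whose counts are
  the degrees, hence a configuration. Its length \<open>d * card V\<close> then reveals the number
  of edges.\<close>

lemma regular_graph_orderings:
  assumes reg: "regular_graph d V G" and m: "d * card V = 2 * m"
  shows "card G = m"
    and "{xs \<in> configs d V. simple_config xs \<and> set (edge_list xs) = G} = {xs. length xs = 2 * m \<and> set (edge_list xs) = G}"
proof -
  have V: "finite V" and G: "G \<subseteq> Pow V" and two: "\<And>e. e \<in> G \<Longrightarrow> card e = 2"
    using reg by (auto simp: regular_graph_def simple_graph_def)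
  have fin: "finite G" using finite_subset[OF G] V by simp
  have conf: "xs \<in> configs d V \<and> simple_config xs" if "length xs = 2 * card G" "set (edge_list xs) = G" for xs
  proof -
    have "distinct (edge_list xs)"
      by (rule card_distinct) (simp add: length_edge_list that)
    then have "simple_config xs" using two that by (auto simp: simple_config_def)
    then show ?thesis using regular_graph_edge_list_iff[OF V, of xs d] reg that by simp
  qed
  have "card {xs. length xs = 2 * card G \<and> set (edge_list xs) = G} > 0"
    using card_edge_orderings[OF fin refl two] by simp
  then have "{xs. length xs = 2 * card G \<and> set (edge_list xs) = G} \<noteq> {}" by force
  then obtain xs where xs: "length xs = 2 * card G" "set (edge_list xs) = G" by auto
  then show cG: "card G = m" using length_configs[of xs d V] conf[OF xs] m by simp
  show "{xs \<in> configs d V. simple_config xs \<and> set (edge_list xs) = G} = {xs. length xs = 2 * m \<and> set (edge_list xs) = G}"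
    using conf cG length_configs[of _ d V] m by auto
qed

text \<open>Every regular graph arises from the same number of configurations. A uniform simple
  configuration thus yields a uniform regular graph, and probabilities can be compared by counting
  words.\<close>

lemma card_simple_configs:
  assumes V: "finite V" and m: "d * card V = 2 * m"
  shows "card {xs \<in> configs d V. simple_config xs \<and> P (set (edge_list xs))}
       = card {G. regular_graph d V G \<and> P G} * (2 ^ m * fact m)"
proof -
  define F where "F G = {xs. length xs = 2 * m \<and> set (edge_list xs) = G}" for G :: "'a set set"
  let ?R = "{G. regular_graph d V G \<and> P G}"
  have "?R \<subseteq> Pow (Pow V)" by (auto simp: regular_graph_def simple_graph_def)
  then have finR: "finite ?R" by (rule finite_subset) (simp add: V)
  have "{xs \<in> configs d V. simple_config xs \<and> P (set (edge_list xs))} = (\<Union>G\<in>?R. F G)"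
  proof (intro equalityI subsetI)
    fix xs assume xs: "xs \<in> {xs \<in> configs d V. simple_config xs \<and> P (set (edge_list xs))}"
    then have "length xs = 2 * m" using length_configs[of xs d V] m by simp
    then have "regular_graph d V (set (edge_list xs))" "xs \<in> F (set (edge_list xs))"
      using xs regular_graph_edge_list_iff[OF V, of xs d] by (auto simp: F_def)
    then show "xs \<in> (\<Union>G\<in>?R. F G)" using xs by blast
  next
    fix xs assume "xs \<in> (\<Union>G\<in>?R. F G)"
    then obtain G where G: "regular_graph d V G" "P G" "xs \<in> F G" by auto
    then show "xs \<in> {xs \<in> configs d V. simple_config xs \<and> P (set (edge_list xs))}"
      using regular_graph_orderings(2)[OF G(1) m] unfolding F_def by auto
  qed
  moreover have F: "finite (F G) \<and> card (F G) = 2 ^ m * fact m" if "G \<in> ?R" for G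
    unfolding F_def
  proof (rule card_edge_orderings)
    show "card G = m" using regular_graph_orderings(1)[OF _ m] that by simp
    have "G \<subseteq> Pow V" using that by (auto simp: regular_graph_def simple_graph_def)
    then show "finite G" by (rule finite_subset) (simp add: V)
  qed (use that in \<open>auto simp: regular_graph_def simple_graph_def\<close>)
  moreover have "card (\<Union>G\<in>?R. F G) = (\<Sum>G\<in>?R. card (F G))"
    by (rule card_UN_disjoint) (use F finR in \<open>auto simp: F_def\<close>)
  ultimately show ?thesis by simp
qed

section \<open>Switchings\<close>


text \<open>Edges \<open>(u, w)\<close> and \<open>(y, z)\<close> become \<open>(u, z)\<close> and
  \<open>(y, w)\<close>. For \<open>i = j\<close> nothing changes.\<close>

definition swap_ends :: "nat \<Rightarrow> nat \<Rightarrow> 'a list \<Rightarrow> 'a list" where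
  "swap_ends i j xs = xs[2 * i + 1 := xs ! (2 * j + 1), 2 * j + 1 := xs ! (2 * i + 1)]"

definition is_loop :: "'a list \<Rightarrow> nat \<Rightarrow> bool" where
  "is_loop xs i \<longleftrightarrow> xs ! (2 * i) = xs ! (2 * i + 1)"

definition is_parallel :: "'a list \<Rightarrow> nat \<Rightarrow> bool" where
  "is_parallel xs i \<longleftrightarrow> (\<exists>k < length xs div 2. k \<noteq> i \<and> {xs ! (2 * k), xs ! (2 * k + 1)} = {xs ! (2 * i), xs ! (2 * i + 1)})"

definition bad_edges :: "'a list \<Rightarrow> nat set" where
  "bad_edges xs = {i. i < length xs div 2 \<and> (is_loop xs i \<or> is_parallel xs i)}"

text \<open>The neighbourhood of \<open>u\<close> in the multigraph; it contains \<open>u\<close>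
  itself exactly if there is a loop at \<open>u\<close>.\<close>

definition partners :: "'a list \<Rightarrow> 'a \<Rightarrow> 'a set" where
  "partners xs u = {w. \<exists>k < length xs div 2. {u, w} = {xs ! (2 * k), xs ! (2 * k + 1)}}"

lemma finite_bad_edges [simp]: "finite (bad_edges xs)"
  by (simp add: bad_edges_def)

lemma simple_config_iff_bad_edges: "simple_config xs \<longleftrightarrow> bad_edges xs = {}"
proof -
  let ?m = "length xs div 2"
  define e where "e i = {xs ! (2 * i), xs ! (2 * i + 1)}" for i
  have nth: "edge_list xs ! i = e i" if "i < ?m" for i
    using nth_edge_list[OF that] by (simp add: e_def)
  have par: "is_parallel xs i \<longleftrightarrow> (\<exists>k<?m. k \<noteq> i \<and> e k = e i)" for i
    by (simp add: is_parallel_def e_def)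
  have "distinct (edge_list xs) \<longleftrightarrow> (\<forall>i<?m. \<forall>k<?m. i \<noteq> k \<longrightarrow> e i \<noteq> e k)"
    unfolding distinct_conv_nth length_edge_list by (simp add: nth)
  then have "distinct (edge_list xs) \<longleftrightarrow> (\<forall>i<?m. \<not> is_parallel xs i)"
    unfolding par by blast
  moreover have "card {a, b} = 2 \<longleftrightarrow> a \<noteq> b" for a b :: 'a
    by (cases "a = b") auto
  then have "(\<forall>e\<in>set (edge_list xs). card e = 2) \<longleftrightarrow> (\<forall>i<?m. \<not> is_loop xs i)"
    unfolding all_set_conv_all_nth length_edge_list is_loop_def by (simp add: nth e_def)
  ultimately show ?thesis by (auto simp: simple_config_def bad_edges_def)
qed

locale configuration_model =
  fixes d :: nat and V :: "'a set" and m :: nat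
  assumes finite_V: "finite V" and double_m: "d * card V = 2 * m"
begin

abbreviation \<Omega> :: "'a list set" where "\<Omega> \<equiv> configs d V"

lemma length_\<Omega>: "xs \<in> \<Omega> \<Longrightarrow> length xs = 2 * m"
  using length_configs double_m by metis

lemma swap_ends_in:
  assumes "xs \<in> \<Omega>" "i < m" "j < m"
  shows "swap_ends i j xs \<in> \<Omega>"
  using assms mset_swap[of "2 * j + 1" xs "2 * i + 1"]
  by (simp add: configs_iff swap_ends_def length_\<Omega> list_update_swap)

lemma nth_swap_ends:
  assumes "length xs = 2 * m" "i < m" "j < m" "k < m"
  shows "swap_ends i j xs ! (2 * k) = xs ! (2 * k)"
    and "swap_ends i j xs ! (2 * k + 1) = (if k = i then xs ! (2 * j + 1) else if k = j then xs ! (2 * i + 1) else xs ! (2 * k + 1))"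
  using assms unfolding swap_ends_def by (auto simp: nth_list_update) presburger+

lemma length_swap_ends [simp]: "length (swap_ends i j xs) = length xs"
  by (simp add: swap_ends_def)

lemma swap_ends_involution:
  assumes "length xs = 2 * m" "i < m" "j < m"
  shows "swap_ends i j (swap_ends i j xs) = xs"
  using assms unfolding swap_ends_def
  by (intro nth_equalityI) (auto simp: nth_list_update)

lemma bij_swap_ends:
  assumes "i < m" "j < m"
  shows "bij_betw (swap_ends i j) \<Omega> \<Omega>"
  by (rule bij_betw_byWitness[where f' = "swap_ends i j"])
     (auto simp: assms swap_ends_in swap_ends_involution length_\<Omega>)

lemma card_positions_le:
  assumes "xs \<in> \<Omega>" "inj_on f {..<m}" "\<And>k. k < m \<Longrightarrow> f k < 2 * m"
  shows "card {k. k < m \<and> xs ! f k = v} \<le> d"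
proof -
  have "card {k. k < m \<and> xs ! f k = v} = card (f ` {k. k < m \<and> xs ! f k = v})"
    by (rule card_image[symmetric]) (rule inj_on_subset[OF assms(2)], auto)
  also have "\<dots> \<le> card {p. p < length xs \<and> xs ! p = v}"
    by (rule card_mono) (use assms length_\<Omega>[OF assms(1)] in auto)
  also have "\<dots> = length (filter (\<lambda>x. x = v) xs)"
    by (simp add: length_filter_conv_card)
  also have "\<dots> = count (mset xs) v"
    by (induction xs) auto
  also have "\<dots> \<le> d"
    using assms(1) by (simp add: configs_iff count_degree_mset finite_V)
  finally show ?thesis .
qed

lemma card_first_end_le: "xs \<in> \<Omega> \<Longrightarrow> card {k. k < m \<and> xs ! (2 * k) = v} \<le> d"
  by (rule card_positions_le) (auto simp: inj_on_def)

lemma card_second_end_le: "xs \<in> \<Omega> \<Longrightarrow> card {k. k < m \<and> xs ! (2 * k + 1) = v} \<le> d"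
  by (rule card_positions_le) (auto simp: inj_on_def)

lemma card_ends_in_le:
  assumes "xs \<in> \<Omega>" "finite Z"
  shows "card {k. k < m \<and> xs ! (2 * k) \<in> Z} \<le> d * card Z"
    and "card {k. k < m \<and> xs ! (2 * k + 1) \<in> Z} \<le> d * card Z"
proof -
  have "{k. k < m \<and> xs ! (2 * k) \<in> Z} = (\<Union>v\<in>Z. {k. k < m \<and> xs ! (2 * k) = v})" by auto
  also have "card \<dots> \<le> (\<Sum>v\<in>Z. card {k. k < m \<and> xs ! (2 * k) = v})"
    by (rule card_UN_le[OF assms(2)])
  also have "\<dots> \<le> d * card Z"
    using sum_bounded_above[of Z "\<lambda>v. card {k. k < m \<and> xs ! (2 * k) = v}" d] card_first_end_le[OF assms(1)]
    by (simp add: mult.commute)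
  finally show "card {k. k < m \<and> xs ! (2 * k) \<in> Z} \<le> d * card Z" .
  have "{k. k < m \<and> xs ! (2 * k + 1) \<in> Z} = (\<Union>v\<in>Z. {k. k < m \<and> xs ! (2 * k + 1) = v})" by auto
  also have "card \<dots> \<le> (\<Sum>v\<in>Z. card {k. k < m \<and> xs ! (2 * k + 1) = v})"
    by (rule card_UN_le[OF assms(2)])
  also have "\<dots> \<le> d * card Z"
    using sum_bounded_above[of Z "\<lambda>v. card {k. k < m \<and> xs ! (2 * k + 1) = v}" d] card_second_end_le[OF assms(1)]
    by (simp add: mult.commute)
  finally show "card {k. k < m \<and> xs ! (2 * k + 1) \<in> Z} \<le> d * card Z" .
qed

lemma card_partners_le:
  assumes "xs \<in> \<Omega>"
  shows "finite (partners xs u)" "card (partners xs u) \<le> 2 * d"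
proof -
  let ?A = "{k. k < m \<and> xs ! (2 * k) = u}" and ?B = "{k. k < m \<and> xs ! (2 * k + 1) = u}"
  let ?P = "(\<lambda>k. xs ! (2 * k + 1)) ` ?A \<union> (\<lambda>k. xs ! (2 * k)) ` ?B"
  have sub: "partners xs u \<subseteq> ?P"
    using length_\<Omega>[OF assms] by (auto simp: partners_def doubleton_eq_iff)
  show "finite (partners xs u)" by (rule finite_subset[OF sub]) simp
  have "card (partners xs u) \<le> card ?P" by (rule card_mono[OF _ sub]) simp
  also have "\<dots> \<le> card ((\<lambda>k. xs ! (2 * k + 1)) ` ?A) + card ((\<lambda>k. xs ! (2 * k)) ` ?B)"
    by (rule card_Un_le)
  also have "\<dots> \<le> card ?A + card ?B" by (intro add_mono card_image_le) auto
  also have "\<dots> \<le> d + d" using card_first_end_le[OF assms] card_second_end_le[OF assms] by (rule add_mono)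
  finally show "card (partners xs u) \<le> 2 * d" by simp
qed

text \<open>Averaging over the swaps: a property of a fixed edge is rare if from every configuration it
  is reached by few swaps.\<close>

lemma card_configs_swap:
  assumes "i < m"
  shows "card {xs \<in> \<Omega>. P xs} * m = (\<Sum>xs\<in>\<Omega>. card {j. j < m \<and> P (swap_ends i j xs)})"
proof -
  have "(\<Sum>xs\<in>\<Omega>. card {j. j < m \<and> P (swap_ends i j xs)}) = (\<Sum>xs\<in>\<Omega>. \<Sum>j<m. of_bool (P (swap_ends i j xs)))"
    by (rule sum.cong[OF refl]) (simp add: Int_def)
  also have "\<dots> = (\<Sum>j<m. \<Sum>xs\<in>\<Omega>. of_bool (P (swap_ends i j xs)))" by (rule sum.swap)
  also have "\<dots> = (\<Sum>j<m. \<Sum>xs\<in>\<Omega>. of_bool (P xs))"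
  proof (rule sum.cong[OF refl])
    fix j assume "j \<in> {..<m}"
    then have "j < m" by simp
    from sum.reindex_bij_betw[OF bij_swap_ends[OF assms this], of "\<lambda>xs. of_bool (P xs) :: nat"]
    show "(\<Sum>xs\<in>\<Omega>. of_bool (P (swap_ends i j xs))) = (\<Sum>xs\<in>\<Omega>. of_bool (P xs) :: nat)" .
  qed
  also have "\<dots> = card {xs \<in> \<Omega>. P xs} * m" by (simp add: Int_def)
  finally show ?thesis by simp
qed

text \<open>A swap with \<open>j\<close> makes edge \<open>i\<close> a loop only if the second end
  of \<open>j\<close> is the first end of \<open>i\<close>, and a vertex is an end at most
  \<open>d\<close> times.\<close>

lemma card_loop_configs:
  assumes "i < m"
  shows "card {xs \<in> \<Omega>. is_loop xs i} * m \<le> d * card \<Omega>"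
proof -
  have "card {j. j < m \<and> is_loop (swap_ends i j xs) i} \<le> d" if xs: "xs \<in> \<Omega>" for xs
  proof -
    have sub: "{j. j < m \<and> is_loop (swap_ends i j xs) i} \<subseteq> {j. j < m \<and> xs ! (2 * j + 1) = xs ! (2 * i)}"
      using nth_swap_ends[OF length_\<Omega>[OF xs] assms _ assms] by (auto simp: is_loop_def)
    show ?thesis
      by (rule order_trans[OF card_mono[OF _ sub] card_second_end_le[OF xs]]) simp
  qed
  then show ?thesis
    unfolding card_configs_swap[OF assms] using sum_bounded_above[of \<Omega> _ d] by (simp add: mult.commute)
qed

text \<open>Let \<open>u\<close> be the first end of \<open>i\<close> and \<open>z\<close> the
  second end of \<open>j\<close>; edge \<open>i\<close> becomes \<open>{u, z}\<close>. A parallel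
  edge other than \<open>j\<close> was there before, which makes \<open>z\<close> a partner of
  \<open>u\<close>. If the parallel edge is \<open>j\<close> itself, comparing ends leaves the other
  two cases.\<close>

lemma parallel_after_swap:
  assumes xs: "xs \<in> \<Omega>" and i: "i < m" and j: "j < m" "j \<noteq> i"
    and par: "is_parallel (swap_ends i j xs) i"
  shows "xs ! (2 * j + 1) \<in> partners xs (xs ! (2 * i)) \<or> xs ! (2 * j) = xs ! (2 * i) \<or> is_loop xs i"
proof -
  note len = length_\<Omega>[OF xs]
  note nth = nth_swap_ends[OF len i j(1)]
  have si: "{swap_ends i j xs ! (2 * i), swap_ends i j xs ! (2 * i + 1)} = {xs ! (2 * i), xs ! (2 * j + 1)}"
    using nth[OF i] by simp
  from par obtain k where "k < length (swap_ends i j xs) div 2" "k \<noteq> i"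
    "{swap_ends i j xs ! (2 * k), swap_ends i j xs ! (2 * k + 1)} = {xs ! (2 * i), xs ! (2 * j + 1)}"
    unfolding is_parallel_def si by blast
  then have k: "k < m" "k \<noteq> i"
    "{swap_ends i j xs ! (2 * k), swap_ends i j xs ! (2 * k + 1)} = {xs ! (2 * i), xs ! (2 * j + 1)}"
    using len by simp_all
  show ?thesis
  proof (cases "k = j")
    case True
    then have "{xs ! (2 * j), xs ! (2 * i + 1)} = {xs ! (2 * i), xs ! (2 * j + 1)}"
      using k nth[OF k(1)] by simp
    then show ?thesis by (auto simp: doubleton_eq_iff is_loop_def)
  next
    case False
    then have "{xs ! (2 * k), xs ! (2 * k + 1)} = {xs ! (2 * i), xs ! (2 * j + 1)}"
      using k nth[OF k(1)] by simp
    then have "xs ! (2 * j + 1) \<in> partners xs (xs ! (2 * i))"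
      unfolding partners_def using k(1) len by (intro CollectI exI[of _ k]) simp
    then show ?thesis ..
  qed
qed

text \<open>At most \<open>2 * d * d\<close> indices \<open>j\<close> have their second end among
  the partners, at most \<open>d\<close> have first end \<open>u\<close>, and one is
  \<open>i\<close> itself. If \<open>i\<close> is a loop, all \<open>m\<close> swaps are allowed
  for; by \<open>card_loop_configs\<close> these configurations cost only another
  \<open>d\<close>.\<close>

lemma card_parallel_configs:
  assumes i: "i < m"
  shows "card {xs \<in> \<Omega>. is_parallel xs i} * m \<le> (2 * d * d + 2 * d + 1) * card \<Omega>"
proof -
  have "card {j. j < m \<and> is_parallel (swap_ends i j xs) i} \<le> (2 * d * d + d + 1) + m * of_bool (is_loop xs i)"
    if xs: "xs \<in> \<Omega>" for xs
  proof (cases "is_loop xs i")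
    case True
    have "card {j. j < m \<and> is_parallel (swap_ends i j xs) i} \<le> card {..<m}"
      by (rule card_mono) auto
    then show ?thesis using True by simp
  next
    case False
    let ?u = "xs ! (2 * i)"
    let ?A = "{j. j < m \<and> xs ! (2 * j + 1) \<in> partners xs ?u}" and ?B = "{j. j < m \<and> xs ! (2 * j) = ?u}"
    have "{j. j < m \<and> is_parallel (swap_ends i j xs) i} \<subseteq> insert i (?A \<union> ?B)"
      using parallel_after_swap[OF xs i] False by blast
    then have "card {j. j < m \<and> is_parallel (swap_ends i j xs) i} \<le> card (insert i (?A \<union> ?B))"
      by (rule card_mono[rotated]) simp
    also have "\<dots> \<le> Suc (card (?A \<union> ?B))" by (rule card_insert_le_m1) auto
    also have "\<dots> \<le> Suc (card ?A + card ?B)" using card_Un_le by blast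
    finally have "card {j. j < m \<and> is_parallel (swap_ends i j xs) i} \<le> Suc (card ?A + card ?B)" .
    moreover have "card ?A \<le> d * card (partners xs ?u)"
      by (rule card_ends_in_le(2)[OF xs card_partners_le(1)[OF xs]])
    moreover have "d * card (partners xs ?u) \<le> d * (2 * d)"
      by (rule mult_le_mono2[OF card_partners_le(2)[OF xs]])
    moreover have "card ?B \<le> d" by (rule card_first_end_le[OF xs])
    moreover have "d * (2 * d) = 2 * d * d" by simp
    ultimately show ?thesis by linarith
  qed
  then have "card {xs \<in> \<Omega>. is_parallel xs i} * m \<le> (\<Sum>xs\<in>\<Omega>. (2 * d * d + d + 1) + m * of_bool (is_loop xs i))"
    unfolding card_configs_swap[OF i] by (rule sum_mono)
  also have "\<dots> = (2 * d * d + d + 1) * card \<Omega> + card {xs \<in> \<Omega>. is_loop xs i} * m"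
  proof -
    have "(\<Sum>xs\<in>\<Omega>. of_bool (is_loop xs i)) = card {xs \<in> \<Omega>. is_loop xs i}" by (simp add: Int_def)
    then show ?thesis
      unfolding sum.distrib sum_constant sum_distrib_left[symmetric] by (simp add: algebra_simps)
  qed
  also have "\<dots> \<le> (2 * d * d + d + 1) * card \<Omega> + d * card \<Omega>"
    using card_loop_configs[OF i] by simp
  finally show ?thesis by (simp add: algebra_simps)
qed

text \<open>Each edge is bad with probability at most \<open>(2 * d * d + 3 * d + 1) / m\<close>,
  the sum of the loop and the parallel bound. The expected number of bad edges is therefore bounded
  independently of \<open>m\<close>.\<close>

lemma sum_card_bad_edges:
  assumes "m > 0"
  shows "(\<Sum>xs\<in>\<Omega>. card (bad_edges xs)) \<le> (2 * d * d + 3 * d + 1) * card \<Omega>"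
proof -
  have bad: "card {xs \<in> \<Omega>. i \<in> bad_edges xs} * m \<le> (2 * d * d + 3 * d + 1) * card \<Omega>" if i: "i < m" for i
  proof -
    have "{xs \<in> \<Omega>. i \<in> bad_edges xs} \<subseteq> {xs \<in> \<Omega>. is_loop xs i} \<union> {xs \<in> \<Omega>. is_parallel xs i}"
      by (auto simp: bad_edges_def)
    then have "card {xs \<in> \<Omega>. i \<in> bad_edges xs} \<le> card ({xs \<in> \<Omega>. is_loop xs i} \<union> {xs \<in> \<Omega>. is_parallel xs i})"
      by (rule card_mono[rotated]) simp
    also have "\<dots> \<le> card {xs \<in> \<Omega>. is_loop xs i} + card {xs \<in> \<Omega>. is_parallel xs i}" by (rule card_Un_le)
    finally have "card {xs \<in> \<Omega>. i \<in> bad_edges xs} * m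
        \<le> (card {xs \<in> \<Omega>. is_loop xs i} + card {xs \<in> \<Omega>. is_parallel xs i}) * m"
      by (rule mult_le_mono1)
    then show ?thesis using card_loop_configs[OF i] card_parallel_configs[OF i] by (simp add: algebra_simps)
  qed
  have "card (bad_edges xs) = (\<Sum>i<m. of_bool (i \<in> bad_edges xs))" if "xs \<in> \<Omega>" for xs
  proof -
    have "bad_edges xs = {..<m} \<inter> {i. i \<in> bad_edges xs}"
      using length_\<Omega>[OF that] by (auto simp: bad_edges_def)
    then have "card (bad_edges xs) = card ({..<m} \<inter> {i. i \<in> bad_edges xs})" by (rule arg_cong)
    then show ?thesis by (simp only: sum_of_bool_eq finite_lessThan of_nat_id)
  qed
  then have "(\<Sum>xs\<in>\<Omega>. card (bad_edges xs)) = (\<Sum>i<m. \<Sum>xs\<in>\<Omega>. of_bool (i \<in> bad_edges xs))"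
    by (subst sum.swap) simp
  also have "\<dots> = (\<Sum>i<m. card {xs \<in> \<Omega>. i \<in> bad_edges xs})" by (simp add: Int_def)
  finally have eq: "(\<Sum>xs\<in>\<Omega>. card (bad_edges xs)) = (\<Sum>i<m. card {xs \<in> \<Omega>. i \<in> bad_edges xs})" .
  have "(\<Sum>xs\<in>\<Omega>. card (bad_edges xs)) * m \<le> (2 * d * d + 3 * d + 1) * card \<Omega> * m"
    unfolding eq sum_distrib_right
    using sum_bounded_above[of "{..<m}" "\<lambda>i. card {xs \<in> \<Omega>. i \<in> bad_edges xs} * m" "(2 * d * d + 3 * d + 1) * card \<Omega>"] bad
    by (simp add: mult.commute)
  then show ?thesis using assms by simp
qed

text \<open>Markov's inequality at twice the bound on the mean.\<close>

lemma card_few_bad_edges: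
  assumes "m > 0"
  shows "card \<Omega> \<le> 2 * card {xs \<in> \<Omega>. card (bad_edges xs) \<le> 2 * (2 * d * d + 3 * d + 1)}"
proof -
  define C where "C = 2 * d * d + 3 * d + 1"
  let ?M = "{xs \<in> \<Omega>. card (bad_edges xs) \<le> 2 * C}" and ?L = "{xs \<in> \<Omega>. 2 * C < card (bad_edges xs)}"
  have "2 * C * card ?L = (\<Sum>xs\<in>?L. 2 * C)" by simp
  also have "\<dots> \<le> (\<Sum>xs\<in>?L. card (bad_edges xs))" by (rule sum_mono) auto
  also have "\<dots> \<le> (\<Sum>xs\<in>\<Omega>. card (bad_edges xs))" by (rule sum_mono2) auto
  also have "\<dots> \<le> C * card \<Omega>" using sum_card_bad_edges[OF assms] by (simp add: C_def)
  finally have "C * (2 * card ?L) \<le> C * card \<Omega>" by (simp add: mult_ac)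
  moreover have "C > 0" by (simp add: C_def)
  ultimately have L: "2 * card ?L \<le> card \<Omega>" by simp
  have "card (?M \<union> ?L) = card ?M + card ?L" by (rule card_Un_disjoint) auto
  moreover have "?M \<union> ?L = \<Omega>" by auto
  ultimately have "card \<Omega> = card ?M + card ?L" by simp
  then show ?thesis using L unfolding C_def by linarith
qed

text \<open>Choose \<open>j\<close> not bad with both ends outside \<open>Z\<close>, the ends of
  \<open>i\<close> and their partners. As \<open>Z\<close> has at most \<open>2 + 4 * d\<close>
  elements, each the first end and the second end of at most \<open>d\<close> edges, fewer than
  \<open>m\<close> indices are excluded. The two new edges are then not loops, were not present
  before, and differ from each other.\<close>

lemma repair_bad_edge:
  assumes xs: "xs \<in> \<Omega>" and i: "i \<in> bad_edges xs"
    and large: "card (bad_edges xs) + 2 * (d * (4 * d + 2)) < m"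
  shows "\<exists>j<m. bad_edges (swap_ends i j xs) \<subseteq> bad_edges xs - {i}"
proof -
  note len = length_\<Omega>[OF xs]
  have im: "i < m" using i len by (simp add: bad_edges_def)
  define u where "u = xs ! (2 * i)"
  define w where "w = xs ! (2 * i + 1)"
  define Z where "Z = {u, w} \<union> (partners xs u \<union> partners xs w)"
  have Z: "finite Z" using card_partners_le(1)[OF xs] by (simp add: Z_def)
  have "card Z \<le> card {u, w} + card (partners xs u \<union> partners xs w)"
    unfolding Z_def by (rule card_Un_le)
  also have "\<dots> \<le> card {u, w} + (card (partners xs u) + card (partners xs w))"
    by (rule add_left_mono[OF card_Un_le])
  also have "\<dots> \<le> 2 + (2 * d + 2 * d)"
    by (intro add_mono card_partners_le(2)[OF xs]) (simp add: card_insert_if)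
  finally have cZ: "card Z \<le> 4 * d + 2" by simp
  define F where "F = bad_edges xs \<union> ({k. k < m \<and> xs ! (2 * k) \<in> Z} \<union> {k. k < m \<and> xs ! (2 * k + 1) \<in> Z})"
  have "card F \<le> card (bad_edges xs) + card ({k. k < m \<and> xs ! (2 * k) \<in> Z} \<union> {k. k < m \<and> xs ! (2 * k + 1) \<in> Z})"
    unfolding F_def by (rule card_Un_le)
  also have "\<dots> \<le> card (bad_edges xs) + (card {k. k < m \<and> xs ! (2 * k) \<in> Z} + card {k. k < m \<and> xs ! (2 * k + 1) \<in> Z})"
    by (rule add_left_mono[OF card_Un_le])
  also have "\<dots> \<le> card (bad_edges xs) + (d * (4 * d + 2) + d * (4 * d + 2))"
    by (intro add_left_mono add_mono order_trans[OF _ mult_le_mono2[OF cZ]] card_ends_in_le[OF xs Z])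
  finally have "card F < card {..<m}" using large by simp
  moreover have "finite F" by (simp add: F_def)
  ultimately have "\<not> {..<m} \<subseteq> F" using card_mono[of F "{..<m}"] by linarith
  then obtain j where j: "j < m" "j \<notin> F" by blast
  define y where "y = xs ! (2 * j)"
  define z where "z = xs ! (2 * j + 1)"
  have yz: "y \<notin> Z" "z \<notin> Z" and jb: "j \<notin> bad_edges xs" using j by (auto simp: F_def y_def z_def)
  have ij: "i \<noteq> j" using i jb by auto
  have "y \<noteq> z" using jb j(1) len by (auto simp: bad_edges_def is_loop_def y_def z_def)
  define xs' where "xs' = swap_ends i j xs"
  note nth = nth_swap_ends[OF len im j(1), folded xs'_def]
  have len': "length xs' div 2 = m" "length xs div 2 = m" using len by (simp_all add: xs'_def)
  define e where "e k = {xs ! (2 * k), xs ! (2 * k + 1)}" for k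
  define e' where "e' k = {xs' ! (2 * k), xs' ! (2 * k + 1)}" for k
  have ends: "xs' ! (2 * i) = u" "xs' ! (2 * i + 1) = z" "xs' ! (2 * j) = y" "xs' ! (2 * j + 1) = w"
    using nth[OF im] nth[OF j(1)] ij by (auto simp: u_def w_def y_def z_def)
  then have e': "e' i = {u, z}" "e' j = {y, w}" unfolding e'_def by simp_all
  have other: "xs' ! (2 * k) = xs ! (2 * k)" "xs' ! (2 * k + 1) = xs ! (2 * k + 1)"
    if "k < m" "k \<noteq> i" "k \<noteq> j" for k
    using nth[OF that(1)] that by auto
  have e'k: "e' k = e k" if "k < m" "k \<noteq> i" "k \<noteq> j" for k
    unfolding e'_def e_def other[OF that] ..
  have par: "is_parallel xs k \<longleftrightarrow> (\<exists>l<m. l \<noteq> k \<and> e l = e k)"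
    and par': "is_parallel xs' k \<longleftrightarrow> (\<exists>l<m. l \<noteq> k \<and> e' l = e' k)" for k
    unfolding is_parallel_def len' e_def e'_def by (rule refl)+
  have new1: "e k \<noteq> {u, z}" if "k < m" for k
  proof
    assume "e k = {u, z}"
    then have "z \<in> partners xs u" unfolding partners_def len' e_def using that by blast
    then show False using yz(2) by (simp add: Z_def)
  qed
  have new2: "e k \<noteq> {y, w}" if "k < m" for k
  proof
    assume "e k = {y, w}"
    then have "{w, y} = e k" by (simp only: insert_commute)
    then have "y \<in> partners xs w" unfolding partners_def len' e_def using that by blast
    then show False using yz(1) by (simp add: Z_def)
  qed
  \<comment> \<open>Equality would need \<open>u = y\<close>, impossible since \<open>u\<close> is
    in \<open>Z\<close>, or \<open>y = z\<close>, impossible since \<open>j\<close> is not a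
    loop.\<close>
  have uzyw: "{u, z} \<noteq> {y, w}" using yz \<open>y \<noteq> z\<close> by (auto simp: Z_def doubleton_eq_iff)
  have "\<not> is_loop xs' i" using yz(2) unfolding is_loop_def ends by (auto simp: Z_def)
  moreover have "\<not> is_parallel xs' i"
  proof
    assume "is_parallel xs' i"
    then obtain l where l: "l < m" "l \<noteq> i" "e' l = {u, z}" unfolding par' e' by blast
    show False
    proof (cases "l = j")
      case True
      then show False using l(3) uzyw unfolding e'(2)[folded True] by simp
    next
      case False
      then show False using l e'k[OF l(1,2) False] new1[OF l(1)] by simp
    qed
  qed
  ultimately have "i \<notin> bad_edges xs'" by (simp add: bad_edges_def)
  moreover have "\<not> is_loop xs' j" using yz(1) unfolding is_loop_def ends by (auto simp: Z_def)
  moreover have "\<not> is_parallel xs' j"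
  proof
    assume "is_parallel xs' j"
    then obtain l where l: "l < m" "l \<noteq> j" "e' l = {y, w}" unfolding par' e' by blast
    show False
    proof (cases "l = i")
      case True
      then show False using l(3) uzyw unfolding e'(1)[folded True] by simp
    next
      case False
      then show False using l e'k[OF l(1) False l(2)] new2[OF l(1)] by simp
    qed
  qed
  ultimately have ij': "i \<notin> bad_edges xs'" "j \<notin> bad_edges xs'" by (simp_all add: bad_edges_def)
  \<comment> \<open>No damage elsewhere: an untouched edge keeps its ends, and it cannot coincide
    with a new edge because neither new edge occurred in \<open>xs\<close>.\<close>
  moreover have "k \<in> bad_edges xs" if k: "k \<in> bad_edges xs'" "k \<noteq> i" "k \<noteq> j" for k
  proof -
    have km: "k < m" using k(1) len' by (simp add: bad_edges_def)
    have "is_parallel xs k" if p: "is_parallel xs' k"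
    proof -
      obtain l where l: "l < m" "l \<noteq> k" "e' l = e k"
        using p unfolding par' e'k[OF km k(2,3)] by blast
      have "l \<noteq> i" using l(3) new1[OF km] e'(1) by auto
      moreover have "l \<noteq> j" using l(3) new2[OF km] e'(2) by auto
      ultimately have "e l = e k" using l(3) e'k[OF l(1)] by simp
      then show ?thesis unfolding par using l(1,2) by blast
    qed
    moreover have "is_loop xs' k \<longleftrightarrow> is_loop xs k"
      unfolding is_loop_def other[OF km k(2,3)] ..
    ultimately show ?thesis using k(1) km len' by (auto simp: bad_edges_def)
  qed
  ultimately have "bad_edges xs' \<subseteq> bad_edges xs - {i}" by blast
  then show ?thesis using j(1) by (auto simp: xs'_def)
qed

text \<open>A swap is its own inverse, so a configuration with \<open>Suc k\<close> bad edges is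
  recovered from its repaired version and the pair \<open>(i, j)\<close>. Each repair thus costs a
  factor of at most \<open>m * m\<close>.\<close>

lemma card_configs_le_simple:
  assumes "K + 2 * (d * (4 * d + 2)) < m" "k \<le> K"
  shows "card {xs \<in> \<Omega>. card (bad_edges xs) \<le> k} \<le> (m * m) ^ k * card {xs \<in> \<Omega>. simple_config xs}"
  using assms(2)
proof (induction k)
  case 0
  have "{xs \<in> \<Omega>. card (bad_edges xs) \<le> 0} = {xs \<in> \<Omega>. simple_config xs}"
    by (auto simp: simple_config_iff_bad_edges)
  then show ?case by simp
next
  case (Suc k)
  let ?A = "{xs \<in> \<Omega>. card (bad_edges xs) \<le> k}"
  have m: "m > 0" using assms(1) by simp
  have "{xs \<in> \<Omega>. card (bad_edges xs) \<le> Suc k} \<subseteq> (\<Union>p\<in>{..<m} \<times> {..<m}. swap_ends (fst p) (snd p) ` ?A)"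
  proof
    fix xs assume "xs \<in> {xs \<in> \<Omega>. card (bad_edges xs) \<le> Suc k}"
    then have xs: "xs \<in> \<Omega>" "card (bad_edges xs) \<le> Suc k" by auto
    show "xs \<in> (\<Union>p\<in>{..<m} \<times> {..<m}. swap_ends (fst p) (snd p) ` ?A)"
    proof (cases "bad_edges xs = {}")
      case True
      \<comment> \<open>Nothing to repair: the trivial swap keeps \<open>xs\<close> within the same
        union.\<close>
      then have "xs \<in> swap_ends (fst (0, 0)) (snd (0, 0)) ` ?A"
        using xs by (intro image_eqI[of _ _ xs]) (auto simp: swap_ends_def)
      then show ?thesis using m by blast
    next
      case False
      then obtain i where i: "i \<in> bad_edges xs" by auto
      have im: "i < m" using i length_\<Omega>[OF xs(1)] by (simp add: bad_edges_def)
      obtain j where j: "j < m" "bad_edges (swap_ends i j xs) \<subseteq> bad_edges xs - {i}"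
        using repair_bad_edge[OF xs(1) i] xs(2) Suc.prems assms(1) by auto
      have "card (bad_edges (swap_ends i j xs)) \<le> card (bad_edges xs - {i})"
        by (rule card_mono[OF _ j(2)]) simp
      also have "\<dots> \<le> k" using i xs(2) by simp
      finally have "swap_ends i j xs \<in> ?A" using swap_ends_in[OF xs(1) im j(1)] by simp
      moreover have "xs = swap_ends (fst (i, j)) (snd (i, j)) (swap_ends i j xs)"
        using swap_ends_involution[OF length_\<Omega>[OF xs(1)] im j(1)] by simp
      ultimately show ?thesis using im j(1) by blast
    qed
  qed
  then have "card {xs \<in> \<Omega>. card (bad_edges xs) \<le> Suc k}
      \<le> card (\<Union>p\<in>{..<m} \<times> {..<m}. swap_ends (fst p) (snd p) ` ?A)"
    by (rule card_mono[rotated]) auto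
  also have "\<dots> \<le> (\<Sum>p\<in>{..<m} \<times> {..<m}. card (swap_ends (fst p) (snd p) ` ?A))"
    by (rule card_UN_le) simp
  also have "\<dots> \<le> (\<Sum>p\<in>{..<m} \<times> {..<m}. card ?A)"
    by (rule sum_mono) (rule card_image_le, simp)
  also have "\<dots> = m * m * card ?A" by simp
  also have "\<dots> \<le> m * m * ((m * m) ^ k * card {xs \<in> \<Omega>. simple_config xs})"
    using Suc by (intro mult_le_mono2) simp
  finally show ?case by (simp add: mult_ac)
qed

lemma card_configs_le:
  assumes "2 * (2 * d * d + 3 * d + 1) + 2 * (d * (4 * d + 2)) < m"
  shows "card \<Omega> \<le> 2 * (m * m) ^ (2 * (2 * d * d + 3 * d + 1)) * card {xs \<in> \<Omega>. simple_config xs}"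
proof -
  have "m > 0" using assms by simp
  from card_few_bad_edges[OF this] show ?thesis
    using mult_le_mono2[OF card_configs_le_simple[OF assms order_refl], of 2] by (simp only: mult.assoc)
qed

end

section \<open>Counting configurations by colour patterns\<close>


lemma prod_degree_mset:
  "finite V \<Longrightarrow> (\<Prod>v\<in>#degree_mset d V. g v) = (\<Prod>v\<in>V. g v ^ d :: 'b :: comm_monoid_mult)"
  unfolding degree_mset_def by (induction V rule: finite_induct) auto

lemma filter_degree_mset:
  "finite V \<Longrightarrow> filter_mset P (degree_mset d V) = degree_mset d {v \<in> V. P v}"
  by (rule multiset_eqI) (simp add: count_degree_mset)

lemma set_degree_mset: "finite V \<Longrightarrow> set_mset (degree_mset d V) \<subseteq> V"
  by (auto simp: count_degree_mset simp flip: count_greater_zero_iff split: if_splits)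

text \<open>Both the weight and the condition on the pairs are local to each of the \<open>m\<close>
  pairs, so the sum is a power.\<close>

lemma sum_weights_edge_list:
  fixes w :: "'c \<Rightarrow> real"
  shows "(\<Sum>xs | length xs = 2 * m \<and> set xs \<subseteq> C \<and> e \<notin> set (edge_list xs). prod_list (map w xs))
     = (\<Sum>p\<in>{p \<in> C \<times> C. {fst p, snd p} \<noteq> e}. w (fst p) * w (snd p)) ^ m"
proof (induction m)
  case 0
  have "{xs :: 'c list. length xs = 2 * 0 \<and> set xs \<subseteq> C \<and> e \<notin> set (edge_list xs)} = {[]}" by auto
  then show ?case by simp
next
  case (Suc m)
  define A where "A m = {xs. length xs = 2 * m \<and> set xs \<subseteq> C \<and> e \<notin> set (edge_list xs)}" for m
  let ?B = "{p \<in> C \<times> C. {fst p, snd p} \<noteq> e}"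
  let ?g = "\<lambda>(p, xs). fst p # snd p # xs :: 'c list"
  have "A (Suc m) = ?g ` (?B \<times> A m)"
  proof (intro equalityI subsetI)
    fix xs assume xs: "xs \<in> A (Suc m)"
    then obtain a b ys where ys: "xs = a # b # ys" "length ys = 2 * m"
      using length_Suc_Suc_cases[of xs m] unfolding A_def by blast
    have "xs = ?g ((a, b), ys)" using ys by simp
    moreover have "((a, b), ys) \<in> ?B \<times> A m" using xs ys unfolding A_def by auto
    ultimately show "xs \<in> ?g ` (?B \<times> A m)" by (rule image_eqI)
  next
    fix xs assume "xs \<in> ?g ` (?B \<times> A m)"
    then obtain p ys where "p \<in> ?B" "ys \<in> A m" "xs = fst p # snd p # ys" by auto
    then show "xs \<in> A (Suc m)" unfolding A_def by auto
  qed
  moreover have "inj_on ?g (?B \<times> A m)" by (rule inj_onI) (auto simp: prod_eq_iff)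
  ultimately have "(\<Sum>xs\<in>A (Suc m). prod_list (map w xs))
     = (\<Sum>(p, xs)\<in>?B \<times> A m. (w (fst p) * w (snd p)) * prod_list (map w xs))"
    by (simp add: sum.reindex case_prod_unfold mult.assoc)
  also have "\<dots> = (\<Sum>p\<in>?B. w (fst p) * w (snd p)) * (\<Sum>xs\<in>A m. prod_list (map w xs))"
    by (simp only: sum_product sum.cartesian_product)
  finally show ?case using Suc by (simp add: A_def)
qed

text \<open>A generating function bound: all arrangements of \<open>\<mu>\<close> have the same
  weight, and they form only part of the words over which \<open>sum_weights_edge_list\<close> sums.
  The weights \<open>w\<close> stay free, to be optimized later.\<close>

lemma card_patterns_le:
  fixes w :: "'c \<Rightarrow> real"
  assumes C: "finite C" "set_mset \<mu> \<subseteq> C" "size \<mu> = 2 * m" and w: "\<And>c. w c \<ge> 0"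
  shows "card {xs \<in> permutations_of_multiset \<mu>. e \<notin> set (edge_list xs)} * (\<Prod>c\<in>#\<mu>. w c)
      \<le> (\<Sum>p\<in>{p \<in> C \<times> C. {fst p, snd p} \<noteq> e}. w (fst p) * w (snd p)) ^ m"
proof -
  let ?P = "{xs \<in> permutations_of_multiset \<mu>. e \<notin> set (edge_list xs)}"
  let ?A = "{xs. length xs = 2 * m \<and> set xs \<subseteq> C \<and> e \<notin> set (edge_list xs)}"
  have "prod_list (map w xs) = (\<Prod>c\<in>#\<mu>. w c)" if "xs \<in> ?P" for xs
  proof -
    have "mset xs = \<mu>" using that by (simp add: permutations_of_multiset_def)
    then show ?thesis by (metis mset_map prod_mset_prod_list)
  qed
  then have "card ?P * (\<Prod>c\<in>#\<mu>. w c) = (\<Sum>xs\<in>?P. prod_list (map w xs))" by simp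
  also have "\<dots> \<le> (\<Sum>xs\<in>?A. prod_list (map w xs))"
  proof (rule sum_mono2)
    have "?A \<subseteq> {xs. set xs \<subseteq> C \<and> length xs = 2 * m}" by auto
    then show "finite ?A" using finite_lists_length_eq[OF C(1)] by (rule finite_subset)
    show "?P \<subseteq> ?A"
    proof
      fix xs assume "xs \<in> ?P"
      then have "mset xs = \<mu>" "e \<notin> set (edge_list xs)" by (simp_all add: permutations_of_multiset_def)
      then show "xs \<in> ?A" using C(2,3) by (auto simp flip: set_mset_mset size_mset)
    qed
    show "0 \<le> prod_list (map w xs)" for xs using w by (induction xs) auto
  qed
  finally show ?thesis by (simp only: sum_weights_edge_list)
qed

text \<open>A list is a shuffle of its colour classes: the colours tell from which subsequence the
  next entry is taken.\<close>

lemma map_filter_inject: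
  assumes "map f xs = map f ys" "\<And>c. filter (\<lambda>x. f x = c) xs = filter (\<lambda>x. f x = c) ys"
  shows "xs = ys"
  using assms
proof (induction xs arbitrary: ys)
  case (Cons x xs)
  then obtain y ys' where ys: "ys = y # ys'" "f x = f y" "map f xs = map f ys'" by auto
  have "x # filter (\<lambda>z. f z = f x) xs = y # filter (\<lambda>z. f z = f x) ys'"
    using Cons.prems(2)[of "f x"] ys by simp
  moreover from this have "filter (\<lambda>z. f z = c) xs = filter (\<lambda>z. f z = c) ys'" for c
    using Cons.prems(2)[of c] ys by (cases "c = f x") auto
  ultimately show ?case using Cons.IH[OF ys(3)] ys(1) by simp
qed simp

lemma card_configs_pattern_le:
  assumes V: "finite V" and C: "finite C" "f ` V \<subseteq> C"
  shows "card {xs \<in> configs d V. map f xs = \<pi>} \<le> (\<Prod>c\<in>C. card (configs d {v \<in> V. f v = c}))"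
proof -
  let ?F = "{xs \<in> configs d V. map f xs = \<pi>}"
  let ?g = "\<lambda>xs. \<lambda>c\<in>C. filter (\<lambda>x. f x = c) xs"
  have "inj_on ?g ?F"
  proof (rule inj_onI)
    fix xs ys assume xs: "xs \<in> ?F" and ys: "ys \<in> ?F" and eq: "?g xs = ?g ys"
    have sub: "set zs \<subseteq> V" if "zs \<in> ?F" for zs
    proof -
      have "mset zs = degree_mset d V" using that by (simp add: configs_iff)
      then have "set zs = set_mset (degree_mset d V)" by (metis set_mset_mset)
      then show ?thesis using set_degree_mset[OF V] by simp
    qed
    show "xs = ys"
    proof (rule map_filter_inject)
      show "map f xs = map f ys" using xs ys by simp
      fix c
      show "filter (\<lambda>x. f x = c) xs = filter (\<lambda>x. f x = c) ys"
      proof (cases "c \<in> C")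
        case True
        then show ?thesis using fun_cong[OF eq, of c] by simp
      next
        case False
        then have "f x \<noteq> c" if "x \<in> V" for x using C(2) that by blast
        then have "filter (\<lambda>x. f x = c) xs = []" "filter (\<lambda>x. f x = c) ys = []"
          using sub[OF xs] sub[OF ys] by (auto simp: filter_empty_conv)
        then show ?thesis by simp
      qed
    qed
  qed
  moreover have "?g ` ?F \<subseteq> (\<Pi>\<^sub>E c\<in>C. configs d {v \<in> V. f v = c})"
    by (auto simp: configs_iff filter_degree_mset V)
  moreover have "finite (\<Pi>\<^sub>E c\<in>C. configs d {v \<in> V. f v = c})"
    using C(1) by (intro finite_PiE) auto
  ultimately have "card ?F \<le> card (\<Pi>\<^sub>E c\<in>C. configs d {v \<in> V. f v = c})"
    by (rule card_inj_on_le)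
  then show ?thesis by (simp add: card_PiE[OF C(1)])
qed

text \<open>A configuration is a colour pattern together with a configuration on each colour class.
  The patterns are bounded by their weights and the classes are counted by
  \<open>card_configs\<close>; the powers of \<open>fact d\<close> cancel between the classes and
  \<open>V\<close>. Everything is multiplied out, so that weights may be zero.\<close>

lemma card_configs_avoiding_le:
  fixes w :: "'c \<Rightarrow> real"
  assumes V: "finite V" and C: "finite C" "f ` V \<subseteq> C" and m: "d * card V = 2 * m" and w: "\<And>c. w c \<ge> 0"
  shows "card {xs \<in> configs d V. e \<notin> set (edge_list (map f xs))} * (\<Prod>c\<in>C. w c ^ (d * card {v \<in> V. f v = c})) * fact (d * card V)
     \<le> (\<Sum>p\<in>{p \<in> C \<times> C. {fst p, snd p} \<noteq> e}. w (fst p) * w (snd p)) ^ m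
        * (\<Prod>c\<in>C. fact (d * card {v \<in> V. f v = c})) * card (configs d V)"
proof -
  define nc where "nc c = card {v \<in> V. f v = c}" for c
  define \<mu> where "\<mu> = image_mset f (degree_mset d V)"
  define W where "W = (\<Prod>c\<in>C. w c ^ (d * nc c))"
  define Q where "Q = (\<Sum>p\<in>{p \<in> C \<times> C. {fst p, snd p} \<noteq> e}. w (fst p) * w (snd p))"
  define A where "A = {xs \<in> configs d V. e \<notin> set (edge_list (map f xs))}"
  define Pats where "Pats = {\<pi> \<in> permutations_of_multiset \<mu>. e \<notin> set (edge_list \<pi>)}"
  have "(\<Prod>c\<in>#\<mu>. w c) = (\<Prod>v\<in>V. w (f v) ^ d)"
    using prod_degree_mset[OF V, of "\<lambda>v. w (f v)" d] by (simp add: \<mu>_def image_mset.compositionality o_def)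
  also have "\<dots> = (\<Prod>c\<in>C. \<Prod>v\<in>{v \<in> V. f v = c}. w (f v) ^ d)"
    by (rule prod.group[OF V C, symmetric])
  also have "\<dots> = W"
    unfolding W_def nc_def by (rule prod.cong[OF refl]) (simp add: power_mult)
  finally have Wmu: "(\<Prod>c\<in>#\<mu>. w c) = W" .
  have W0: "W \<ge> 0" unfolding W_def using w by (intro prod_nonneg) auto
  have "set_mset \<mu> \<subseteq> C" using set_degree_mset[OF V, of d] C(2) by (auto simp: \<mu>_def)
  moreover have "size \<mu> = 2 * m" using m by (simp add: \<mu>_def size_degree_mset)
  ultimately have patterns: "card Pats * W \<le> Q ^ m"
    unfolding Pats_def Q_def Wmu[symmetric] by (rule card_patterns_le[OF C(1) _ _ w])
  have finP: "finite Pats" by (simp add: Pats_def)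
  have "A \<subseteq> (\<Union>\<pi>\<in>Pats. {xs \<in> configs d V. map f xs = \<pi>})"
    by (auto simp: A_def Pats_def \<mu>_def permutations_of_multiset_def configs_iff)
  then have "card A \<le> card (\<Union>\<pi>\<in>Pats. {xs \<in> configs d V. map f xs = \<pi>})"
    by (rule card_mono[rotated]) (simp add: finP)
  also have "\<dots> \<le> (\<Sum>\<pi>\<in>Pats. card {xs \<in> configs d V. map f xs = \<pi>})"
    by (rule card_UN_le[OF finP])
  also have "\<dots> \<le> (\<Sum>\<pi>\<in>Pats. \<Prod>c\<in>C. card (configs d {v \<in> V. f v = c}))"
    by (rule sum_mono) (rule card_configs_pattern_le[OF V C])
  finally have A: "card A \<le> card Pats * (\<Prod>c\<in>C. card (configs d {v \<in> V. f v = c}))" by simp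
  have "(\<Sum>c\<in>C. nc c) = card V"
    using sum.group[OF V C, of "\<lambda>_. 1 :: nat"] by (simp add: nc_def)
  then have fd: "(fact d ^ card V :: nat) = (\<Prod>c\<in>C. fact d ^ nc c)"
    by (simp add: power_sum[symmetric])
  have "card A * fact d ^ card V \<le> card Pats * ((\<Prod>c\<in>C. card (configs d {v \<in> V. f v = c})) * fact d ^ card V)"
    using mult_le_mono1[OF A] by (simp only: mult.assoc)
  also have "(\<Prod>c\<in>C. card (configs d {v \<in> V. f v = c})) * fact d ^ card V = (\<Prod>c\<in>C. fact (d * nc c))"
    unfolding fd prod.distrib[symmetric] nc_def using card_configs[of "{v \<in> V. f v = _}" d] V by simp
  finally have A2: "card A * fact d ^ card V \<le> card Pats * (\<Prod>c\<in>C. fact (d * nc c))" .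
  define FC where "FC = (\<Prod>c\<in>C. fact (d * nc c) :: real)"
  have FC: "FC \<ge> 0" unfolding FC_def by (intro prod_nonneg) auto
  have "real (card A * fact d ^ card V) \<le> real (card Pats * (\<Prod>c\<in>C. fact (d * nc c)))"
    using A2 by (rule of_nat_mono)
  then have A3: "real (card A) * fact d ^ card V \<le> real (card Pats) * FC" by (simp add: FC_def)
  have conf: "fact (d * card V) = real (card (configs d V)) * fact d ^ card V"
    using arg_cong[OF card_configs[OF V, of d], of real] by simp
  have "card A * W * fact (d * card V) = (card A * fact d ^ card V) * (W * card (configs d V))"
    unfolding conf by simp
  also have "\<dots> \<le> (card Pats * FC) * (W * card (configs d V))"
    using A3 W0 by (intro mult_right_mono) auto
  also have "\<dots> = (card Pats * W) * (FC * card (configs d V))"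
    by (simp only: mult_ac)
  also have "\<dots> \<le> Q ^ m * (FC * card (configs d V))"
    using patterns FC by (intro mult_right_mono mult_nonneg_nonneg) auto
  finally show ?thesis unfolding A_def W_def Q_def FC_def nc_def by (simp only: mult.assoc)
qed

text \<open>One half of an elementary Stirling estimate; the inductive step is
  \<open>(1 + 1 / k) ^ k \<le> exp 1\<close>.\<close>

lemma self_power_le_fact_exp: "real k ^ k \<le> fact k * exp (real k)"
proof (induction k)
  case (Suc k)
  have step: "real (Suc k) ^ k \<le> exp 1 * real k ^ k"
  proof (cases "k = 0")
    case False
    then have eq: "real (Suc k) = real k * (1 + 1 / real k)" by (simp add: field_simps)
    have "(1 + 1 / real k) ^ k \<le> exp (1 / real k) ^ k"
      by (rule power_mono) (auto simp: exp_ge_add_one_self)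
    moreover have "exp (1 / real k) ^ k = exp 1" using False by (simp flip: exp_of_nat_mult)
    ultimately have "real k ^ k * (1 + 1 / real k) ^ k \<le> real k ^ k * exp 1" by (simp add: mult_left_mono)
    then show ?thesis unfolding eq power_mult_distrib by (simp only: mult.commute)
  qed simp
  have "real (Suc k) ^ Suc k \<le> real (Suc k) * (exp 1 * real k ^ k)"
    using step by (simp add: mult_left_mono)
  also have "\<dots> \<le> real (Suc k) * (exp 1 * (fact k * exp (real k)))"
    using Suc by (intro mult_left_mono) auto
  finally show ?case by (simp add: exp_add[symmetric] mult_ac)
qed simp

text \<open>The other half, from \<open>(1 - 1 / Suc k) ^ Suc k \<le> exp (- 1)\<close>. Any
  polynomial factor would do here.\<close>

lemma fact_exp_le_self_power: "fact k * exp (real k) \<le> exp 1 * (real k + 1) * real k ^ k"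
proof -
  \<comment> \<open>With the factor \<open>k\<close> in place of \<open>k + 1\<close> the induction
    closes, but it has to start at 1 since the claim fails at 0.\<close>
  have pos: "fact k * exp (real k) \<le> exp 1 * real k * real k ^ k" if "k \<ge> 1"
    using that
  proof (induction k rule: nat_induct_at_least)
    case (Suc k)
    have "(1 - 1 / real (Suc k)) ^ Suc k \<le> exp (- (1 / real (Suc k))) ^ Suc k"
      using exp_ge_add_one_self[of "- (1 / real (Suc k))"] by (intro power_mono) auto
    also have "\<dots> = exp (- 1)" by (subst exp_of_nat_mult[symmetric]) simp
    also have "1 - 1 / real (Suc k) = real k / real (Suc k)" by (simp add: field_simps)
    finally have le: "(real k / real (Suc k)) ^ Suc k \<le> exp (- 1)" .
    have "exp 1 * real k ^ Suc k = (exp 1 * (real k / real (Suc k)) ^ Suc k) * real (Suc k) ^ Suc k"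
      unfolding power_divide by simp
    also have "\<dots> \<le> (exp 1 * exp (- 1)) * real (Suc k) ^ Suc k"
      using le by (intro mult_right_mono mult_left_mono) auto
    also have "exp 1 * exp (- 1) = (1 :: real)" by (simp flip: exp_add)
    finally have step: "exp 1 * real k ^ Suc k \<le> real (Suc k) ^ Suc k" by simp
    have "fact (Suc k) * exp (real (Suc k)) = real (Suc k) * exp 1 * (fact k * exp (real k))"
      by (simp add: exp_add)
    also have "\<dots> \<le> real (Suc k) * exp 1 * (exp 1 * real k * real k ^ k)"
      using Suc.IH by (intro mult_left_mono) auto
    also have "\<dots> = exp 1 * real (Suc k) * (exp 1 * real k ^ Suc k)" by simp
    also have "\<dots> \<le> exp 1 * real (Suc k) * real (Suc k) ^ Suc k"
      using step by (intro mult_left_mono) auto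
    finally show ?case .
  qed simp
  have le: "exp 1 * real k * real k ^ k \<le> exp 1 * (real k + 1) * real k ^ k"
    by (intro mult_right_mono) auto
  show ?thesis
  proof (cases "k = 0")
    case False
    then have "k \<ge> 1" by simp
    from order_trans[OF pos[OF this] le] show ?thesis .
  qed simp
qed

section \<open>The first moment bound\<close>


lemma edge_list_doubleton: "e \<in> set (edge_list xs) \<Longrightarrow> \<exists>a b. e = {a, b}"
  by (induction xs rule: edge_list.induct) auto

text \<open>Colour \<open>S\<close>, \<open>T\<close> and the rest by 0, 1 and 2 and forbid the pair
  \<open>{0, 1}\<close>. With the colour proportions as weights, the power of each weight cancels
  the leading Stirling term of its class; a factor \<open>exp 1 * (N + 1)\<close> per colour
  remains. \<open>Q\<close> is the probability that two independent random colours are not 0 and 1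
  in some order.\<close>

lemma card_separated_configs_le:
  fixes V :: "'a set"
  assumes V: "finite V" "V \<noteq> {}" and m: "d * card V = 2 * m" and ST: "S \<subseteq> V" "T \<subseteq> V" "S \<inter> T = {}"
    and card: "card S = s" "card T = s"
  shows "card {xs \<in> configs d V. separated (set (edge_list xs)) S T}
    \<le> (1 - 2 * (s / card V)\<^sup>2) ^ m * (exp 1 * (d * card V + 1)) ^ 3 * card (configs d V)"
proof -
  define f :: "'a \<Rightarrow> nat" where "f v = (if v \<in> S then 0 else if v \<in> T then 1 else 2)" for v
  define C :: "nat set" where "C = {0, 1, 2}"
  define n where "n = card V"
  define N where "N = d * n"
  define k where "k c = card {v \<in> V. f v = c}" for c
  define w where "w c = real (k c) / real n" for c
  define Q where "Q = (\<Sum>p\<in>{p \<in> C \<times> C. {fst p, snd p} \<noteq> {0, 1}}. w (fst p) * w (snd p))"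
  define W where "W = (\<Prod>c\<in>C. w c ^ (d * k c))"
  define FC where "FC = (\<Prod>c\<in>C. fact (d * k c) :: real)"
  define A where "A = {xs \<in> configs d V. {0, 1} \<notin> set (edge_list (map f xs))}"
  have n: "n > 0" using V by (simp add: n_def card_gt_0_iff)
  have C: "finite C" "f ` V \<subseteq> C" by (auto simp: C_def f_def)
  have w0: "w c \<ge> 0" for c by (simp add: w_def)
  have main: "card A * W * fact N \<le> Q ^ m * FC * card (configs d V)"
    using card_configs_avoiding_le[OF V(1) C m, of w "{0, 1}"] w0
    unfolding A_def W_def Q_def FC_def N_def n_def k_def by blast
  have ksum: "(\<Sum>c\<in>C. k c) = n"
    using sum.group[OF V(1) C, of "\<lambda>_. 1 :: nat"] by (simp add: k_def n_def)
  have "{v \<in> V. f v = 0} = S" "{v \<in> V. f v = 1} = T"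
    using ST by (auto simp: f_def split: if_splits)
  then have k01: "k 0 = s" "k 1 = s" using card by (simp_all add: k_def)
  have wsum: "w 0 + w 1 + w 2 = 1"
  proof -
    have "real n = real (k 0) + real (k 1) + real (k 2)"
      using ksum by (simp add: C_def)
    then have "(real (k 0) + real (k 1) + real (k 2)) / real n = 1" using n by simp
    then show ?thesis by (simp only: w_def add_divide_distrib)
  qed
  have pairs: "{p \<in> C \<times> C. {fst p, snd p} \<noteq> {0, 1}} = {(0, 0), (0, 2), (1, 1), (1, 2), (2, 0), (2, 1), (2, 2)}"
    by (auto simp: C_def doubleton_eq_iff)
  have "Q = w 0 * w 0 + w 0 * w 2 + w 1 * w 1 + w 1 * w 2 + w 2 * w 0 + w 2 * w 1 + w 2 * w 2"
    unfolding Q_def pairs by simp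
  also have "\<dots> = (w 0 + w 1 + w 2)\<^sup>2 - 2 * (w 0 * w 1)" by (simp add: power2_eq_square algebra_simps)
  also have "\<dots> = 1 - 2 * (s / n)\<^sup>2" 
  proof -
    have "w 0 = s / n" "w 1 = s / n" by (simp_all only: w_def k01)
    then show ?thesis unfolding wsum by (simp only: power2_eq_square mult_1)
  qed
  finally have Q: "Q = 1 - 2 * (s / n)\<^sup>2" .
  \<comment> \<open>A colour may be absent; its weight is then 0, but so is the exponent.\<close>
  have "w c ^ (d * k c) > 0" for c
  proof (cases "k c = 0")
    case False
    then have "w c > 0" using n by (simp add: w_def)
    then show ?thesis by (rule zero_less_power)
  qed simp
  then have W: "W > 0" unfolding W_def by (intro prod_pos) blast
  have dk: "real (d * k c) ^ (d * k c) = w c ^ (d * k c) * real N ^ (d * k c)" for c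
    using n by (simp add: w_def N_def mult.commute[of _ "real d"] flip: power_mult_distrib)
  have "FC \<le> (\<Prod>c\<in>C. exp 1 * (real N + 1) * (w c ^ (d * k c) * real N ^ (d * k c)) * exp (- real (d * k c)))"
    unfolding FC_def
  proof (rule prod_mono)
    fix c assume c: "c \<in> C"
    have "k c \<le> n" using ksum member_le_sum[OF c, of k] C(1) by simp
    then have kN: "real (d * k c) \<le> real N" unfolding N_def by (intro of_nat_mono mult_le_mono2)
    have "fact (d * k c) = (fact (d * k c) * exp (real (d * k c))) * exp (- real (d * k c))"
      by (simp add: exp_minus)
    also have "\<dots> \<le> (exp 1 * (real (d * k c) + 1) * real (d * k c) ^ (d * k c)) * exp (- real (d * k c))"
      by (intro mult_right_mono fact_exp_le_self_power) simp
    also have "\<dots> \<le> (exp 1 * (real N + 1) * real (d * k c) ^ (d * k c)) * exp (- real (d * k c))"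
      using kN by (intro mult_right_mono mult_left_mono) auto
    finally show "0 \<le> (fact (d * k c) :: real) \<and> fact (d * k c) \<le> exp 1 * (real N + 1) * (w c ^ (d * k c) * real N ^ (d * k c)) * exp (- real (d * k c))"
      unfolding dk by simp
  qed
  also have "\<dots> = (exp 1 * (real N + 1)) ^ 3 * (W * real N ^ N) * exp (- real N)"
  proof -
    have "(\<Prod>c\<in>C. real N ^ (d * k c)) = real N ^ N"
      unfolding N_def ksum[symmetric] by (simp add: power_sum sum_distrib_left)
    moreover have "(\<Prod>c\<in>C. exp (- real (d * k c))) = exp (- real N)"
      unfolding N_def ksum[symmetric] by (simp add: exp_sum[OF C(1), symmetric] sum_negf sum_distrib_left)
    moreover have "card C = 3" by (simp add: C_def)
    ultimately show ?thesis unfolding prod.distrib W_def by (simp add: power_mult_distrib)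
  qed
  finally have FC: "FC \<le> (exp 1 * (real N + 1)) ^ 3 * (W * real N ^ N) * exp (- real N)" .
  have Q0: "Q \<ge> 0" unfolding Q_def using w0 by (intro sum_nonneg) auto
  define Z where "Z = W * (real N ^ N * exp (- real N))"
  have "real N ^ N > 0" by (cases "N = 0") auto
  then have Z: "Z > 0" using W by (simp add: Z_def)
  have "real N ^ N * exp (- real N) \<le> fact N"
    using self_power_le_fact_exp[of N] by (simp add: exp_minus field_simps)
  then have "card A * Z \<le> card A * W * fact N"
    unfolding Z_def using W by (simp add: mult.assoc mult_left_mono)
  also note main
  also have "Q ^ m * FC * card (configs d V) \<le> Q ^ m * ((exp 1 * (real N + 1)) ^ 3 * (W * real N ^ N) * exp (- real N)) * card (configs d V)"
    using FC Q0 by (intro mult_right_mono mult_left_mono) auto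
  also have "\<dots> = (Q ^ m * (exp 1 * (real N + 1)) ^ 3 * card (configs d V)) * Z"
    unfolding Z_def by (simp only: mult_ac)
  finally have "card A \<le> Q ^ m * (exp 1 * (real N + 1)) ^ 3 * card (configs d V)"
    using Z by (simp only: mult_le_cancel_right_pos)
  moreover have "{xs \<in> configs d V. separated (set (edge_list xs)) S T} \<subseteq> A"
  proof
    fix xs assume xs: "xs \<in> {xs \<in> configs d V. separated (set (edge_list xs)) S T}"
    have "{0, 1} \<notin> set (edge_list (map f xs))"
    proof
      assume "{0, 1} \<in> set (edge_list (map f xs))"
      then obtain e where e: "e \<in> set (edge_list xs)" "{0, 1} = f ` e" by (auto simp: edge_list_map)
      obtain a b where ab: "e = {a, b}" using edge_list_doubleton[OF e(1)] by blast
      then have "f a = 0 \<and> f b = 1 \<or> f a = 1 \<and> f b = 0" using e(2) by (auto simp: doubleton_eq_iff)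
      then have "a \<in> S \<and> b \<in> T \<or> a \<in> T \<and> b \<in> S" by (auto simp: f_def split: if_splits)
      then show False using xs e(1) ab by (auto simp: separated_def insert_commute)
    qed
    then show "xs \<in> A" using xs by (simp add: A_def)
  qed
  then have "card {xs \<in> configs d V. separated (set (edge_list xs)) S T} \<le> card A"
    by (rule card_mono[rotated]) (simp add: A_def)
  ultimately have "card {xs \<in> configs d V. separated (set (edge_list xs)) S T}
      \<le> Q ^ m * (exp 1 * (real N + 1)) ^ 3 * card (configs d V)" by linarith
  then show ?thesis unfolding Q N_def n_def of_nat_add of_nat_1 .
qed

section \<open>Pairs of disjoint sets and the union bound\<close>

definition separated_pairs :: "'a set \<Rightarrow> nat \<Rightarrow> ('a set \<times> 'a set) set" where
  "separated_pairs V s = {(S, T). S \<subseteq> V \<and> T \<subseteq> V \<and> S \<inter> T = {} \<and> card S = s \<and> card T = s}"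

lemma finite_separated_pairs: "finite V \<Longrightarrow> finite (separated_pairs V s)"
  by (rule finite_subset[of _ "Pow V \<times> Pow V"]) (auto simp: separated_pairs_def)

text \<open>The weights are the probabilities of the classes of a random colouring of the vertices.\<close>

lemma card_separated_pairs_le:
  fixes a c :: real
  assumes V: "finite V" and ac: "a \<ge> 0" "c \<ge> 0" "2 * a + c = 1"
  shows "card (separated_pairs V s) * (a ^ (2 * s) * c ^ (card V - 2 * s)) \<le> 1"
proof -
  define w :: "nat \<Rightarrow> real" where "w i = (if i = 2 then c else a)" for i
  define g :: "'a set \<times> 'a set \<Rightarrow> 'a \<Rightarrow> nat" where
    "g p = (\<lambda>v\<in>V. if v \<in> fst p then 0 else if v \<in> snd p then 1 else 2)" for p
  let ?X = "separated_pairs V s" and ?F = "PiE V (\<lambda>_. {0, 1, 2 :: nat})"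
  have w0: "w i \<ge> 0" for i using ac by (simp add: w_def)
  have val: "(\<Prod>v\<in>V. w (g p v)) = a ^ (2 * s) * c ^ (card V - 2 * s)" if p: "p \<in> ?X" for p
  proof -
    obtain S T where ST: "p = (S, T)" "S \<subseteq> V" "T \<subseteq> V" "S \<inter> T = {}" "card S = s" "card T = s"
      using p by (auto simp: separated_pairs_def)
    have fin: "finite S" "finite T" using ST V finite_subset by blast+
    have cU: "card (S \<union> T) = 2 * s" using ST fin by (simp add: card_Un_disjoint)
    have "(\<Prod>v\<in>V. w (g p v)) = (\<Prod>v\<in>V. if v \<in> S \<union> T then a else c)"
      by (rule prod.cong[OF refl]) (auto simp: g_def w_def ST(1))
    also have "\<dots> = (\<Prod>v\<in>V \<inter> {v. v \<in> S \<union> T}. a) * (\<Prod>v\<in>V \<inter> - {v. v \<in> S \<union> T}. c)"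
      by (rule prod.If_cases[OF V])
    also have "V \<inter> {v. v \<in> S \<union> T} = S \<union> T" using ST by auto
    also have "V \<inter> - {v. v \<in> S \<union> T} = V - (S \<union> T)" by auto
    finally have "(\<Prod>v\<in>V. w (g p v)) = a ^ card (S \<union> T) * c ^ card (V - (S \<union> T))" by simp
    moreover have "card (V - (S \<union> T)) = card V - 2 * s"
      using card_Diff_subset[of "S \<union> T" V] fin ST(2,3) cU by simp
    ultimately show ?thesis using cU by simp
  qed
  have inj: "inj_on g ?X"
  proof (rule inj_onI)
    fix p q assume pq: "p \<in> ?X" "q \<in> ?X" "g p = g q"
    have "fst r = {v \<in> V. g r v = 0}" "snd r = {v \<in> V. g r v = 1}" if "r \<in> ?X" for r
      using that by (auto simp: separated_pairs_def g_def)
    then show "p = q" using pq by (simp add: prod_eq_iff)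
  qed
  have "card ?X * (a ^ (2 * s) * c ^ (card V - 2 * s)) = (\<Sum>p\<in>?X. \<Prod>v\<in>V. w (g p v))"
    by (simp add: val)
  also have "\<dots> = (\<Sum>h\<in>g ` ?X. \<Prod>v\<in>V. w (h v))"
    by (simp add: sum.reindex[OF inj])
  also have "\<dots> \<le> (\<Sum>h\<in>?F. \<Prod>v\<in>V. w (h v))"
  proof (rule sum_mono2)
    show "finite ?F" using V by (intro finite_PiE) auto
    show "g ` ?X \<subseteq> ?F" by (rule image_subsetI, rule PiE_I) (simp_all add: g_def)
    show "0 \<le> (\<Prod>v\<in>V. w (h v))" for h using w0 by (intro prod_nonneg) auto
  qed
  also have "\<dots> = (\<Prod>v\<in>V. \<Sum>i\<in>{0, 1, 2}. w i)"
    by (rule prod_sum_PiE[symmetric]) (use V in auto)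
  also have "(\<Sum>i\<in>{0, 1, 2}. w i) = 1" using ac(3) by (simp add: w_def)
  finally show ?thesis by simp
qed

text \<open>A union bound over the pairs, transferred to graphs: separation depends only on the edge
  set, so the number \<open>\<kappa>\<close> of orderings cancels, and switching bounds
  \<open>card \<Omega>\<close> by \<open>D\<close> times the simple configurations. The case
  \<open>2 * s > n\<close>, in which there are no pairs, is set apart because of the truncated
  exponent \<open>n - 2 * s\<close>.\<close>

lemma prob_separated_le:
  fixes a c :: real and n d m s :: nat
  assumes n: "n > 0" and m: "d * n = 2 * m" and large: "2 * (2 * d * d + 3 * d + 1) + 2 * (d * (4 * d + 2)) < m"
    and ac: "a > 0" "c > 0" "2 * a + c = 1"
  shows "measure_pmf.prob (random_regular n d) {G. \<exists>(S, T)\<in>separated_pairs {..<n} s. separated G S T} * (a ^ (2 * s) * c ^ (n - 2 * s))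
    \<le> (1 - 2 * (s / n)\<^sup>2) ^ m * (exp 1 * (d * n + 1)) ^ 3 * (2 * (m * m) ^ (2 * (2 * d * d + 3 * d + 1)))
     \<or> 2 * s > n"
proof (rule disjCI)
  assume "\<not> 2 * s > n"
  then have sn: "2 * s \<le> n" by simp
  let ?V = "{..<n}"
  interpret configuration_model d ?V m by unfold_locales (use m in auto)
  define D where "D = 2 * (m * m) ^ (2 * (2 * d * d + 3 * d + 1))"
  define B where "B = (1 - 2 * (s / n)\<^sup>2) ^ m * (exp 1 * (d * n + 1)) ^ 3"
  define R where "R = {G. regular_graph d ?V G}"
  define \<kappa> :: nat where "\<kappa> = 2 ^ m * fact m"
  let ?X = "separated_pairs ?V s"
  let ?bad = "{G. \<exists>(S, T)\<in>?X. separated G S T}"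
  have \<kappa>: "\<kappa> > 0" by (simp add: \<kappa>_def)
  have "R \<subseteq> Pow (Pow ?V)" by (auto simp: R_def regular_graph_def simple_graph_def)
  then have finR: "finite R" by (rule finite_subset) simp
  have \<Omega>: "card \<Omega> \<le> D * card {xs \<in> \<Omega>. simple_config xs}"
    using card_configs_le[OF large] by (simp add: D_def)
  also have "card {xs \<in> \<Omega>. simple_config xs} = card R * \<kappa>"
    using card_simple_configs[OF finite_V, of d m "\<lambda>_. True"] m by (simp add: R_def \<kappa>_def)
  finally have \<Omega>R: "card \<Omega> \<le> D * (card R * \<kappa>)" .
  have "card \<Omega> > 0" using card_configs[OF finite_V, of d] by (metis fact_nonzero gr0I mult_0)
  \<comment> \<open>Existence of a regular graph is a by-product of the switching bound; it makes
    \<open>random_regular\<close> a genuine uniform distribution.\<close>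
  then have cR: "card R > 0" using \<Omega>R by (metis gr0I mult_0 mult_0_right not_le)
  have B0: "B \<ge> 0"
  proof -
    have "real s / real n \<le> 1 / 2" using sn n by (simp add: field_simps)
    then have "(real s / real n)\<^sup>2 \<le> (1 / 2)\<^sup>2" by (intro power_mono) auto
    moreover have "(1 / 2)\<^sup>2 = (1 / 4 :: real)" by (simp add: power2_eq_square)
    moreover define q where "q = (real s / real n)\<^sup>2"
    ultimately have "1 - 2 * q \<ge> 0" by linarith
    then show ?thesis unfolding B_def q_def by (intro mult_nonneg_nonneg zero_le_power) auto
  qed
  have one: "card {G \<in> R. separated G S T} \<le> B * D * card R" if ST: "(S, T) \<in> ?X" for S T
  proof -
    have "card {G \<in> R. separated G S T} * \<kappa> = card {xs \<in> \<Omega>. simple_config xs \<and> separated (set (edge_list xs)) S T}"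
      using card_simple_configs[OF finite_V, of d m "\<lambda>G. separated G S T"] m by (simp add: R_def \<kappa>_def)
    also have "\<dots> \<le> card {xs \<in> \<Omega>. separated (set (edge_list xs)) S T}"
      by (rule card_mono) auto
    finally have "real (card {G \<in> R. separated G S T} * \<kappa>) \<le> real (card {xs \<in> \<Omega>. separated (set (edge_list xs)) S T})"
      by (rule of_nat_mono)
    also have "\<dots> \<le> B * card \<Omega>"
    proof -
      have "?V \<noteq> {}" using n by auto
      then show ?thesis
        using card_separated_configs_le[of ?V d m S T s] ST m by (simp add: B_def separated_pairs_def)
    qed
    also have "\<dots> \<le> B * real (D * (card R * \<kappa>))"
      using \<Omega>R B0 by (intro mult_left_mono of_nat_mono)
    finally have "card {G \<in> R. separated G S T} * real \<kappa> \<le> (B * D * card R) * real \<kappa>" by (simp add: mult_ac)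
    then show ?thesis using \<kappa> by simp
  qed
  have "R \<inter> ?bad = (\<Union>(S, T)\<in>?X. {G \<in> R. separated G S T})" by auto
  also have "card \<dots> \<le> (\<Sum>p\<in>?X. card (case p of (S, T) \<Rightarrow> {G \<in> R. separated G S T}))"
    by (rule card_UN_le) (simp add: finite_separated_pairs)
  finally have "real (card (R \<inter> ?bad)) \<le> real (\<Sum>p\<in>?X. card (case p of (S, T) \<Rightarrow> {G \<in> R. separated G S T}))"
    by (rule of_nat_mono)
  also have "\<dots> = (\<Sum>p\<in>?X. real (card (case p of (S, T) \<Rightarrow> {G \<in> R. separated G S T})))"
    by (rule of_nat_sum)
  also have "\<dots> \<le> (\<Sum>p\<in>?X. B * D * card R)"
    by (rule sum_mono) (use one in auto)
  finally have "card (R \<inter> ?bad) \<le> card ?X * (B * D * card R)" by simp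
  then have "card (R \<inter> ?bad) / card R \<le> card ?X * (B * D)"
    using cR by (simp add: field_simps)
  moreover have "measure_pmf.prob (random_regular n d) ?bad = card (R \<inter> ?bad) / card R"
    unfolding random_regular_def R_def[symmetric] using cR finR by (intro measure_pmf_of_set) auto
  ultimately have "measure_pmf.prob (random_regular n d) ?bad \<le> card ?X * (B * D)" by simp
  then have "measure_pmf.prob (random_regular n d) ?bad * (a ^ (2 * s) * c ^ (n - 2 * s))
     \<le> card ?X * (B * D) * (a ^ (2 * s) * c ^ (n - 2 * s))"
    using ac by (intro mult_right_mono) auto
  also have "\<dots> = (card ?X * (a ^ (2 * s) * c ^ (n - 2 * s))) * (B * D)" by (simp only: mult_ac)
  also have "\<dots> \<le> 1 * (B * D)"
    using card_separated_pairs_le[of ?V a c s] ac B0 by (intro mult_right_mono) auto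
  finally show "measure_pmf.prob (random_regular n d) ?bad * (a ^ (2 * s) * c ^ (n - 2 * s))
    \<le> (1 - 2 * (s / n)\<^sup>2) ^ m * (exp 1 * (d * n + 1)) ^ 3 * (2 * (m * m) ^ (2 * (2 * d * d + 3 * d + 1)))"
    by (simp add: B_def D_def)
qed

section \<open>The rate of the first moment bound\<close>


text \<open>Half of what is subtracted from 1 in the spectral bound when
  \<open>\<lambda> = 2 * sqrt (d - 1)\<close>. If \<open>H\<close> is below the claimed bound, then
  \<open>S\<close> and \<open>T\<close> each contain at least this fraction of the vertices.\<close>

definition hop_rate :: "nat \<Rightarrow> real" where
  "hop_rate d = min (4 * sqrt (real d - 1) / real d) (8 * sqrt (real d - 1) / (real d + 6 * sqrt (real d - 1))) / 2"

text \<open>Certifies a rational lower bound \<open>x\<close> from a rational \<open>y\<close> below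
  \<open>sqrt (d - 1)\<close>. The conditions persist when \<open>y\<close> grows to the root; for
  the second one this uses \<open>4 - 6 * x > 0\<close>.\<close>

lemma hop_rate_ge:
  assumes "y \<ge> 0" "y\<^sup>2 \<le> real d - 1" "x \<ge> 0" "x * d \<le> 2 * y" "x * (real d + 6 * y) \<le> 4 * y" "x \<le> 1 / 2"
  shows "x \<le> hop_rate d"
proof -
  define z where "z = sqrt (real d - 1)"
  have yz: "y \<le> z" unfolding z_def by (rule real_le_rsqrt) (rule assms(2))
  have d: "real d > 0" using assms(2) zero_le_power2[of y] by linarith
  have "x * d \<le> 2 * z" using assms(4) yz by linarith
  then have "x \<le> 2 * z / d" using d by (simp add: field_simps)
  moreover have "(4 - 6 * x) * y \<le> (4 - 6 * x) * z" using yz assms(6) by (intro mult_left_mono) auto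
  then have "x * (real d + 6 * z) \<le> 4 * z" using assms(5) by (simp add: algebra_simps)
  then have "x \<le> 4 * z / (real d + 6 * z)" using d yz assms(1) by (simp add: field_simps)
  ultimately show ?thesis unfolding hop_rate_def z_def[symmetric] by (simp add: min_def)
qed

lemma hop_rate_bounds:
  assumes "d \<ge> 3"
  shows "0 < hop_rate d" "2 * (hop_rate d)\<^sup>2 < 1"
proof -
  define z where "z = sqrt (real d - 1)"
  have z: "z > 0" using assms by (simp add: z_def)
  have d: "real d > 0" using assms by simp
  show pos: "0 < hop_rate d"
    unfolding hop_rate_def z_def[symmetric] using z d by (simp add: min_def add_pos_pos)
  have "hop_rate d \<le> 4 * z / (real d + 6 * z)"
    unfolding hop_rate_def z_def[symmetric] by (simp add: min_def)
  also have "\<dots> \<le> 2 / 3" using z d by (simp add: field_simps)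
  finally have "(hop_rate d)\<^sup>2 \<le> (2 / 3)\<^sup>2" using pos by (intro power_mono) auto
  then show "2 * (hop_rate d)\<^sup>2 < 1" by (simp add: power2_eq_square)
qed

text \<open>The constant is squeezed: the count of \<open>3 ^ n\<close> colourings needs more than
  \<open>ln 3\<close>, about 1.0986, and at \<open>d = 5\<close> the value is
  \<open>320 / 289\<close>, about 1.107.\<close>

lemma hop_rate_square:
  assumes "d \<ge> 5"
  shows "11 / 10 \<le> d * (hop_rate d)\<^sup>2"
proof -
  define y where "y = sqrt (real d - 1)"
  have d: "real d = y\<^sup>2 + 1" using assms by (simp add: y_def)
  have y: "y \<ge> 2" unfolding y_def using assms by (intro real_le_rsqrt) simp
  have "11 / 10 \<le> d * (2 * y / d)\<^sup>2"
  proof -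
    have "D * (x / D)\<^sup>2 = x\<^sup>2 / D" for D x :: real
      by (cases "D = 0") (auto simp: power2_eq_square)
    then have "d * (2 * y / d)\<^sup>2 = 4 * y\<^sup>2 / (y\<^sup>2 + 1)"
      by (simp add: d power_mult_distrib)
    moreover have "y\<^sup>2 \<ge> 2\<^sup>2" using y by (intro power_mono) auto
    then have "11 / 10 \<le> 4 * y\<^sup>2 / (y\<^sup>2 + 1)" by (simp add: field_simps)
    ultimately show ?thesis by simp
  qed
  moreover have "11 / 10 \<le> d * (4 * y / (d + 6 * y))\<^sup>2"
  proof -
    \<comment> \<open>Since \<open>y \<ge> 2\<close>, expanding around 2 turns the inequality into a
      polynomial in \<open>t \<ge> 0\<close> with positive coefficients.\<close>
    define t where "t = y - 2"
    have t: "t \<ge> 0" and yt: "y = t + 2" using y by (auto simp: t_def)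
    have eq: "160 * y\<^sup>2 * (y\<^sup>2 + 1) - 11 * (y\<^sup>2 + 1 + 6 * y)\<^sup>2
        = 149 * t ^ 4 + 1060 * t ^ 3 + 2526 * t ^ 2 + 2020 * t + 21"
      unfolding yt by (simp add: power2_eq_square power3_eq_cube power4_eq_xxxx algebra_simps)
    have "0 \<le> 149 * t ^ 4 + 1060 * t ^ 3 + 2526 * t ^ 2 + 2020 * t + 21"
      using t by (intro add_nonneg_nonneg) auto
    then have "11 * (y\<^sup>2 + 1 + 6 * y)\<^sup>2 \<le> 160 * y\<^sup>2 * (y\<^sup>2 + 1)" using eq by linarith
    moreover have "(y\<^sup>2 + 1 + 6 * y)\<^sup>2 > 0" using y by (intro zero_less_power add_pos_pos) auto
    moreover have "d * (4 * y / (d + 6 * y))\<^sup>2 = (16 * y\<^sup>2 * (y\<^sup>2 + 1)) / (y\<^sup>2 + 1 + 6 * y)\<^sup>2"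
      unfolding d power_divide by (simp add: power_mult_distrib)
    ultimately show ?thesis by (simp add: pos_le_divide_eq)
  qed
  moreover have "hop_rate d = 2 * y / d \<or> hop_rate d = 4 * y / (d + 6 * y)"
    unfolding hop_rate_def y_def[symmetric] by (simp add: min_def)
  ultimately show ?thesis by auto
qed

text \<open>For \<open>d \<ge> 4\<close> it is enough to count all \<open>3\<^sup>n\<close> colourings. For \<open>d = 3\<close> this is too many, and
  the third colour, which is rare, gets a small weight.\<close>

lemma hop_rate_first_moment:
  assumes "d \<ge> 3"
  obtains a c \<gamma> :: real where "a > 0" "c > 0" "\<gamma> > 0" "2 * a + c = 1"
    "\<forall>n s. hop_rate d * real n \<le> real s \<longrightarrow> 2 * s \<le> n \<longrightarrow> \<gamma> ^ n \<le> a ^ (2 * s) * c ^ (n - 2 * s)"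
    "(1 - 2 * (hop_rate d)\<^sup>2) ^ d < \<gamma>\<^sup>2"
proof (cases "d = 3")
  case True
  \<comment> \<open>As \<open>\<sigma> \<ge> 49 / 100\<close>, at most \<open>n / 50\<close>
    vertices have the third colour. Its weight \<open>1 / 64\<close> costs at most
    \<open>64 powr (1 / 50) < 109 / 100\<close> per vertex, while
    \<open>a = (1 - 1 / 64) / 2\<close> stays close to one half.\<close>
  define a c \<gamma> :: real where "a = 63 / 128" and "c = 1 / 64" and "\<gamma> = 63 / 128 * (100 / 109)"
  have rate: "49 / 100 \<le> hop_rate d"
    by (rule hop_rate_ge[of "14 / 10"]) (auto simp: True power2_eq_square)
  have "\<gamma> ^ n \<le> a ^ (2 * s) * c ^ (n - 2 * s)" if "hop_rate d * real n \<le> real s" "2 * s \<le> n" for n s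
  proof -
    have "49 / 100 * real n \<le> real s" using that(1) rate by (meson mult_right_mono of_nat_0_le_iff order_trans)
    then have le: "50 * (n - 2 * s) \<le> n" using that(2) by linarith
    have "((100 / 109) ^ n) ^ 50 = ((100 / 109) ^ 50 :: real) ^ n"
      by (simp only: power_mult[symmetric] mult.commute)
    also have "\<dots> \<le> c ^ n" unfolding c_def by (intro power_mono) (auto simp: power_divide)
    also have "\<dots> \<le> c ^ (50 * (n - 2 * s))" using le by (intro power_decreasing) (auto simp: c_def)
    also have "\<dots> = (c ^ (n - 2 * s)) ^ 50" by (simp only: power_mult[symmetric] mult.commute)
    finally have "(100 / 109) ^ n \<le> c ^ (n - 2 * s)"
      by (rule power_le_imp_le_base[of _ 49, simplified]) (simp add: c_def)
    moreover have "a ^ n \<le> a ^ (2 * s)" using that(2) by (intro power_decreasing) (auto simp: a_def)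
    ultimately have "a ^ n * (100 / 109) ^ n \<le> a ^ (2 * s) * c ^ (n - 2 * s)"
      by (intro mult_mono) (auto simp: a_def)
    then show ?thesis by (simp only: \<gamma>_def a_def power_mult_distrib)
  qed
  moreover have "(1 - 2 * (hop_rate d)\<^sup>2) ^ d < \<gamma>\<^sup>2"
  proof -
    have "(49 / 100)\<^sup>2 \<le> (hop_rate d)\<^sup>2" using rate by (intro power_mono) auto
    then have "1 - 2 * (hop_rate d)\<^sup>2 \<le> 5198 / 10000" by (simp add: power2_eq_square)
    then have "(1 - 2 * (hop_rate d)\<^sup>2) ^ d \<le> (5198 / 10000) ^ d"
      using hop_rate_bounds(2)[OF assms] by (intro power_mono) auto
    then show ?thesis unfolding True \<gamma>_def by (simp add: power2_eq_square power3_eq_cube)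
  qed
  ultimately show ?thesis by (intro that[of a c \<gamma>]) (auto simp: a_def c_def \<gamma>_def)
next
  case False
  have third: "(1 / 3) ^ n \<le> (1 / 3 :: real) ^ (2 * s) * (1 / 3) ^ (n - 2 * s)" if "2 * s \<le> n" for n s
    using that by (simp flip: power_add)
  have "(1 - 2 * (hop_rate d)\<^sup>2) ^ d < (1 / 3)\<^sup>2"
  proof (cases "d = 4")
    case True
    have rate: "48 / 100 \<le> hop_rate d"
      by (rule hop_rate_ge[of "173 / 100"]) (auto simp: True power2_eq_square)
    have "(48 / 100)\<^sup>2 \<le> (hop_rate d)\<^sup>2" using rate by (intro power_mono) auto
    then have "1 - 2 * (hop_rate d)\<^sup>2 \<le> 5392 / 10000" by (simp add: power2_eq_square)
    then have "(1 - 2 * (hop_rate d)\<^sup>2) ^ d \<le> (5392 / 10000) ^ d"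
      using hop_rate_bounds(2)[OF assms] by (intro power_mono) auto
    then show ?thesis unfolding True by (simp add: power2_eq_square power4_eq_xxxx)
  next
    case d4: False
    then have d5: "d \<ge> 5" using assms False by simp
    have exp3: "3 < exp (11 / 10 :: real)"
    proof -
      \<comment> \<open>The margin is small, as \<open>exp (11 / 10)\<close> is about 3.004;
        splitting the exponent into 20 parts makes the quadratic Taylor bound accurate
        enough.\<close>
      have "3 < (10565 / 10000 :: real) ^ 20" by (simp add: power_divide)
      also have "\<dots> \<le> exp (55 / 1000) ^ 20"
        using exp_lower_Taylor_quadratic[of "55 / 1000 :: real"] by (intro power_mono) (auto simp: power2_eq_square)
      also have "\<dots> = exp (11 / 10)" by (simp flip: exp_of_nat_mult)
      finally show ?thesis .
    qed
    have "(1 - 2 * (hop_rate d)\<^sup>2) ^ d \<le> exp (- 2 * (hop_rate d)\<^sup>2) ^ d"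
      using hop_rate_bounds(2)[OF assms] exp_ge_add_one_self[of "- 2 * (hop_rate d)\<^sup>2"] by (intro power_mono) auto
    also have "\<dots> = exp (- 2 * (d * (hop_rate d)\<^sup>2))" by (simp add: mult_ac flip: exp_of_nat_mult)
    also have "\<dots> \<le> exp (- 2 * (11 / 10))" using hop_rate_square[OF d5] by simp
    also have "\<dots> = (1 / exp (11 / 10))\<^sup>2" by (simp add: power2_eq_square exp_minus field_simps flip: exp_add)
    also have "\<dots> < (1 / 3)\<^sup>2" using exp3 by (intro power_strict_mono divide_strict_left_mono) auto
    finally show ?thesis .
  qed
  then show ?thesis using third by (intro that[of "1 / 3" "1 / 3" "1 / 3"]) auto
qed

text \<open>With \<open>y\<close> the \<open>L\<close>-th root of \<open>x\<close>, the term is the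
  \<open>L\<close>-th power of \<open>n * y ^ n\<close>.\<close>

lemma power_times_geometric_tendsto_0:
  fixes x :: real
  assumes "0 \<le> x" "x < 1" "L > 0"
  shows "(\<lambda>n. real n ^ L * x ^ n) \<longlonglongrightarrow> 0"
proof -
  define y where "y = root L x"
  have y: "y ^ L = x" "0 \<le> y" "y < 1" using assms by (auto simp: y_def)
  have "(\<lambda>n. (real n * y ^ n) ^ L) \<longlonglongrightarrow> 0 ^ L"
    by (intro tendsto_power powser_times_n_limit_0) (use y in auto)
  moreover have "(real n * y ^ n) ^ L = real n ^ L * x ^ n" for n
    unfolding y(1)[symmetric] power_mult_distrib by (simp only: power_mult[symmetric] mult.commute)
  ultimately show ?thesis using assms(3) by (simp add: zero_power)
qed

section \<open>Random regular graphs\<close>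


text \<open>Rounding \<open>\<sigma> * n\<close> up adds less than 2 to \<open>2 * s\<close>. The
  slack of 1 in \<open>hopping_number_separated\<close> and \<open>\<epsilon> * n \<ge> 1\<close>
  together pay for it.\<close>

lemma few_hops_separated:
  assumes "\<not> (1 - 2 * \<sigma> - \<epsilon>) * real n \<le> real (hopping_number {..<n} E)" "\<sigma> \<ge> 0" "1 \<le> \<epsilon> * real n"
  shows "\<exists>(S, T)\<in>separated_pairs {..<n} (nat \<lceil>\<sigma> * real n\<rceil>). separated E S T"
proof -
  define s where "s = nat \<lceil>\<sigma> * real n\<rceil>"
  have "real s < \<sigma> * real n + 1" using assms(2) unfolding s_def by (simp add: of_nat_nat) linarith
  moreover have "real (hopping_number {..<n} E) < real n - 2 * (\<sigma> * real n) - \<epsilon> * real n"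
    using assms(1) by (simp add: algebra_simps)
  ultimately have "2 * s + hopping_number {..<n} E \<le> n + 1" using assms(3) by linarith
  then obtain S T where "S \<subseteq> {..<n}" "T \<subseteq> {..<n}" "card S = s" "card T = s" "separated E S T"
    using hopping_number_separated[of "{..<n}" s E] by auto
  then have "(S, T) \<in> separated_pairs {..<n} s" "separated E S T"
    by (auto simp: separated_pairs_def separated_def)
  then show ?thesis unfolding s_def[symmetric] by blast
qed

lemma separated_pairs_empty:
  assumes "finite V" "card V < 2 * s"
  shows "separated_pairs V s = {}"
proof (rule equals0I)
  fix p assume "p \<in> separated_pairs V s"
  then obtain S T where ST: "S \<subseteq> V" "T \<subseteq> V" "S \<inter> T = {}" "card S = s" "card T = s"
    by (auto simp: separated_pairs_def)
  have "card (S \<union> T) = 2 * s"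
    using ST finite_subset[OF _ assms(1)] by (simp add: card_Un_disjoint)
  then show False using card_mono[OF assms(1), of "S \<union> T"] ST assms(2) by simp
qed

text \<open>By the choice of \<open>x\<close> and \<open>2 * m = d * n\<close>, the rate
  \<open>(1 - 2 * \<sigma>\<^sup>2) ^ m\<close> is \<open>(x * \<gamma>) ^ n\<close>; dividing by
  the weight \<open>\<gamma> ^ n\<close> leaves \<open>x ^ n\<close>. The exponent
  \<open>2 * K + 3\<close> collects \<open>(m * m) ^ K\<close> from the switchings and a cube from
  the three colours.\<close>

lemma prob_few_hops_le:
  fixes a c \<gamma> x :: real and n d s m :: nat
  assumes d: "d \<ge> 3" and n: "n > 0" and m: "d * n = 2 * m"
    and large: "2 * (2 * d * d + 3 * d + 1) + 2 * (d * (4 * d + 2)) < m"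
    and s: "hop_rate d * real n \<le> real s"
    and ac: "a > 0" "c > 0" "\<gamma> > 0" "2 * a + c = 1"
    and weight: "2 * s \<le> n \<Longrightarrow> \<gamma> ^ n \<le> a ^ (2 * s) * c ^ (n - 2 * s)"
    and x: "x \<ge> 0" "x\<^sup>2 * \<gamma>\<^sup>2 = (1 - 2 * (hop_rate d)\<^sup>2) ^ d"
    and K: "K = 2 * (2 * d * d + 3 * d + 1)"
  shows "measure_pmf.prob (random_regular n d) {G. \<exists>(S, T)\<in>separated_pairs {..<n} s. separated G S T}
    \<le> (exp 1 * real (d + 1)) ^ 3 * (2 * real d ^ (2 * K)) * (real n ^ (2 * K + 3) * x ^ n)"
    (is "?P \<le> ?M * _")
proof (cases "2 * s \<le> n")
  case False
  then have "separated_pairs {..<n} s = {}" by (intro separated_pairs_empty) auto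
  then show ?thesis using x(1) by simp
next
  case True
  define \<sigma> where "\<sigma> = hop_rate d"
  note rate = hop_rate_bounds[OF d, folded \<sigma>_def]
  define R where "R = (exp 1 * real (d * n + 1)) ^ 3 * (2 * real (m * m) ^ K)"
  have R0: "R \<ge> 0" by (simp add: R_def)
  have "real s / real n \<ge> \<sigma>" using s n by (simp add: \<sigma>_def field_simps)
  then have "(real s / real n)\<^sup>2 \<ge> \<sigma>\<^sup>2" using rate(1) by (intro power_mono) auto
  moreover have "real s / real n \<le> 1 / 2" using True n by (simp add: field_simps)
  then have "(real s / real n)\<^sup>2 \<le> (1 / 2)\<^sup>2" by (intro power_mono) auto
  then have "(real s / real n)\<^sup>2 \<le> 1 / 4" by (simp add: power_one_over)
  ultimately have Q: "(1 - 2 * (real s / real n)\<^sup>2) ^ m \<le> (1 - 2 * \<sigma>\<^sup>2) ^ m"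
    by (intro power_mono) linarith+
  have "(1 - 2 * \<sigma>\<^sup>2) ^ m = (x * \<gamma>) ^ n"
  proof (rule power2_eq_imp_eq)
    have "((1 - 2 * \<sigma>\<^sup>2) ^ m)\<^sup>2 = ((1 - 2 * \<sigma>\<^sup>2) ^ d) ^ n"
      unfolding power_mult[symmetric] m by (simp only: mult.commute)
    also have "\<dots> = ((x * \<gamma>)\<^sup>2) ^ n" unfolding \<sigma>_def x(2)[symmetric] power_mult_distrib ..
    also have "\<dots> = ((x * \<gamma>) ^ n)\<^sup>2" by (simp only: power_mult[symmetric] mult.commute)
    finally show "((1 - 2 * \<sigma>\<^sup>2) ^ m)\<^sup>2 = ((x * \<gamma>) ^ n)\<^sup>2" .
  qed (use rate x(1) ac(3) in auto)
  then have Q2: "(1 - 2 * (real s / real n)\<^sup>2) ^ m * R \<le> (x ^ n * R) * \<gamma> ^ n"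
    using mult_right_mono[OF Q R0] by (simp add: power_mult_distrib mult_ac)
  have "?P * \<gamma> ^ n \<le> ?P * (a ^ (2 * s) * c ^ (n - 2 * s))"
    using weight[OF True] by (intro mult_left_mono) auto
  also have "\<dots> \<le> (1 - 2 * (real s / real n)\<^sup>2) ^ m * R"
    using prob_separated_le[OF n m large ac(1,2,4), of s] True unfolding R_def K by (simp add: mult.assoc)
  also note Q2
  finally have "?P \<le> x ^ n * R" using ac(3) by simp
  also have "R \<le> ?M * real n ^ (2 * K + 3)"
  proof -
    have "real (d * n + 1) \<le> real ((d + 1) * n)" using n by (intro of_nat_mono) simp
    then have "(exp 1 * real (d * n + 1)) ^ 3 \<le> (exp 1 * real ((d + 1) * n)) ^ 3"
      by (intro power_mono mult_left_mono) auto
    moreover have "m \<le> d * n" using m by simp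
    then have "real (m * m) ^ K \<le> real (d * n * (d * n)) ^ K"
      by (intro power_mono of_nat_mono mult_le_mono) auto
    ultimately have "R \<le> (exp 1 * real ((d + 1) * n)) ^ 3 * (2 * real (d * n * (d * n)) ^ K)"
      unfolding R_def by (intro mult_mono) auto
    also have "real (d * n * (d * n)) ^ K = real d ^ (2 * K) * real n ^ (2 * K)"
      by (simp add: power_mult power2_eq_square power_mult_distrib mult_ac)
    also have "(exp 1 * real ((d + 1) * n)) ^ 3 = (exp 1 * real (d + 1)) ^ 3 * real n ^ 3"
      by (simp only: of_nat_mult power_mult_distrib mult.assoc)
    finally show ?thesis by (simp only: power_add mult_ac)
  qed
  then have "x ^ n * R \<le> x ^ n * (?M * real n ^ (2 * K + 3))" using x(1) by (intro mult_left_mono) auto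
  finally show ?thesis by (simp only: mult_ac)
qed

text \<open>The constants \<open>x < 1\<close>, \<open>K\<close> and \<open>M\<close> depend on
  \<open>d\<close> only, so the failure probability is a polynomial in \<open>n\<close> times a
  decaying geometric term. The filter lets \<open>n\<close> tend to infinity through the values with
  \<open>d * n\<close> even.\<close>

theorem random_regular_hopping_number_ge:
  fixes d :: nat and \<epsilon> :: real
  assumes d: "d \<ge> 3" and \<epsilon>: "\<epsilon> > 0"
  shows "((\<lambda>n. measure_pmf.prob (random_regular n d)
          {E. real (hopping_number {..<n} E) \<ge> (1 - 2 * hop_rate d - \<epsilon>) * real n})
        \<longlongrightarrow> 1) (inf sequentially (principal {n. even (d * n)}))"
proof -
  define \<sigma> where "\<sigma> = hop_rate d"
  define K where "K = 2 * (2 * d * d + 3 * d + 1)"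
  obtain a c \<gamma> :: real where ac: "a > 0" "c > 0" "\<gamma> > 0" "2 * a + c = 1"
    and weight: "\<forall>n s. hop_rate d * real n \<le> real s \<longrightarrow> 2 * s \<le> n \<longrightarrow> \<gamma> ^ n \<le> a ^ (2 * s) * c ^ (n - 2 * s)"
    and rate: "(1 - 2 * (hop_rate d)\<^sup>2) ^ d < \<gamma>\<^sup>2"
    using hop_rate_first_moment[OF d] .
  define x where "x = sqrt ((1 - 2 * (hop_rate d)\<^sup>2) ^ d / \<gamma>\<^sup>2)"
  have Q0: "(1 - 2 * (hop_rate d)\<^sup>2) ^ d \<ge> 0" using hop_rate_bounds(2)[OF d] by (intro zero_le_power) simp
  have x: "x \<ge> 0" "x < 1" "x\<^sup>2 * \<gamma>\<^sup>2 = (1 - 2 * (hop_rate d)\<^sup>2) ^ d"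
    using Q0 rate ac(3) by (simp_all add: x_def)
  define M where "M = (exp 1 * real (d + 1)) ^ 3 * (2 * real d ^ (2 * K))"
  define good where "good n = {E. real (hopping_number {..<n} E) \<ge> (1 - 2 * \<sigma> - \<epsilon>) * real n}" for n
  let ?F = "inf sequentially (principal {n. even (d * n)})"
  have lower: "1 - M * (real n ^ (2 * K + 3) * x ^ n) \<le> measure_pmf.prob (random_regular n d) (good n)"
    if n: "n > K + 2 * (d * (4 * d + 2))" "n \<ge> nat \<lceil>1 / \<epsilon>\<rceil>" "even (d * n)" for n
  proof -
    obtain m where m: "d * n = 2 * m" using n(3) by (elim evenE)
    \<comment> \<open>Hence there are at least \<open>n\<close> edges, and a lower bound on
      \<open>n\<close> yields the lower bound on \<open>m\<close> that the switchings
      require.\<close>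
    have "2 * n \<le> d * n" using d by (intro mult_le_mono1) simp
    then have "n \<le> m" using m by simp
    then have large: "2 * (2 * d * d + 3 * d + 1) + 2 * (d * (4 * d + 2)) < m" using n(1) unfolding K_def by linarith
    have "1 / \<epsilon> \<le> real n" using n(2) by linarith
    then have \<epsilon>n: "1 \<le> \<epsilon> * real n" using \<epsilon> by (simp add: field_simps)
    define s where "s = nat \<lceil>\<sigma> * real n\<rceil>"
    let ?bad = "{G. \<exists>(S, T)\<in>separated_pairs {..<n} s. separated G S T}"
    have s: "hop_rate d * real n \<le> real s" unfolding s_def \<sigma>_def by linarith
    have "UNIV - good n \<subseteq> ?bad"
    proof
      fix E assume "E \<in> UNIV - good n"
      then have "\<not> (1 - 2 * \<sigma> - \<epsilon>) * real n \<le> real (hopping_number {..<n} E)" by (simp add: good_def)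
      from few_hops_separated[OF this _ \<epsilon>n] hop_rate_bounds(1)[OF d]
      show "E \<in> ?bad" by (simp add: s_def \<sigma>_def)
    qed
    then have "measure_pmf.prob (random_regular n d) (UNIV - good n) \<le> measure_pmf.prob (random_regular n d) ?bad"
      by (intro measure_pmf.finite_measure_mono) auto
    also have "\<dots> \<le> M * (real n ^ (2 * K + 3) * x ^ n)"
      unfolding M_def
      by (rule prob_few_hops_le[OF d _ m large s ac weight[rule_format, OF s] x(1,3) K_def]) (use n(1) in auto)
    finally show ?thesis
      using measure_pmf.prob_compl[of "good n" "random_regular n d"] by simp
  qed
  have lower_ev: "eventually (\<lambda>n. 1 - M * (real n ^ (2 * K + 3) * x ^ n) \<le> measure_pmf.prob (random_regular n d) (good n)) ?F"
    unfolding eventually_inf_principal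
    using eventually_gt_at_top[of "K + 2 * (d * (4 * d + 2))"] eventually_ge_at_top[of "nat \<lceil>1 / \<epsilon>\<rceil>"]
    by eventually_elim (use lower in auto)
  have lim: "((\<lambda>n. 1 - M * (real n ^ (2 * K + 3) * x ^ n)) \<longlongrightarrow> 1) ?F"
  proof -
    have "(\<lambda>n. 1 - M * (real n ^ (2 * K + 3) * x ^ n)) \<longlonglongrightarrow> 1 - M * 0"
      by (intro tendsto_intros power_times_geometric_tendsto_0) (use x in auto)
    then have "(\<lambda>n. 1 - M * (real n ^ (2 * K + 3) * x ^ n)) \<longlonglongrightarrow> 1" by simp
    then show ?thesis by (rule tendsto_mono[OF inf_le1])
  qed
  have "((\<lambda>n. measure_pmf.prob (random_regular n d) (good n)) \<longlongrightarrow> 1) ?F"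
    by (rule tendsto_sandwich[OF lower_ev _ lim tendsto_const]) (simp add: always_eventually)
  then show ?thesis unfolding good_def \<sigma>_def .
qed

theorem theorem1p4:
  shows "(\<forall>(V :: 'a set) E d. regular_graph d V E \<longrightarrow>
      (let n = real (card V); lam = graph_lambda V E in
         real (hopping_number V E)
           \<ge> max (1 - 2 * lam / real d) ((real d - lam) / (real d + 3 * lam)) * n \<and>
         max (1 - 2 * lam / real d) ((real d - lam) / (real d + 3 * lam)) * n
           = (1 - min (2 * lam / real d) (4 * lam / (real d + 3 * lam))) * n))
    \<and> (\<forall>(d :: nat) (\<epsilon> :: real). d \<ge> 3 \<longrightarrow> \<epsilon> > 0 \<longrightarrow>
      ((\<lambda>n. measure_pmf.prob (random_regular n d)
          {E. real (hopping_number {..<n} E) \<ge>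
             (1 - min (4 * sqrt (real d - 1) / real d)
                      (8 * sqrt (real d - 1) / (real d + 6 * sqrt (real d - 1))) - \<epsilon>) * real n})
        \<longlongrightarrow> 1) (inf sequentially (principal {n. even (d * n)})))"
proof (intro conjI allI impI)
  fix V :: "'a set" and E d
  assume "regular_graph d V E"
  from regular_hopping_number_ge[OF this]
  show "let n = real (card V); lam = graph_lambda V E in
         real (hopping_number V E)
           \<ge> max (1 - 2 * lam / real d) ((real d - lam) / (real d + 3 * lam)) * n \<and>
         max (1 - 2 * lam / real d) ((real d - lam) / (real d + 3 * lam)) * n
           = (1 - min (2 * lam / real d) (4 * lam / (real d + 3 * lam))) * n"
    unfolding Let_def by (rule conjI)
next
  fix d :: nat and \<epsilon> :: real
  assume d: "d \<ge> 3" and \<epsilon>: "\<epsilon> > 0"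
  have eq: "min (4 * sqrt (real d - 1) / real d)
      (8 * sqrt (real d - 1) / (real d + 6 * sqrt (real d - 1))) = 2 * hop_rate d"
    by (simp add: hop_rate_def)
  show "((\<lambda>n. measure_pmf.prob (random_regular n d)
          {E. real (hopping_number {..<n} E) \<ge>
             (1 - min (4 * sqrt (real d - 1) / real d)
                      (8 * sqrt (real d - 1) / (real d + 6 * sqrt (real d - 1))) - \<epsilon>) * real n})
        \<longlongrightarrow> 1) (inf sequentially (principal {n. even (d * n)}))"
    unfolding eq by (rule random_regular_hopping_number_ge[OF d \<epsilon>])
qed

end
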